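(* Let $\omega$ be a PD prehamiltonian system on a fiber bundle $\alpha:P\to M$ with connected fiber, such that $\ker\omega=\ker\underline{\omega}$. Assume that the leaves of the involutive distribution $D^\omega=\underline{D}^\omega$ form a smooth fiber bundle $\widetilde{\alpha}:\widetilde{P}\to M$ over $M$ in such a way that the canonical projection $\mathfrak{p}:P\to\widetilde{P}$ is a smooth bundle. Then there exists a unique PD Hamiltonian system $\widetilde{\omega}$ on $\widetilde{\alpha}$ such that 1) $\omega=\mathfrak{p}^*(\widetilde{\omega})$, 2) $\ker\widetilde{\omega}=\ker\underline{\widetilde{\omega}}=0$, and 3) a local section $\sigma$ of $\alpha$ is a solution of the PD Hamilton equations of $\omega$ if and only if $\mathfrak{p}\circ\sigma$ (which is a local section of $\widetilde{\alpha}$) is a solution of the PD Hamilton equations of $\widetilde{\omega}$.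
   Context: Everything is smooth; $n=\dim M$. For a fiber bundle $\alpha:P\to M$, $V\mathrm{D}$ is the module of $\alpha$-vertical vector fields on $P$ and $\Lambda_p^k$ is the module of $k$-forms $\omega$ on $P$ with $i_{Y_1}\cdots i_{Y_{k-p+1}}\omega=0$ for all $Y_j\in V\mathrm{D}$ (zero if $k<p$). Affine $q$-forms are identified with differential forms: $\Omega^q(P,\alpha):=\Lambda_{n-1}^{q+n-1}$, with $\Omega_0^q:=\Lambda_n^{q+n-1}\subset\Omega^q$ and $\underline{\Omega}^q:=\Omega^q/\Omega_0^q$; $\underline{\omega}$ is the class of $\omega$ in $\underline{\Omega}$; $\delta$ is the restriction of the de Rham differential to $\Omega=\bigoplus_q\Omega^q$. For $\omega\in\Omega^2$ put $\ker\omega:=\{Y\in V\mathrm{D}:i_Y\omega=0\}$, $\ker\underline{\omega}:=\{Y\in V\mathrm{D}:i_Y\underline{\omega}=0\}$ (the latter condition meaning $i_Wi_Y\omega=0$ for all $W\in V\mathrm{D}$), and for $y\in P$, $D^\omega_y:=\{\xi\in V_yP:i_\xi\omega_y=0\}$, $\underline{D}^\omega_y:=\{\xi\in V_yP:i_\eta i_\xi\omega_y=0\ \forall\eta\in V_yP\}$, with $V_yP$ the vertical tangent space; $\underline{D}^\omega$ is assumed to have constant rank. A PD prehamiltonian system on $\alpha$ is an $\omega\in\Omega^2$ with $\delta\omega=0$; it is a PD Hamiltonian system if moreover $\ker\underline{\omega}=0$. In the claim, $\ker\omega=\ker\underline{\omega}$ is equivalent to the existence of a connection $\nabla$ in $\alpha$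 with $i_\nabla\omega=0$, and by construction $\mathfrak{p}$ has connected fibers. A point $c$ of the first jet bundle $J^1\alpha$ over $y\in P$ is a complement $H_c$ of $V_yP$ in $T_yP$; $i_c\omega_y$ is the component of $\omega_y$ of horizontal degree $n$ with respect to $T_yP=V_yP\oplus H_c$ (for a connection $\nabla$, $i_\nabla\omega$ is defined pointwise). A solution of the PD Hamilton equations of $\omega$ is a local section $\sigma:U\to P$ of $\alpha$ with $i_{\dot{\sigma}(x)}\omega_{\sigma(x)}=0$ for all $x\in U$, $\dot{\sigma}$ being the first jet prolongation. In bundle coordinates $(x^i,y^a)$ with $\omega=\omega^i_{ab}dy^ady^bd^{n-1}x_i+\omega_ady^ad^nx$ ($\omega^i_{ab}=-\omega^i_{ba}$, $d^{n-1}x_i=i_{\partial_i}d^nx$) the equations read $2\omega^i_{ab}\partial_iy^a-\omega_b=0$. *)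

theory Defs
  imports "HOL-Analysis.Analysis" "HOL-Library.Function_Algebras"
begin

text \<open>Pointwise real vector space structure on functions. Tangent vectors are encoded below as
  functions, so that the library notions \<^const>\<open>subspace\<close> and \<^const>\<open>dim\<close> apply to them.\<close>

instantiation "fun" :: (type, real_vector) real_vector
begin

definition scaleR_fun :: "real \<Rightarrow> ('a \<Rightarrow> 'b) \<Rightarrow> 'a \<Rightarrow> 'b"
  where "scaleR_fun r f = (\<lambda>x. r *\<^sub>R f x)"

instance
  by standard (simp_all add: scaleR_fun_def plus_fun_def fun_eq_iff algebra_simps)

end


section \<open>Smooth manifolds\<close>

text \<open>Manifolds are modelled on finite-dimensional real normed spaces rather than on
  \<^class>\<open>euclidean_space\<close> types, because the latter have positive dimension, whereas fibres of
  dimension zero must be allowed.\<close>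

fun higher_differentiable_on ::
    "'a::real_normed_vector set \<Rightarrow> ('a \<Rightarrow> 'b::real_normed_vector) \<Rightarrow> nat \<Rightarrow> bool"
where
  "higher_differentiable_on S f 0 \<longleftrightarrow> continuous_on S f"
| "higher_differentiable_on S f (Suc k) \<longleftrightarrow>
     (\<forall>x\<in>S. f differentiable (at x)) \<and>
     (\<forall>v. higher_differentiable_on S (\<lambda>x. frechet_derivative f (at x) v) k)"

text \<open>Only used for open sets \<open>S\<close> in finite-dimensional spaces.\<close>

definition smooth_on :: "'a::real_normed_vector set \<Rightarrow> ('a \<Rightarrow> 'b::real_normed_vector) \<Rightarrow> bool"
  where "smooth_on S f \<longleftrightarrow> (\<forall>k. higher_differentiable_on S f k)"

type_synonym ('a, 'e) chart = "'a set \<times> ('a \<Rightarrow> 'e)"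

datatype ('a, 'e) manifold = Manifold (mtop: "'a topology") (atlas: "('a, 'e) chart set")

definition carrier :: "('a, 'e) manifold \<Rightarrow> 'a set"
  where "carrier M = topspace (mtop M)"

definition mdim :: "('a, 'e::real_normed_vector) manifold \<Rightarrow> nat"
  where "mdim M = dim (UNIV :: 'e set)"

definition chart_inv :: "('a, 'e) chart \<Rightarrow> 'e \<Rightarrow> 'a"
  where "chart_inv c = inv_into (fst c) (snd c)"

definition chart_image :: "('a, 'e) chart \<Rightarrow> 'e set"
  where "chart_image c = snd c ` fst c"

definition smooth_manifold :: "('a, 'e::real_normed_vector) manifold \<Rightarrow> bool"
where "smooth_manifold M \<longleftrightarrow>
    (\<exists>B :: 'e set. finite B \<and> span B = UNIV) \<and>
    Hausdorff_space (mtop M) \<and> second_countable (mtop M) \<and>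
    (\<Union>c\<in>atlas M. fst c) = carrier M \<and>
    (\<forall>c\<in>atlas M. openin (mtop M) (fst c) \<and> open (chart_image c) \<and>
        homeomorphic_map (subtopology (mtop M) (fst c))
          (subtopology euclidean (chart_image c)) (snd c)) \<and>
    (\<forall>c\<in>atlas M. \<forall>d\<in>atlas M. smooth_on (snd c ` (fst c \<inter> fst d)) (snd d \<circ> chart_inv c))"

text \<open>\<open>smooth_map M N S f\<close>: \<open>S\<close> is open in \<open>M\<close> and \<open>f\<close> restricted to \<open>S\<close> is a smooth map into \<open>N\<close>.\<close>

definition smooth_map ::
    "('a, 'd::real_normed_vector) manifold \<Rightarrow> ('b, 'e::real_normed_vector) manifold \<Rightarrow>
     'a set \<Rightarrow> ('a \<Rightarrow> 'b) \<Rightarrow> bool"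
where "smooth_map M N S f \<longleftrightarrow>
    openin (mtop M) S \<and>
    continuous_map (subtopology (mtop M) S) (mtop N) f \<and>
    (\<forall>c\<in>atlas M. \<forall>d\<in>atlas N.
        smooth_on (snd c ` (fst c \<inter> S \<inter> f -` fst d)) (snd d \<circ> f \<circ> chart_inv c))"

definition prod_manifold ::
    "('a, 'd) manifold \<Rightarrow> ('b, 'e) manifold \<Rightarrow> ('a \<times> 'b, 'd \<times> 'e) manifold"
where "prod_manifold M N =
    Manifold (prod_topology (mtop M) (mtop N))
      ((\<lambda>(c, d). (fst c \<times> fst d, map_prod (snd c) (snd d))) ` (atlas M \<times> atlas N))"


section \<open>Tangent vectors\<close>

text \<open>A tangent vector at \<open>y\<close> is the family of its component vectors in all charts around \<open>y\<close>,
  which have to transform by the derivatives of the transition maps. Since the base point is not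
  part of this encoding, it is always passed separately.\<close>

type_synonym ('a, 'e) tvec = "('a, 'e) chart \<Rightarrow> 'e"

definition charts_at :: "('a, 'e) manifold \<Rightarrow> 'a \<Rightarrow> ('a, 'e) chart set"
  where "charts_at M y = {c \<in> atlas M. y \<in> fst c}"

definition some_chart :: "('a, 'e) manifold \<Rightarrow> 'a \<Rightarrow> ('a, 'e) chart"
  where "some_chart M y = (SOME c. c \<in> charts_at M y)"

definition tangent_space ::
    "('a, 'e::real_normed_vector) manifold \<Rightarrow> 'a \<Rightarrow> ('a, 'e) tvec set"
where "tangent_space M y = {\<xi>.
    (\<forall>c\<in>charts_at M y. \<forall>d\<in>charts_at M y.
        \<xi> d = frechet_derivative (snd d \<circ> chart_inv c) (at (snd c y)) (\<xi> c)) \<and>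
    (\<forall>c. c \<notin> charts_at M y \<longrightarrow> \<xi> c = 0)}"

text \<open>The tangent vector at \<open>y\<close> with component vector \<open>w\<close> in the chart \<open>c\<close>.\<close>

definition coord_tvec ::
    "('a, 'e::real_normed_vector) manifold \<Rightarrow> ('a, 'e) chart \<Rightarrow> 'a \<Rightarrow> 'e \<Rightarrow> ('a, 'e) tvec"
where "coord_tvec M c y w = (\<lambda>d. if d \<in> charts_at M y
    then frechet_derivative (snd d \<circ> chart_inv c) (at (snd c y)) w else 0)"

text \<open>The tangent map of \<open>f\<close> at \<open>y\<close>; by the chain rule it does not depend on the chosen chart of
  \<open>M\<close>. Only the germ of \<open>f\<close> at \<open>y\<close> matters.\<close>

definition tangent_map ::
    "('a, 'd::real_normed_vector) manifold \<Rightarrow> ('b, 'e::real_normed_vector) manifold \<Rightarrow>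
     ('a \<Rightarrow> 'b) \<Rightarrow> 'a \<Rightarrow> ('a, 'd) tvec \<Rightarrow> ('b, 'e) tvec"
where "tangent_map M N f y \<xi> = (\<lambda>d. if d \<in> charts_at N (f y)
    then let c = some_chart M y
         in frechet_derivative (snd d \<circ> f \<circ> chart_inv c) (at (snd c y)) (\<xi> c)
    else 0)"


section \<open>Differential forms\<close>

text \<open>A \<open>k\<close>-form takes a point and the list of its \<open>k\<close> tangent vector arguments. Forms vanish by
  convention on all improper arguments, so that equality of forms is equality of functions.\<close>

type_synonym ('a, 'e) form = "'a \<Rightarrow> ('a, 'e) tvec list \<Rightarrow> real"

definition alternating_form :: "'v::real_vector set \<Rightarrow> nat \<Rightarrow> ('v list \<Rightarrow> real) \<Rightarrow> bool"
where "alternating_form T k f \<longleftrightarrow>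
    (\<forall>vs. \<not> (length vs = k \<and> set vs \<subseteq> T) \<longrightarrow> f vs = 0) \<and>
    (\<forall>vs i. length vs = k \<and> set vs \<subseteq> T \<and> i < k \<longrightarrow>
       (\<forall>u\<in>T. \<forall>v\<in>T. \<forall>a b.
          f (vs[i := a *\<^sub>R u + b *\<^sub>R v]) = a * f (vs[i := u]) + b * f (vs[i := v]))) \<and>
    (\<forall>vs i j. length vs = k \<and> set vs \<subseteq> T \<and> i < j \<and> j < k \<and> vs ! i = vs ! j \<longrightarrow> f vs = 0)"

definition forms :: "('a, 'e::real_normed_vector) manifold \<Rightarrow> nat \<Rightarrow> ('a, 'e) form set"
where "forms M k = {\<omega>.
    (\<forall>y. y \<notin> carrier M \<longrightarrow> \<omega> y = 0) \<and>
    (\<forall>y\<in>carrier M. alternating_form (tangent_space M y) k (\<omega> y)) \<and>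
    (\<forall>c\<in>atlas M. \<forall>ws. length ws = k \<longrightarrow>
       smooth_on (chart_image c)
         (\<lambda>x. \<omega> (chart_inv c x) (map (coord_tvec M c (chart_inv c x)) ws)))}"

text \<open>The de Rham differential, computed in a chart by
  \<open>d\<omega>(w\<^sub>0, \<dots>, w\<^sub>k) = (\<Sum>i. (-1)^i * D\<^bsub>w\<^sub>i\<^esub> (\<omega>(w\<^sub>0, \<dots>, omit w\<^sub>i, \<dots>, w\<^sub>k)))\<close> for constant coordinate vectors \<open>w\<^sub>i\<close>;
  on forms the value does not depend on the chart.\<close>

definition ext_deriv ::
    "('a, 'e::real_normed_vector) manifold \<Rightarrow> ('a, 'e) form \<Rightarrow> ('a, 'e) form"
where "ext_deriv M \<omega> = (\<lambda>y \<xi>s.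
    if y \<in> carrier M \<and> set \<xi>s \<subseteq> tangent_space M y then
      let c = some_chart M y; ws = map (\<lambda>\<xi>. \<xi> c) \<xi>s
      in \<Sum>i<length ws. (-1) ^ i *
           frechet_derivative
             (\<lambda>x. \<omega> (chart_inv c x)
                (map (coord_tvec M c (chart_inv c x)) (take i ws @ drop (Suc i) ws)))
             (at (snd c y)) (ws ! i)
    else 0)"

definition pullback ::
    "('a, 'd::real_normed_vector) manifold \<Rightarrow> ('b, 'e::real_normed_vector) manifold \<Rightarrow>
     ('a \<Rightarrow> 'b) \<Rightarrow> ('b, 'e) form \<Rightarrow> ('a, 'd) form"
where "pullback M N f \<omega> = (\<lambda>y \<xi>s.
    if y \<in> carrier M \<and> set \<xi>s \<subseteq> tangent_space M y
    then \<omega> (f y) (map (tangent_map M N f y) \<xi>s) else 0)"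

definition interior :: "('a \<Rightarrow> ('a, 'e) tvec) \<Rightarrow> ('a, 'e) form \<Rightarrow> ('a, 'e) form"
  where "interior Y \<omega> = (\<lambda>y \<xi>s. \<omega> y (Y y # \<xi>s))"


section \<open>Fibre bundles\<close>

definition fiber_bundle ::
    "('p, 'e::real_normed_vector) manifold \<Rightarrow> ('m, 'b::real_normed_vector) manifold \<Rightarrow>
     ('f, 'g::real_normed_vector) manifold \<Rightarrow> ('p \<Rightarrow> 'm) \<Rightarrow> bool"
where "fiber_bundle P M F \<alpha> \<longleftrightarrow>
    smooth_manifold P \<and> smooth_manifold M \<and> smooth_manifold F \<and>
    smooth_map P M (carrier P) \<alpha> \<and> \<alpha> ` carrier P = carrier M \<and>
    (\<forall>x\<in>carrier M. \<exists>U \<Psi>. openin (mtop M) U \<and> x \<in> U \<and>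
       bij_betw \<Psi> (carrier P \<inter> \<alpha> -` U) (U \<times> carrier F) \<and>
       (\<forall>y\<in>carrier P \<inter> \<alpha> -` U. fst (\<Psi> y) = \<alpha> y) \<and>
       smooth_map P (prod_manifold M F) (carrier P \<inter> \<alpha> -` U) \<Psi> \<and>
       smooth_map (prod_manifold M F) P (U \<times> carrier F)
         (inv_into (carrier P \<inter> \<alpha> -` U) \<Psi>))"

definition vertical_space ::
    "('p, 'e::real_normed_vector) manifold \<Rightarrow> ('m, 'b::real_normed_vector) manifold \<Rightarrow>
     ('p \<Rightarrow> 'm) \<Rightarrow> 'p \<Rightarrow> ('p, 'e) tvec set"
where "vertical_space P M \<alpha> y = {\<xi> \<in> tangent_space P y. tangent_map P M \<alpha> y \<xi> = 0}"

definition vertical_fields ::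
    "('p, 'e::real_normed_vector) manifold \<Rightarrow> ('m, 'b::real_normed_vector) manifold \<Rightarrow>
     ('p \<Rightarrow> 'm) \<Rightarrow> ('p \<Rightarrow> ('p, 'e) tvec) set"
where "vertical_fields P M \<alpha> = {Y.
    (\<forall>y. y \<notin> carrier P \<longrightarrow> Y y = 0) \<and>
    (\<forall>y\<in>carrier P. Y y \<in> vertical_space P M \<alpha> y) \<and>
    (\<forall>c\<in>atlas P. smooth_on (chart_image c) (\<lambda>x. Y (chart_inv c x) c))}"

definition Lambda_forms ::
    "('p, 'e::real_normed_vector) manifold \<Rightarrow> ('m, 'b::real_normed_vector) manifold \<Rightarrow>
     ('p \<Rightarrow> 'm) \<Rightarrow> nat \<Rightarrow> nat \<Rightarrow> ('p, 'e) form set"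
where "Lambda_forms P M \<alpha> p k =
    (if k < p then {0}
     else {\<omega> \<in> forms P k.
       \<forall>Ys. set Ys \<subseteq> vertical_fields P M \<alpha> \<and> length Ys = k - p + 1 \<longrightarrow> foldr interior Ys \<omega> = 0})"

text \<open>The affine \<open>q\<close>-forms \<open>\<Omega>\<^sup>q(P, \<alpha>)\<close>, identified with differential forms.\<close>

definition Omega ::
    "('p, 'e::real_normed_vector) manifold \<Rightarrow> ('m, 'b::real_normed_vector) manifold \<Rightarrow>
     ('p \<Rightarrow> 'm) \<Rightarrow> nat \<Rightarrow> ('p, 'e) form set"
where "Omega P M \<alpha> q = Lambda_forms P M \<alpha> (mdim M - 1) (q + mdim M - 1)"

definition ker_form ::
    "('p, 'e::real_normed_vector) manifold \<Rightarrow> ('m, 'b::real_normed_vector) manifold \<Rightarrow>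
     ('p \<Rightarrow> 'm) \<Rightarrow> ('p, 'e) form \<Rightarrow> ('p \<Rightarrow> ('p, 'e) tvec) set"
where "ker_form P M \<alpha> \<omega> = {Y \<in> vertical_fields P M \<alpha>. interior Y \<omega> = 0}"

text \<open>The kernel of the class \<open>\<omega>\<close> modulo \<open>\<Omega>\<^sub>0\<close>: the class of \<open>i\<^sub>Y \<omega>\<close> vanishes iff \<open>i\<^sub>Y \<omega>\<close> is annihilated by all
  vertical fields.\<close>

definition ker_form_class ::
    "('p, 'e::real_normed_vector) manifold \<Rightarrow> ('m, 'b::real_normed_vector) manifold \<Rightarrow>
     ('p \<Rightarrow> 'm) \<Rightarrow> ('p, 'e) form \<Rightarrow> ('p \<Rightarrow> ('p, 'e) tvec) set"
where "ker_form_class P M \<alpha> \<omega> =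
    {Y \<in> vertical_fields P M \<alpha>.
       \<forall>W\<in>vertical_fields P M \<alpha>. interior W (interior Y \<omega>) = 0}"

definition PD_prehamiltonian ::
    "('p, 'e::real_normed_vector) manifold \<Rightarrow> ('m, 'b::real_normed_vector) manifold \<Rightarrow>
     ('p \<Rightarrow> 'm) \<Rightarrow> ('p, 'e) form \<Rightarrow> bool"
where "PD_prehamiltonian P M \<alpha> \<omega> \<longleftrightarrow> \<omega> \<in> Omega P M \<alpha> 2 \<and> ext_deriv P \<omega> = 0"

definition PD_hamiltonian ::
    "('p, 'e::real_normed_vector) manifold \<Rightarrow> ('m, 'b::real_normed_vector) manifold \<Rightarrow>
     ('p \<Rightarrow> 'm) \<Rightarrow> ('p, 'e) form \<Rightarrow> bool"
where "PD_hamiltonian P M \<alpha> \<omega> \<longleftrightarrow>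
    PD_prehamiltonian P M \<alpha> \<omega> \<and> ker_form_class P M \<alpha> \<omega> = {0}"


section \<open>Kernel distributions and their leaves\<close>

definition kernel_dist ::
    "('p, 'e::real_normed_vector) manifold \<Rightarrow> ('m, 'b::real_normed_vector) manifold \<Rightarrow>
     ('p \<Rightarrow> 'm) \<Rightarrow> ('p, 'e) form \<Rightarrow> 'p \<Rightarrow> ('p, 'e) tvec set"
where "kernel_dist P M \<alpha> \<omega> y =
    {\<xi> \<in> vertical_space P M \<alpha> y. \<forall>\<xi>s. \<omega> y (\<xi> # \<xi>s) = 0}"

definition kernel_dist_class ::
    "('p, 'e::real_normed_vector) manifold \<Rightarrow> ('m, 'b::real_normed_vector) manifold \<Rightarrow>
     ('p \<Rightarrow> 'm) \<Rightarrow> ('p, 'e) form \<Rightarrow> 'p \<Rightarrow> ('p, 'e) tvec set"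
where "kernel_dist_class P M \<alpha> \<omega> y =
    {\<xi> \<in> vertical_space P M \<alpha> y.
       \<forall>\<eta>\<in>vertical_space P M \<alpha> y. \<forall>\<xi>s. \<omega> y (\<xi> # \<eta> # \<xi>s) = 0}"

definition constant_rank ::
    "('p, 'e::real_normed_vector) manifold \<Rightarrow> ('p \<Rightarrow> ('p, 'e) tvec set) \<Rightarrow> bool"
where "constant_rank P D \<longleftrightarrow> (\<exists>r. \<forall>y\<in>carrier P. dim (D y) = r)"

text \<open>Nonempty connected integral manifolds, immersed in \<open>P\<close> by the inclusion map; the topology
  of \<open>N\<close> may be finer than the subspace topology.\<close>

definition connected_integral_manifold ::
    "('p, 'e::real_normed_vector) manifold \<Rightarrow> ('p \<Rightarrow> ('p, 'e) tvec set) \<Rightarrow>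
     ('p, 'k::real_normed_vector) manifold \<Rightarrow> bool"
where "connected_integral_manifold P D N \<longleftrightarrow>
    smooth_manifold N \<and> carrier N \<noteq> {} \<and> connected_space (mtop N) \<and>
    carrier N \<subseteq> carrier P \<and> smooth_map N P (carrier N) id \<and>
    (\<forall>y\<in>carrier N. inj_on (tangent_map N P id y) (tangent_space N y) \<and>
       tangent_map N P id y ` tangent_space N y = D y)"

text \<open>The leaves of \<open>D\<close>, that is, its maximal connected integral manifolds. The type argument
  provides the model space of the leaves; unless its dimension equals the rank of \<open>D\<close>, there are
  no integral manifolds modelled on it.\<close>

definition leaves ::
    "'k::real_normed_vector itself \<Rightarrow> ('p, 'e::real_normed_vector) manifold \<Rightarrow>
     ('p \<Rightarrow> ('p, 'e) tvec set) \<Rightarrow> 'p set set"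
where "leaves TYPE('k) P D = {L. \<exists>N :: ('p, 'k) manifold.
    connected_integral_manifold P D N \<and> carrier N = L \<and>
    (\<forall>N' :: ('p, 'k) manifold. connected_integral_manifold P D N' \<and> L \<subseteq> carrier N' \<longrightarrow>
       carrier N' = L)}"


section \<open>Jets and the PD Hamilton equations\<close>

text \<open>Points of the first jet bundle over \<open>y\<close>, as complements of the vertical space.\<close>

definition jet_points ::
    "('p, 'e::real_normed_vector) manifold \<Rightarrow> ('m, 'b::real_normed_vector) manifold \<Rightarrow>
     ('p \<Rightarrow> 'm) \<Rightarrow> 'p \<Rightarrow> ('p, 'e) tvec set set"
where "jet_points P M \<alpha> y = {H.
    subspace H \<and> H \<inter> vertical_space P M \<alpha> y = {0} \<and>
    {h + v | h v. h \<in> H \<and> v \<in> vertical_space P M \<alpha> y} = tangent_space P y}"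

definition horizontal_part :: "'v::real_vector set \<Rightarrow> 'v set \<Rightarrow> 'v \<Rightarrow> 'v"
  where "horizontal_part H V \<xi> = (THE h. h \<in> H \<and> \<xi> - h \<in> V)"

text \<open>The component of horizontal degree \<open>n\<close> of a form on \<open>V \<oplus> H\<close>: the sum of its values with
  horizontal parts inserted in exactly \<open>n\<close> argument positions \<open>S\<close>, and vertical parts in the
  others.\<close>

definition horizontal_component ::
    "'v::real_vector set \<Rightarrow> 'v set \<Rightarrow> nat \<Rightarrow> ('v list \<Rightarrow> real) \<Rightarrow> 'v list \<Rightarrow> real"
where "horizontal_component H V n f \<xi>s =
    (\<Sum>S | S \<subseteq> {..<length \<xi>s} \<and> card S = n.
       f (map (\<lambda>i. if i \<in> S then horizontal_part H V (\<xi>s ! i)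
                   else \<xi>s ! i - horizontal_part H V (\<xi>s ! i)) [0..<length \<xi>s]))"

text \<open>The contraction \<open>i\<^sub>c \<omega>\<^sub>y\<close> with the jet point \<open>c\<close> over \<open>y\<close> given by the complement \<open>H\<close>.\<close>

definition jet_contraction ::
    "('p, 'e::real_normed_vector) manifold \<Rightarrow> ('m, 'b::real_normed_vector) manifold \<Rightarrow>
     ('p \<Rightarrow> 'm) \<Rightarrow> 'p \<Rightarrow> ('p, 'e) tvec set \<Rightarrow> ('p, 'e) form \<Rightarrow> ('p, 'e) tvec list \<Rightarrow> real"
where "jet_contraction P M \<alpha> y H \<omega> = (\<lambda>\<xi>s.
    if set \<xi>s \<subseteq> tangent_space P y
    then horizontal_component H (vertical_space P M \<alpha> y) (mdim M) (\<omega> y) \<xi>s else 0)"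

definition local_section ::
    "('p, 'e::real_normed_vector) manifold \<Rightarrow> ('m, 'b::real_normed_vector) manifold \<Rightarrow>
     ('p \<Rightarrow> 'm) \<Rightarrow> 'm set \<Rightarrow> ('m \<Rightarrow> 'p) \<Rightarrow> bool"
where "local_section P M \<alpha> U \<sigma> \<longleftrightarrow> smooth_map M P U \<sigma> \<and> (\<forall>x\<in>U. \<alpha> (\<sigma> x) = x)"

definition jet_prolongation ::
    "('p, 'e::real_normed_vector) manifold \<Rightarrow> ('m, 'b::real_normed_vector) manifold \<Rightarrow>
     ('m \<Rightarrow> 'p) \<Rightarrow> 'm \<Rightarrow> ('p, 'e) tvec set"
where "jet_prolongation P M \<sigma> x = tangent_map M P \<sigma> x ` tangent_space M x"

definition PD_solution ::
    "('p, 'e::real_normed_vector) manifold \<Rightarrow> ('m, 'b::real_normed_vector) manifold \<Rightarrow>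
     ('p \<Rightarrow> 'm) \<Rightarrow> ('p, 'e) form \<Rightarrow> 'm set \<Rightarrow> ('m \<Rightarrow> 'p) \<Rightarrow> bool"
where "PD_solution P M \<alpha> \<omega> U \<sigma> \<longleftrightarrow>
    local_section P M \<alpha> U \<sigma> \<and>
    (\<forall>x\<in>U. jet_prolongation P M \<sigma> x \<in> jet_points P M \<alpha> (\<sigma> x) \<and>
       jet_contraction P M \<alpha> (\<sigma> x) (jet_prolongation P M \<sigma> x) \<omega> = 0)"

end

(*
The form descends pointwise. A connected integral manifold through y, modelled on the same space as the
fibres of \<pp>, has tangent space ker (T\<pp>) by a dimension count, so ker (T\<pp>) is the kernel of \<omega>.
Contracting d\<omega> = 0 with such a vector shows that in a trivialization of \<pp> the coefficients of \<omega> do not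
change along the leaf; since leaves are connected, \<omega>'(T\<pp> \<xi>, ...) := \<omega>(\<xi>, ...) is well defined, and it is
smooth and closed because it is locally the pullback of \<omega> along a section of \<pp>. Nondegeneracy of \<omega>' needs
equality of the two kernels at each point, whereas the hypothesis speaks of global vertical fields: the constant
rank provides local sections of the kernel of the class of \<omega> through any given vector, and bump functions make
them global.
*)

theory Submission
  imports Defs
begin

section \<open>Finite-dimensional normed spaces\<close>

text \<open>The model spaces are normed spaces known only to have a finite spanning set, dimension
  zero included, and smoothness differentiates in constant directions. Whenever a direction, or an
  argument of a form, depends on the point, it is therefore expanded in a basis; that coordinates
  are bounded linear makes this legitimate. Tangent vectors carry one component per chart, and both
  \<open>tangent_map\<close> and \<open>ext_deriv\<close> pick an arbitrary chart. To escape these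
  choices, everything is moved to \<open>param\<close> maps from open sets of vector spaces, with
  tangent vectors written as \<open>push\<close>. Closedness passes to every such map by naturality
  of d, which must therefore be available for arbitrary smooth maps and not only for chart changes:
  it is applied to trivializations of \<pp>, in whose coordinates directions along the leaves are
  constant, and to local sections of \<pp>. The reduced form is defined by arbitrary choices of a
  point in the leaf and of lifts of vectors. Each of its properties is obtained by first trading
  these choices for ones that are linear or smooth.\<close>

definition finite_dim :: "'a::real_vector itself \<Rightarrow> bool"
  where "finite_dim (_::'a itself) \<longleftrightarrow> (\<exists>B::'a set. finite B \<and> span B = UNIV)"

lemma finite_dim_basis:
  assumes "finite_dim TYPE('a::real_vector)"
  obtains B :: "'a::real_vector set" where "finite B" "independent B" "span B = UNIV"
proof -
  obtain B0 :: "'a set" where B0: "finite B0" "span B0 = UNIV"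
    using assms unfolding finite_dim_def by blast
  obtain B where B: "B \<subseteq> B0" "independent B" "B0 \<subseteq> span B"
    using maximal_independent_subset[of B0] by blast
  have "span B = UNIV" using B(3) B0(2) span_minimal[OF B(3) subspace_span] by auto
  then show ?thesis using B B0 that finite_subset by blast
qed

lemma finite_dim_real: "finite_dim TYPE(real)"
proof -
  have "x \<in> span {1::real}" for x
    using span_scale[OF span_base[of "1::real" "{1}"], of x] by simp
  then have "span {1::real} = UNIV" by auto
  then show ?thesis unfolding finite_dim_def by blast
qed

lemma finite_dim_prod:
  assumes "finite_dim TYPE('a::real_vector)" "finite_dim TYPE('b::real_vector)"
  shows "finite_dim TYPE('a \<times> 'b)"
proof -
  obtain A :: "'a set" where A: "finite A" "span A = UNIV"
    using assms(1) unfolding finite_dim_def by blast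
  obtain B :: "'b set" where B: "finite B" "span B = UNIV"
    using assms(2) unfolding finite_dim_def by blast
  let ?S = "(\<lambda>a. (a, 0::'b)) ` A \<union> (\<lambda>b. (0::'a, b)) ` B"
  have lin: "linear (\<lambda>a::'a. (a, 0::'b))" "linear (\<lambda>b::'b. (0::'a, b))"
    by (auto intro!: linearI)
  have "(x, y) \<in> span ?S" for x y
  proof -
    have "(x, 0) \<in> span ((\<lambda>a. (a, 0::'b)) ` A)"
      using linear_span_image[OF lin(1), of A] A by auto
    moreover have "(0, y) \<in> span ((\<lambda>b. (0::'a, b)) ` B)"
      using linear_span_image[OF lin(2), of B] B by auto
    ultimately have "(x, 0) + (0, y) \<in> span ?S"
      by (intro span_add) (meson Un_upper1 Un_upper2 span_mono subsetD)+
    then show ?thesis by simp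
  qed
  then have "span ?S = UNIV" by auto
  moreover have "finite ?S" using A B by simp
  ultimately show ?thesis unfolding finite_dim_def by blast
qed

section \<open>Boundedness of coordinates in finite dimension\<close>

definition coord_cube :: "'a::real_normed_vector set \<Rightarrow> real \<Rightarrow> 'a set"
  where "coord_cube B r = {(\<Sum>b\<in>B. c b *\<^sub>R b) | c. \<forall>b\<in>B. \<bar>c b\<bar> \<le> r}"

text \<open>Each new vector contributes one factor: the cube is a continuous image of an interval
  times the smaller cube. Compactness of balls in the model space is not presupposed.\<close>

lemma compact_coord_cube:
  assumes "finite B" shows "compact (coord_cube B r)"
  using assms
proof (induction B)
  case empty
  have "coord_cube {} r = {0::'a}" by (auto simp: coord_cube_def)
  then show ?case by simp
next
  case (insert b B)
  have "coord_cube (insert b B) r = (\<lambda>(t, w). t *\<^sub>R b + w) ` ({-r..r} \<times> coord_cube B r)"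
  proof (intro equalityI subsetI)
    fix v assume "v \<in> coord_cube (insert b B) r"
    then obtain c where "v = (\<Sum>b\<in>insert b B. c b *\<^sub>R b)" "\<forall>b\<in>insert b B. \<bar>c b\<bar> \<le> r"
      unfolding coord_cube_def by blast
    then show "v \<in> (\<lambda>(t, w). t *\<^sub>R b + w) ` ({-r..r} \<times> coord_cube B r)"
      using insert.hyps
      by (intro image_eqI[where x = "(c b, \<Sum>b\<in>B. c b *\<^sub>R b)"]) (auto simp: coord_cube_def abs_le_iff)
  next
    fix v assume "v \<in> (\<lambda>(t, w). t *\<^sub>R b + w) ` ({-r..r} \<times> coord_cube B r)"
    then obtain t c where tc: "v = t *\<^sub>R b + (\<Sum>b\<in>B. c b *\<^sub>R b)" "\<forall>b\<in>B. \<bar>c b\<bar> \<le> r" "t \<in> {-r..r}"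
      unfolding coord_cube_def by auto
    have "(\<Sum>b'\<in>insert b B. (c(b := t)) b' *\<^sub>R b') = v"
      using insert.hyps tc by (auto intro!: sum.cong)
    moreover have "\<forall>b'\<in>insert b B. \<bar>(c(b := t)) b'\<bar> \<le> r" using tc by auto
    ultimately show "v \<in> coord_cube (insert b B) r" unfolding coord_cube_def by blast
  qed
  moreover have "continuous_on ({-r..r} \<times> coord_cube B r) (\<lambda>(t, w). t *\<^sub>R b + w)"
    unfolding case_prod_unfold by (intro continuous_intros)
  ultimately show ?case
    using insert.IH compact_Times[OF compact_Icc] compact_continuous_image by metis
qed

lemma independent_sum_zero:
  assumes "finite B" "independent B" "(\<Sum>b\<in>B. c b *\<^sub>R b) = 0" "b \<in> B"
  shows "c b = 0"
  using assms independent_explicit_finite_subsets[of B] by (meson order_refl)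

text \<open>By independence, the compact set of combinations with coefficient 1 at \<open>b0\<close>
  and all others in [-1, 1] misses 0, so the norm has a positive minimum on it.\<close>

lemma coord_norm_lower_bound:
  fixes B :: "'a::real_normed_vector set"
  assumes "finite B" "independent B" "b0 \<in> B"
  obtains \<delta> where "\<delta> > 0"
    "\<And>c. c b0 = 1 \<Longrightarrow> \<forall>b\<in>B. \<bar>c b\<bar> \<le> 1 \<Longrightarrow> \<delta> \<le> norm (\<Sum>b\<in>B. c b *\<^sub>R b)"
proof -
  let ?K = "(\<lambda>w. b0 + w) ` coord_cube (B - {b0}) 1"
  have K: "compact ?K"
    using assms by (intro compact_continuous_image compact_coord_cube continuous_intros) auto
  have in_K: "(\<Sum>b\<in>B. c b *\<^sub>R b) \<in> ?K" if "c b0 = 1" "\<forall>b\<in>B. \<bar>c b\<bar> \<le> 1" for c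
  proof -
    have "(\<Sum>b\<in>B. c b *\<^sub>R b) = b0 + (\<Sum>b\<in>B - {b0}. c b *\<^sub>R b)"
      using assms that by (simp add: sum.remove)
    then show ?thesis using that unfolding coord_cube_def by blast
  qed
  have "0 \<notin> ?K"
  proof
    assume "0 \<in> ?K"
    then obtain c where c: "0 = b0 + (\<Sum>b\<in>B - {b0}. c b *\<^sub>R b)" unfolding coord_cube_def by auto
    let ?c = "c(b0 := 1)"
    have "(\<Sum>b\<in>B. ?c b *\<^sub>R b) = b0 + (\<Sum>b\<in>B - {b0}. ?c b *\<^sub>R b)"
      using assms by (simp add: sum.remove)
    also have "(\<Sum>b\<in>B - {b0}. ?c b *\<^sub>R b) = (\<Sum>b\<in>B - {b0}. c b *\<^sub>R b)" by (intro sum.cong) auto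
    finally have "?c b0 = 0" using c assms independent_sum_zero[of B ?c b0] by simp
    then show False by simp
  qed
  have "(\<Sum>b\<in>B. (if b = b0 then 1 else 0) *\<^sub>R b) \<in> ?K" by (rule in_K) auto
  then have ne: "?K \<noteq> {}" by blast
  obtain k where k: "k \<in> ?K" "\<And>y. y \<in> ?K \<Longrightarrow> norm k \<le> norm y"
    using continuous_attains_inf[OF K ne, of norm] continuous_on_norm_id by blast
  show ?thesis
  proof
    show "norm k > 0" using k \<open>0 \<notin> ?K\<close> by auto
  qed (use k in_K in blast)
qed

text \<open>After division by the coefficient of largest absolute value, attained at
  \<open>b0\<close>, the lower bound for \<open>b0\<close> applies and controls all coefficients by
  the norm.\<close>

lemma bounded_linear_representation:
  fixes B :: "'a::real_normed_vector set"
  assumes B: "finite B" "independent B" "span B = UNIV"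
  shows "bounded_linear (\<lambda>v. representation B v b)"
proof -
  have "\<exists>\<delta>>0. \<forall>c. c b0 = 1 \<longrightarrow> (\<forall>b\<in>B. \<bar>c b\<bar> \<le> 1) \<longrightarrow> \<delta> \<le> norm (\<Sum>b\<in>B. c b *\<^sub>R b)" if "b0 \<in> B" for b0
    using coord_norm_lower_bound[OF B(1,2) that] by metis
  then obtain \<delta> where \<delta>: "\<And>b0. b0 \<in> B \<Longrightarrow> \<delta> b0 > 0"
    "\<And>b0 c. b0 \<in> B \<Longrightarrow> c b0 = 1 \<Longrightarrow> \<forall>b\<in>B. \<bar>c b\<bar> \<le> 1 \<Longrightarrow> \<delta> b0 \<le> norm (\<Sum>b\<in>B. c b *\<^sub>R b)"
    by metis
  \<comment> \<open>Which basis vector carries the largest coefficient depends on the vector; the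
    sum over \<open>B\<close> dominates every possible 1 / \<delta>.\<close>
  let ?K = "\<Sum>b\<in>B. 1 / \<delta> b"
  have "\<bar>representation B v b\<bar> \<le> norm v * ?K" for v
  proof (cases "\<exists>b\<in>B. representation B v b \<noteq> 0")
    case False
    then have "representation B v b = 0" using representation_ne_zero by metis
    then show ?thesis using \<delta>(1) by (auto intro!: mult_nonneg_nonneg sum_nonneg simp: less_imp_le)
  next
    case True
    let ?r = "representation B v"
    let ?m = "Max ((\<lambda>b. \<bar>?r b\<bar>) ` B)"
    have "?m \<in> (\<lambda>b. \<bar>?r b\<bar>) ` B" using True B by (intro Max_in) auto
    then obtain b0 where b0: "b0 \<in> B" "\<bar>?r b0\<bar> = ?m" by auto
    have le: "\<bar>?r b'\<bar> \<le> \<bar>?r b0\<bar>" if "b' \<in> B" for b' using B b0 that by simp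
    then have nz: "?r b0 \<noteq> 0" using True by force
    let ?c = "\<lambda>b. ?r b / ?r b0"
    have "\<delta> b0 \<le> norm (\<Sum>b\<in>B. ?c b *\<^sub>R b)"
      using b0 nz le by (intro \<delta>(2)) (auto simp: divide_simps)
    also have "(\<Sum>b\<in>B. ?c b *\<^sub>R b) = (1 / ?r b0) *\<^sub>R (\<Sum>b\<in>B. ?r b *\<^sub>R b)"
      by (simp add: scaleR_sum_right)
    also have "(\<Sum>b\<in>B. ?r b *\<^sub>R b) = v" using B by (intro sum_representation_eq) auto
    finally have "\<bar>?r b0\<bar> \<le> norm v * (1 / \<delta> b0)"
      using \<delta>(1)[OF b0(1)] nz by (simp add: divide_simps mult.commute)
    also have "\<dots> \<le> norm v * ?K"
      using B b0 \<delta>(1) by (intro mult_left_mono member_le_sum) (auto simp: less_imp_le)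
    finally show ?thesis
      using le[of b] representation_ne_zero[of B v b] nz by (cases "b \<in> B") force+
  qed
  then show ?thesis
    using B by (intro bounded_linear_intro[where K = ?K])
      (auto simp: real_vector.representation_add real_vector.representation_scale)
qed

lemma linear_expansion:
  assumes "finite B" "independent B" "span B = UNIV" "linear f"
  shows "f v = (\<Sum>b\<in>B. representation B v b *\<^sub>R f b)"
proof -
  have "f (\<Sum>b\<in>B. representation B v b *\<^sub>R b) = (\<Sum>b\<in>B. representation B v b *\<^sub>R f b)"
    by (simp add: linear_sum[OF assms(4)] linear_scale[OF assms(4)])
  moreover have "(\<Sum>b\<in>B. representation B v b *\<^sub>R b) = v"
    using assms by (intro sum_representation_eq) auto
  ultimately show ?thesis by simp
qed

section \<open>Dimension arguments over a finite spanning set\<close>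

lemma finite_dim_linear_injective_surjective:
  fixes f :: "'a::real_vector \<Rightarrow> 'a"
  assumes "finite_dim TYPE('a)" "linear f" "inj f"
  shows "surj f"
proof -
  obtain B :: "'a set" where B: "finite B" "independent B" "span B = UNIV"
    using finite_dim_basis[OF assms(1)] .
  interpret F: finite_dimensional_vector_space "(*\<^sub>R) :: real \<Rightarrow> 'a \<Rightarrow> 'a" B
    using B by unfold_locales (simp_all add: dependent_raw_def span_raw_def)
  interpret FP: finite_dimensional_vector_space_pair "(*\<^sub>R) :: real \<Rightarrow> 'a \<Rightarrow> 'a" B "(*\<^sub>R) :: real \<Rightarrow> 'a \<Rightarrow> 'a" B
    by unfold_locales
  show ?thesis
    using assms(2,3) by (intro FP.linear_injective_imp_surjective) (auto simp: linear_def)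
qed

lemma finite_dim_dim_image:
  fixes f :: "'a::real_vector \<Rightarrow> 'b::real_vector"
  assumes "finite_dim TYPE('a)" "linear f" "subspace S" "inj_on f S"
  shows "dim (f ` S) = dim S"
proof -
  obtain B :: "'a set" where B: "finite B" "independent B" "span B = UNIV"
    using finite_dim_basis[OF assms(1)] .
  interpret F: finite_dimensional_vector_space_pair_1 "(*\<^sub>R) :: real \<Rightarrow> 'a \<Rightarrow> 'a" B "(*\<^sub>R) :: real \<Rightarrow> 'b \<Rightarrow> 'b"
    using B by unfold_locales (simp_all add: dependent_raw_def span_raw_def scaleR_add_right scaleR_add_left)
  show ?thesis
    using F.dim_image_eq[of f S] assms span_eq_iff[of S] by (simp add: linear_def dim_raw_def span_raw_def)
qed

lemma finite_dim_dim_psubset: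
  fixes S T :: "'a::real_vector set"
  assumes "finite_dim TYPE('a)" "subspace S" "subspace T" "S \<subset> T"
  shows "dim S < dim T"
proof -
  obtain B :: "'a set" where B: "finite B" "independent B" "span B = UNIV"
    using finite_dim_basis[OF assms(1)] .
  interpret F: finite_dimensional_vector_space "(*\<^sub>R) :: real \<Rightarrow> 'a \<Rightarrow> 'a" B
    using B by unfold_locales (simp_all add: dependent_raw_def span_raw_def)
  show ?thesis
    using F.dim_psubset[of S T] assms by (metis dim_raw_def span_raw_def span_eq_iff)
qed

section \<open>Smooth maps between normed spaces\<close>

text \<open>This holds without differentiability: both functions have the same derivatives at
  \<open>x\<close>, so the choice operator picks the same one.\<close>

lemma frechet_derivative_cong_open:
  assumes "open S" "x \<in> S" "\<And>y. y \<in> S \<Longrightarrow> f y = g y"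
  shows "frechet_derivative f (at x) = frechet_derivative g (at x)"
proof -
  have "(f has_derivative D) (at x) \<longleftrightarrow> (g has_derivative D) (at x)" for D
    using has_derivative_transform_within_open[OF _ assms(1,2)] assms(3) by metis
  then show ?thesis unfolding frechet_derivative_def by simp
qed

lemma differentiable_cong_open:
  assumes "open S" "x \<in> S" "\<And>y. y \<in> S \<Longrightarrow> f y = g y"
  shows "f differentiable (at x) \<longleftrightarrow> g differentiable (at x)"
  using has_derivative_transform_within_open[OF _ assms(1,2)] assms(3)
  unfolding differentiable_def by metis

lemma higher_differentiable_on_cong:
  assumes "open S" "\<And>x. x \<in> S \<Longrightarrow> f x = g x" "higher_differentiable_on S f k"
  shows "higher_differentiable_on S g k"
  using assms(2,3)
proof (induction k arbitrary: f g)
  case 0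
  then show ?case using continuous_on_cong[of S S f g] by simp
next
  case (Suc k)
  have "higher_differentiable_on S (\<lambda>x. frechet_derivative g (at x) v) k" for v
  proof (rule Suc.IH)
    show "frechet_derivative f (at x) v = frechet_derivative g (at x) v" if "x \<in> S" for x
      using frechet_derivative_cong_open[OF assms(1) that Suc.prems(1)] by (rule fun_cong)
    show "higher_differentiable_on S (\<lambda>x. frechet_derivative f (at x) v) k"
      using Suc.prems(2) unfolding higher_differentiable_on.simps by blast
  qed
  moreover have "g differentiable (at x)" if "x \<in> S" for x
  proof -
    have "f differentiable (at x) \<longleftrightarrow> g differentiable (at x)"
      by (rule differentiable_cong_open[OF assms(1) that Suc.prems(1)])
    then show ?thesis using Suc.prems(2) that unfolding higher_differentiable_on.simps by blast
  qed
  ultimately show ?case unfolding higher_differentiable_on.simps by blast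
qed

lemma higher_differentiable_on_subset:
  "higher_differentiable_on S f k \<Longrightarrow> T \<subseteq> S \<Longrightarrow> higher_differentiable_on T f k"
  by (induction k arbitrary: f) (auto intro: continuous_on_subset)

lemma higher_differentiable_on_SucD:
  "higher_differentiable_on S f (Suc k) \<Longrightarrow> higher_differentiable_on S f k"
proof (induction k arbitrary: f)
  case 0
  then show ?case
    by (auto intro!: differentiable_imp_continuous_on simp: differentiable_on_def differentiable_at_withinI)
next
  case (Suc k)
  then show ?case by (metis higher_differentiable_on.simps(2))
qed

lemma higher_differentiable_on_has_derivative:
  "higher_differentiable_on S f (Suc k) \<Longrightarrow> x \<in> S \<Longrightarrow>
    (f has_derivative frechet_derivative f (at x)) (at x)"
  using frechet_derivative_works by (metis higher_differentiable_on.simps(2))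

lemma higher_differentiable_on_SucI:
  assumes "open S" "\<And>x. x \<in> S \<Longrightarrow> (f has_derivative D x) (at x)"
    and "\<And>v. higher_differentiable_on S (\<lambda>x. D x v) k"
  shows "higher_differentiable_on S f (Suc k)"
proof -
  have "higher_differentiable_on S (\<lambda>x. frechet_derivative f (at x) v) k" for v
    by (rule higher_differentiable_on_cong[OF assms(1) _ assms(3)])
      (rule fun_cong[OF frechet_derivative_at[OF assms(2)]])
  then show ?thesis
    unfolding higher_differentiable_on.simps using assms(2) differentiableI by blast
qed

lemma higher_differentiable_on_local:
  assumes "\<And>x. x \<in> S \<Longrightarrow> \<exists>T. open T \<and> x \<in> T \<and> higher_differentiable_on T f k"
  shows "higher_differentiable_on S f k"
  using assms
proof (induction k arbitrary: f)
  case 0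
  then show ?case
    by (metis continuous_at_imp_continuous_on continuous_on_eq_continuous_at higher_differentiable_on.simps(1))
next
  case (Suc k)
  then show ?case by (metis higher_differentiable_on.simps(2))
qed

section \<open>Calculus rules of finite order\<close>

lemma higher_differentiable_on_const: "higher_differentiable_on S (\<lambda>x. c) k"
  by (induction k arbitrary: c) (simp_all add: frechet_derivative_const)

lemma higher_differentiable_on_add:
  assumes "open S" "higher_differentiable_on S f k" "higher_differentiable_on S g k"
  shows "higher_differentiable_on S (\<lambda>x. f x + g x) k"
  using assms(2,3)
proof (induction k arbitrary: f g)
  case 0
  then show ?case by (simp add: continuous_on_add)
next
  case (Suc k)
  let ?D = "\<lambda>x v. frechet_derivative f (at x) v + frechet_derivative g (at x) v"
  have d: "((\<lambda>x. f x + g x) has_derivative ?D x) (at x)" if "x \<in> S" for x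
    using Suc.prems that by (intro has_derivative_add higher_differentiable_on_has_derivative)
  moreover have "higher_differentiable_on S (\<lambda>x. ?D x v) k" for v
      using Suc by simp
  ultimately show ?case by (rule higher_differentiable_on_SucI[OF assms(1)])
qed

lemma higher_differentiable_on_bounded_linear:
  assumes "open S" "bounded_linear L" "higher_differentiable_on S f k"
  shows "higher_differentiable_on S (\<lambda>x. L (f x)) k"
  using assms(3)
proof (induction k arbitrary: f)
  case 0
  then show ?case using bounded_linear.continuous_on[OF assms(2)] by simp
next
  case (Suc k)
  have d: "((\<lambda>x. L (f x)) has_derivative (\<lambda>v. L (frechet_derivative f (at x) v))) (at x)" if "x \<in> S" for x
    using Suc.prems that
    by (intro bounded_linear.has_derivative[OF assms(2)] higher_differentiable_on_has_derivative)
  moreover have "higher_differentiable_on S (\<lambda>x. L (frechet_derivative f (at x) v)) k" for v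
      using Suc by simp
  ultimately show ?case by (rule higher_differentiable_on_SucI[OF assms(1)])
qed

lemma higher_differentiable_on_bilinear:
  assumes "open S" "bounded_bilinear b" "higher_differentiable_on S f k" "higher_differentiable_on S g k"
  shows "higher_differentiable_on S (\<lambda>x. b (f x) (g x)) k"
  using assms(3,4)
proof (induction k arbitrary: f g)
  case 0
  then show ?case using bounded_bilinear.continuous_on[OF assms(2)] by simp
next
  case (Suc k)
  let ?D = "\<lambda>x v. b (f x) (frechet_derivative g (at x) v) + b (frechet_derivative f (at x) v) (g x)"
  have d: "((\<lambda>x. b (f x) (g x)) has_derivative ?D x) (at x)" if "x \<in> S" for x
    using Suc.prems that
    by (intro bounded_bilinear.FDERIV[OF assms(2)] higher_differentiable_on_has_derivative)
  moreover have "higher_differentiable_on S (\<lambda>x. ?D x v) k" for v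
    using Suc.prems Suc.prems[THEN higher_differentiable_on_SucD]
    by (intro higher_differentiable_on_add assms(1) Suc.IH) auto
  ultimately show ?case by (rule higher_differentiable_on_SucI[OF assms(1)])
qed

lemma higher_differentiable_on_sum:
  assumes "open S" "\<And>i. i \<in> I \<Longrightarrow> higher_differentiable_on S (f i) k"
  shows "higher_differentiable_on S (\<lambda>x. \<Sum>i\<in>I. f i x) k"
  using assms(2)
proof (induction I rule: infinite_finite_induct)
  case (insert i I)
  then show ?case using higher_differentiable_on_add[OF assms(1), of "f i" k] by simp
qed (simp_all add: higher_differentiable_on_const)

text \<open>The chain rule feeds the derivative of \<open>g\<close> a direction that varies with x,
  while the induction hypothesis speaks of constant directions. Expansion in a basis of the middle
  space turns the derivative into a sum of products to which the hypothesis applies.\<close>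

lemma higher_differentiable_on_compose:
  fixes f :: "'a::real_normed_vector \<Rightarrow> 'b::real_normed_vector"
    and g :: "'b \<Rightarrow> 'c::real_normed_vector"
  assumes "finite_dim TYPE('b)" "open S" "open T" "f ` S \<subseteq> T"
    and "higher_differentiable_on S f k" "higher_differentiable_on T g k"
  shows "higher_differentiable_on S (\<lambda>x. g (f x)) k"
  using assms(5,6)
proof (induction k arbitrary: g)
  case 0
  then show ?case using assms(4) continuous_on_compose2 by auto
next
  case (Suc k)
  obtain B :: "'b set" where B: "finite B" "independent B" "span B = UNIV"
    using finite_dim_basis[OF assms(1)] .
  let ?D = "\<lambda>x v. frechet_derivative g (at (f x)) (frechet_derivative f (at x) v)"
  have gd: "(g has_derivative frechet_derivative g (at (f x))) (at (f x))" if "x \<in> S" for x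
    using that assms(4) by (intro higher_differentiable_on_has_derivative[OF Suc.prems(2)]) auto
  have d: "((\<lambda>x. g (f x)) has_derivative ?D x) (at x)" if "x \<in> S" for x
    using that
    by (intro has_derivative_compose[of f _ x UNIV g] gd higher_differentiable_on_has_derivative[OF Suc.prems(1)])
  moreover have "higher_differentiable_on S (\<lambda>x. ?D x v) k" for v
  proof (rule higher_differentiable_on_cong[OF assms(2)])
    have "higher_differentiable_on S (\<lambda>x. frechet_derivative g (at (f x)) b) k" for b
      using Suc.prems(2) by (intro Suc.IH higher_differentiable_on_SucD[OF Suc.prems(1)]) simp
    moreover have "higher_differentiable_on S (\<lambda>x. frechet_derivative f (at x) v) k"
      using Suc.prems(1) by simp
    then have "higher_differentiable_on S (\<lambda>x. representation B (frechet_derivative f (at x) v) b) k" for b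
      by (rule higher_differentiable_on_bounded_linear[OF assms(2) bounded_linear_representation[OF B]])
    ultimately show "higher_differentiable_on S (\<lambda>x. \<Sum>b\<in>B. representation B (frechet_derivative f (at x) v) b *\<^sub>R
       frechet_derivative g (at (f x)) b) k"
      by (intro higher_differentiable_on_sum[OF assms(2)]
          higher_differentiable_on_bilinear[OF assms(2) bounded_bilinear_scaleR])
  next
    fix x assume "x \<in> S"
    then have "linear (frechet_derivative g (at (f x)))"
      using gd has_derivative_linear by blast
    then show "(\<Sum>b\<in>B. representation B (frechet_derivative f (at x) v) b *\<^sub>R
       frechet_derivative g (at (f x)) b) = ?D x v" by (rule linear_expansion[OF B, symmetric])
  qed
  ultimately show ?case by (rule higher_differentiable_on_SucI[OF assms(2)])
qed

section \<open>Calculus rules for smooth maps\<close>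

lemma smooth_on_cong:
  "open S \<Longrightarrow> (\<And>x. x \<in> S \<Longrightarrow> f x = g x) \<Longrightarrow> smooth_on S f \<Longrightarrow> smooth_on S g"
  unfolding smooth_on_def using higher_differentiable_on_cong by blast

lemma smooth_on_subset: "smooth_on S f \<Longrightarrow> T \<subseteq> S \<Longrightarrow> smooth_on T f"
  unfolding smooth_on_def using higher_differentiable_on_subset by blast

lemma smooth_on_local:
  "(\<And>x. x \<in> S \<Longrightarrow> \<exists>T. open T \<and> x \<in> T \<and> smooth_on T f) \<Longrightarrow> smooth_on S f"
  unfolding smooth_on_def using higher_differentiable_on_local by metis

lemma smooth_on_const [simp]: "smooth_on S (\<lambda>x. c)"
  unfolding smooth_on_def using higher_differentiable_on_const by blast

lemma smooth_on_add: "open S \<Longrightarrow> smooth_on S f \<Longrightarrow> smooth_on S g \<Longrightarrow> smooth_on S (\<lambda>x. f x + g x)"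
  unfolding smooth_on_def using higher_differentiable_on_add by blast

lemma smooth_on_bounded_linear:
  "open S \<Longrightarrow> bounded_linear L \<Longrightarrow> smooth_on S f \<Longrightarrow> smooth_on S (\<lambda>x. L (f x))"
  unfolding smooth_on_def using higher_differentiable_on_bounded_linear by blast

lemma smooth_on_bilinear:
  "open S \<Longrightarrow> bounded_bilinear b \<Longrightarrow> smooth_on S f \<Longrightarrow> smooth_on S g \<Longrightarrow> smooth_on S (\<lambda>x. b (f x) (g x))"
  unfolding smooth_on_def using higher_differentiable_on_bilinear by blast

lemmas smooth_on_scaleR = smooth_on_bilinear[OF _ bounded_bilinear_scaleR]
  and smooth_on_mult = smooth_on_bilinear[OF _ bounded_bilinear_mult]

lemma smooth_on_minus: "open S \<Longrightarrow> smooth_on S f \<Longrightarrow> smooth_on S (\<lambda>x. - f x)"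
  by (rule smooth_on_bounded_linear[OF _ bounded_linear_minus[OF bounded_linear_ident]])

lemma smooth_on_diff: "open S \<Longrightarrow> smooth_on S f \<Longrightarrow> smooth_on S g \<Longrightarrow> smooth_on S (\<lambda>x. f x - g x)"
  using smooth_on_add[OF _ _ smooth_on_minus, of S f g] by simp

lemma smooth_on_sum:
  "open S \<Longrightarrow> (\<And>i. i \<in> I \<Longrightarrow> smooth_on S (f i)) \<Longrightarrow> smooth_on S (\<lambda>x. \<Sum>i\<in>I. f i x)"
  unfolding smooth_on_def by (intro allI higher_differentiable_on_sum) simp_all

lemma smooth_on_compose:
  fixes f :: "'a::real_normed_vector \<Rightarrow> 'b::real_normed_vector"
    and g :: "'b \<Rightarrow> 'c::real_normed_vector"
  assumes "finite_dim TYPE('b)" "open S" "open T" "f ` S \<subseteq> T" "smooth_on S f" "smooth_on T g"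
  shows "smooth_on S (\<lambda>x. g (f x))"
  using assms(5,6) higher_differentiable_on_compose[OF assms(1-4)] unfolding smooth_on_def by blast

lemma smooth_on_id: "smooth_on S (\<lambda>x. x)"
proof -
  have "higher_differentiable_on S (\<lambda>x. x) k" for k
    by (cases k) (auto simp: higher_differentiable_on_const)
  then show ?thesis unfolding smooth_on_def by blast
qed

lemma smooth_on_differentiable: "smooth_on S f \<Longrightarrow> x \<in> S \<Longrightarrow> f differentiable (at x)"
  unfolding smooth_on_def by (metis higher_differentiable_on.simps(2))

lemma smooth_on_has_derivative:
  "smooth_on S f \<Longrightarrow> x \<in> S \<Longrightarrow> (f has_derivative frechet_derivative f (at x)) (at x)"
  using smooth_on_differentiable frechet_derivative_works by blast

lemma smooth_on_continuous: "smooth_on S f \<Longrightarrow> continuous_on S f"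
  unfolding smooth_on_def by (metis higher_differentiable_on.simps(1))

lemma smooth_on_frechet_derivative:
  "smooth_on S f \<Longrightarrow> smooth_on S (\<lambda>x. frechet_derivative f (at x) v)"
  unfolding smooth_on_def by (metis higher_differentiable_on.simps(2))

lemma smooth_on_Pair:
  assumes "open S" "smooth_on S f" "smooth_on S g"
  shows "smooth_on S (\<lambda>x. (f x, g x))"
proof -
  have "bounded_linear (\<lambda>x. (x, 0))" "bounded_linear (\<lambda>x. (0, x))"
    by (auto intro!: bounded_linear_Pair bounded_linear_ident bounded_linear_zero)
  then have "smooth_on S (\<lambda>x. (f x, 0) + (0, g x))"
    using assms(1) smooth_on_bounded_linear[OF assms(1) _ assms(2)] smooth_on_bounded_linear[OF assms(1) _ assms(3)]
    by (intro smooth_on_add) simp_all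
  then show ?thesis by simp
qed

section \<open>Bump functions and symmetry of the second derivative\<close>

text \<open>The functions exp(-1/t) / t^n, extended by 0. The powers are included because the
  derivative of each member is a linear combination of members, so smoothness follows by one
  induction for all n.\<close>

definition flat_exp :: "nat \<Rightarrow> real \<Rightarrow> real"
  where "flat_exp n t = (if t > 0 then exp (- inverse t) * inverse t ^ n else 0)"

lemma DERIV_flat_exp:
  "(flat_exp n has_real_derivative flat_exp (n + 2) t - n * flat_exp (n + 1) t) (at t)"
proof -
  consider "t > 0" | "t < 0" | "t = 0" by linarith
  then show ?thesis
  proof cases
    case 1
    have "((\<lambda>t. exp (- inverse t) * inverse t ^ n) has_real_derivative
        flat_exp (n + 2) t - n * flat_exp (n + 1) t) (at t)"
      using 1 by (auto intro!: derivative_eq_intros simp: flat_exp_def)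
        (cases n; simp add: field_simps power2_eq_square)
    then show ?thesis
      using 1 by (elim has_field_derivative_transform_within_open[where S = "{0<..}"]) (auto simp: flat_exp_def)
  next
    case 2
    have "((\<lambda>t. 0) has_real_derivative flat_exp (n + 2) t - n * flat_exp (n + 1) t) (at t)"
      using 2 by (simp add: flat_exp_def)
    then show ?thesis
      using 2 by (elim has_field_derivative_transform_within_open[where S = "{..<0}"]) (auto simp: flat_exp_def)
  next
    \<comment> \<open>At 0 only the right-hand difference quotient is not trivially zero; there the
      exponential decay beats the power of 1/h.\<close>
    case 3
    have "((\<lambda>h. flat_exp n h / h) \<longlongrightarrow> 0) (at 0)"
    proof (rule filterlim_split_at)
      have "eventually (\<lambda>h. flat_exp n h / h = 0) (at_left 0)"
        by (simp add: eventually_at_filter flat_exp_def)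
      then show "((\<lambda>h. flat_exp n h / h) \<longlongrightarrow> 0) (at_left 0)"
        by (rule tendsto_eventually)
      have "((\<lambda>h. inverse h ^ (n + 1) / exp (inverse h)) \<longlongrightarrow> 0) (at_right (0::real))"
        by (rule filterlim_compose[OF tendsto_power_div_exp_0 filterlim_inverse_at_top_right])
      moreover have "eventually (\<lambda>h. inverse h ^ (n + 1) / exp (inverse h) = flat_exp n h / h) (at_right 0)"
        by (simp add: eventually_at_filter flat_exp_def exp_minus divide_inverse mult_ac)
      ultimately show "((\<lambda>h. flat_exp n h / h) \<longlongrightarrow> 0) (at_right 0)"
        by (rule Lim_transform_eventually)
    qed
    then show ?thesis using 3 by (simp add: has_field_derivative_iff flat_exp_def)
  qed
qed

lemma smooth_on_flat_exp: "smooth_on UNIV (flat_exp n)"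
proof -
  have "higher_differentiable_on UNIV (flat_exp n) k" for k
  proof (induction k arbitrary: n)
    case 0
    then show ?case
      using DERIV_isCont[OF DERIV_flat_exp] by (simp add: continuous_at_imp_continuous_on)
  next
    case (Suc k)
    let ?D = "\<lambda>t. flat_exp (n + 2) t + (- real n) * flat_exp (n + 1) t"
    have "higher_differentiable_on UNIV ?D k"
      by (intro higher_differentiable_on_add[OF open_UNIV] Suc.IH
          higher_differentiable_on_bounded_linear[OF open_UNIV bounded_linear_mult_right])
    then have *: "higher_differentiable_on UNIV (\<lambda>t. ?D t * v) k" for v
      by (rule higher_differentiable_on_bounded_linear[OF open_UNIV bounded_linear_mult_left])
    show ?case
      by (rule higher_differentiable_on_SucI[OF open_UNIV _ *])
        (use DERIV_flat_exp[of n] in \<open>simp add: has_field_derivative_def\<close>)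
  qed
  then show ?thesis unfolding smooth_on_def by blast
qed

text \<open>The flat exponential is applied to r^2 minus the sum of the squared coordinates. The
  function then vanishes off a coordinate cube, which is compact by construction.\<close>

lemma bump_function:
  fixes x0 :: "'a::real_normed_vector"
  assumes "finite_dim TYPE('a)" "open S" "x0 \<in> S"
  obtains \<beta> :: "'a \<Rightarrow> real" and K
  where "smooth_on UNIV \<beta>" "\<beta> x0 \<noteq> 0" "compact K" "K \<subseteq> S" "\<And>x. x \<notin> K \<Longrightarrow> \<beta> x = 0"
proof -
  obtain B :: "'a set" where B: "finite B" "independent B" "span B = UNIV"
    using finite_dim_basis[OF assms(1)] .
  obtain e where e: "e > 0" "ball x0 e \<subseteq> S" using assms open_contains_ball by metis
  \<comment> \<open>The cube of half-width r around \<open>x0\<close> fits into the ball of radius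
    e. The summand 1 makes the estimate strict and keeps the denominator positive when
    \<open>B\<close> is empty.\<close>
  define r where "r = e / (1 + (\<Sum>b\<in>B. norm b))"
  have pos: "1 + (\<Sum>b\<in>B. norm b) > 0" by (simp add: add_pos_nonneg sum_nonneg)
  then have r: "r > 0" using e by (simp add: r_def)
  let ?K = "(\<lambda>x. x0 + x) ` coord_cube B r"
  let ?q = "\<lambda>x. r * r - (\<Sum>b\<in>B. representation B (x - x0) b * representation B (x - x0) b)"
  have smooth_rep: "smooth_on UNIV (\<lambda>x. representation B (x - x0) b)" for b
    by (rule smooth_on_bounded_linear[OF open_UNIV bounded_linear_representation[OF B]])
      (rule smooth_on_diff[OF open_UNIV smooth_on_id smooth_on_const])
  show ?thesis
  proof
    have "smooth_on UNIV ?q"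
      by (rule smooth_on_diff[OF open_UNIV smooth_on_const smooth_on_sum[OF open_UNIV
            smooth_on_mult[OF open_UNIV smooth_rep smooth_rep]]])
    then show "smooth_on UNIV (\<lambda>x. flat_exp 0 (?q x))"
      by (rule smooth_on_compose[where f = ?q, OF finite_dim_real open_UNIV open_UNIV subset_UNIV _ smooth_on_flat_exp])
    show "flat_exp 0 (?q x0) \<noteq> 0"
      using r by (simp add: flat_exp_def representation_zero)
    show "compact ?K"
      using B by (intro compact_continuous_image compact_coord_cube continuous_intros)
    show "?K \<subseteq> S"
    proof
      fix x assume "x \<in> ?K"
      then obtain c where c: "x = x0 + (\<Sum>b\<in>B. c b *\<^sub>R b)" "\<forall>b\<in>B. \<bar>c b\<bar> \<le> r"
        unfolding coord_cube_def by blast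
      have "norm (\<Sum>b\<in>B. c b *\<^sub>R b) \<le> (\<Sum>b\<in>B. r * norm b)"
        using c by (intro order_trans[OF norm_sum] sum_mono) (simp add: mult_right_mono)
      also have "\<dots> = r * (\<Sum>b\<in>B. norm b)" by (simp add: sum_distrib_left)
      also have "\<dots> < r * (1 + (\<Sum>b\<in>B. norm b))" using r by simp
      also have "\<dots> = e" using pos by (simp add: r_def)
      finally show "x \<in> S" using e(2) c(1) by (auto simp: dist_norm)
    qed
    show "flat_exp 0 (?q x) = 0" if "x \<notin> ?K" for x
    proof (rule ccontr)
      assume "flat_exp 0 (?q x) \<noteq> 0"
      then have lt: "(\<Sum>b\<in>B. representation B (x - x0) b * representation B (x - x0) b) < r * r"
        by (simp add: flat_exp_def split: if_splits)
      have "\<bar>representation B (x - x0) b\<bar> \<le> r" if "b \<in> B" for b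
      proof -
        have "representation B (x - x0) b * representation B (x - x0) b
            \<le> (\<Sum>b\<in>B. representation B (x - x0) b * representation B (x - x0) b)"
          using B that by (intro member_le_sum) auto
        with lt have "(representation B (x - x0) b)\<^sup>2 \<le> r\<^sup>2" by (simp add: power2_eq_square)
        then show ?thesis using r by (simp add: abs_le_square_iff[symmetric])
      qed
      moreover have "(\<Sum>b\<in>B. representation B (x - x0) b *\<^sub>R b) = x - x0"
        using B by (intro sum_representation_eq) auto
      ultimately have "x - x0 \<in> coord_cube B r" unfolding coord_cube_def by force
      then have "x \<in> ?K" by force
      then show False using that by simp
    qed
  qed
qed

section \<open>Symmetry of second derivatives\<close>

lemma has_real_derivative_along_line:
  fixes f :: "'a::real_normed_vector \<Rightarrow> real"
  assumes "f differentiable (at (y + s *\<^sub>R v))"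
  shows "((\<lambda>s. f (y + s *\<^sub>R v)) has_real_derivative frechet_derivative f (at (y + s *\<^sub>R v)) v) (at s)"
proof -
  let ?D = "frechet_derivative f (at (y + s *\<^sub>R v))"
  have D: "(f has_derivative ?D) (at (y + s *\<^sub>R v))"
    using assms frechet_derivative_works by blast
  have "((\<lambda>s. y + s *\<^sub>R v) has_derivative (\<lambda>h. h *\<^sub>R v)) (at s)"
    by (auto intro!: derivative_eq_intros)
  from has_derivative_compose[OF this D]
  have "((\<lambda>s. f (y + s *\<^sub>R v)) has_derivative (\<lambda>h. ?D (h *\<^sub>R v))) (at s)" .
  moreover have "(\<lambda>h. ?D (h *\<^sub>R v)) = (*) (?D v)"
    using linear_scale[OF has_derivative_linear[OF D]] by (simp add: fun_eq_iff mult.commute)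
  ultimately show ?thesis by (simp add: has_field_derivative_def)
qed

text \<open>The mean value theorem is applied twice: along v to the difference of f across h w, then
  along w to the resulting difference of first derivatives.\<close>

lemma second_difference_mean_value:
  fixes f :: "'a::real_normed_vector \<Rightarrow> real"
  assumes f: "smooth_on S f" and h: "h > 0"
    and S: "\<And>s t. 0 \<le> s \<Longrightarrow> s \<le> h \<Longrightarrow> 0 \<le> t \<Longrightarrow> t \<le> h \<Longrightarrow> x + s *\<^sub>R v + t *\<^sub>R w \<in> S"
  obtains s t where "0 < s" "s < h" "0 < t" "t < h"
    "f (x + h *\<^sub>R v + h *\<^sub>R w) - f (x + h *\<^sub>R v) - f (x + h *\<^sub>R w) + f x =
     h * (h * frechet_derivative (\<lambda>y. frechet_derivative f (at y) v) (at (x + s *\<^sub>R v + t *\<^sub>R w)) w)"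
proof -
  let ?fv = "\<lambda>y. frechet_derivative f (at y) v"
  let ?\<phi> = "\<lambda>s. f (x + s *\<^sub>R v + h *\<^sub>R w) - f (x + s *\<^sub>R v)"
  have S0: "x + s *\<^sub>R v \<in> S" if "0 \<le> s" "s \<le> h" for s using S[of s 0] that h by simp
  have "(?\<phi> has_real_derivative ?fv (x + s *\<^sub>R v + h *\<^sub>R w) - ?fv (x + s *\<^sub>R v)) (at s)"
    if "0 \<le> s" "s \<le> h" for s
  proof (rule DERIV_diff)
    show "((\<lambda>s. f (x + s *\<^sub>R v)) has_real_derivative ?fv (x + s *\<^sub>R v)) (at s)"
      using smooth_on_differentiable[OF f S0[OF that]] by (rule has_real_derivative_along_line)
    have "f differentiable (at ((x + h *\<^sub>R w) + s *\<^sub>R v))"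
      using smooth_on_differentiable[OF f S[of s h]] that h by (simp add: algebra_simps)
    from has_real_derivative_along_line[OF this]
    show "((\<lambda>s. f (x + s *\<^sub>R v + h *\<^sub>R w)) has_real_derivative ?fv (x + s *\<^sub>R v + h *\<^sub>R w)) (at s)"
      by (simp add: algebra_simps)
  qed
  from MVT2[OF h this] obtain s where s: "0 < s" "s < h"
    "?\<phi> h - ?\<phi> 0 = (h - 0) * (?fv (x + s *\<^sub>R v + h *\<^sub>R w) - ?fv (x + s *\<^sub>R v))" by blast
  have "((\<lambda>t. ?fv (x + s *\<^sub>R v + t *\<^sub>R w)) has_real_derivative
      frechet_derivative ?fv (at (x + s *\<^sub>R v + t *\<^sub>R w)) w) (at t)" if "0 \<le> t" "t \<le> h" for t
    using smooth_on_differentiable[OF smooth_on_frechet_derivative[OF f] S[of s t]] that s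
    by (intro has_real_derivative_along_line) simp
  from MVT2[OF h this] obtain t where t: "0 < t" "t < h"
    "?fv (x + s *\<^sub>R v + h *\<^sub>R w) - ?fv (x + s *\<^sub>R v + 0 *\<^sub>R w) =
      (h - 0) * frechet_derivative ?fv (at (x + s *\<^sub>R v + t *\<^sub>R w)) w" by blast
  show ?thesis using that[OF s(1,2) t(1,2)] s(3) t(3) by simp
qed

text \<open>The second difference over a small parallelogram is symmetric in v and w. So the two
  mixed derivatives take a common value at two points close to x, and continuity excludes a gap at
  x.\<close>

lemma second_derivative_symmetric_real:
  fixes f :: "'a::real_normed_vector \<Rightarrow> real"
  assumes "open S" "smooth_on S f" "x \<in> S"
  shows "frechet_derivative (\<lambda>y. frechet_derivative f (at y) v) (at x) w =
    frechet_derivative (\<lambda>y. frechet_derivative f (at y) w) (at x) v" (is "?a x = ?b x")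
proof (rule ccontr)
  assume ne: "?a x \<noteq> ?b x"
  \<comment> \<open>Half of the gap: two errors below \<open>e\<close> cannot bridge it.\<close>
  define e where "e = \<bar>?a x - ?b x\<bar> / 2"
  have e: "e > 0" using ne by (simp add: e_def)
  have "smooth_on S ?a" "smooth_on S ?b"
    by (intro smooth_on_frechet_derivative assms)+
  then have "isCont ?a x" "isCont ?b x"
    using smooth_on_continuous assms continuous_on_eq_continuous_at by blast+
  then obtain d1 d2 where d: "d1 > 0" "\<And>y. dist y x < d1 \<Longrightarrow> \<bar>?a y - ?a x\<bar> < e"
     "d2 > 0" "\<And>y. dist y x < d2 \<Longrightarrow> \<bar>?b y - ?b x\<bar> < e"
    using e unfolding continuous_at dist_real_def LIM_def
    by (metis (no_types, lifting) continuous_at_eps_delta dist_real_def \<open>isCont ?a x\<close> \<open>isCont ?b x\<close>)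
  obtain d0 where d0: "d0 > 0" "ball x d0 \<subseteq> S" using assms open_contains_ball by metis
  define h where "h = min d0 (min d1 d2) / (1 + norm v + norm w)"
  have pos: "1 + norm v + norm w > 0" by (simp add: add_pos_nonneg)
  then have h: "h > 0" using d0 d by (simp add: h_def)
  have near: "dist (x + s *\<^sub>R v + t *\<^sub>R w) x < min d0 (min d1 d2)"
    if "0 \<le> s" "s \<le> h" "0 \<le> t" "t \<le> h" for s t
  proof -
    have "dist (x + s *\<^sub>R v + t *\<^sub>R w) x \<le> s * norm v + t * norm w"
      using that norm_triangle_ineq[of "s *\<^sub>R v" "t *\<^sub>R w"] by (simp add: dist_norm add.assoc)
    also have "\<dots> \<le> h * norm v + h * norm w" using that by (intro add_mono mult_right_mono) auto
    also have "\<dots> < h * (1 + norm v + norm w)" using h by (simp add: algebra_simps)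
    also have "\<dots> = min d0 (min d1 d2)" using pos by (simp add: h_def)
    finally show ?thesis .
  qed
  have S: "x + s *\<^sub>R v + t *\<^sub>R w \<in> S" if "0 \<le> s" "s \<le> h" "0 \<le> t" "t \<le> h" for s t
    using near[OF that] d0(2) by (auto simp: dist_commute)
  obtain s t where 1: "0 < s" "s < h" "0 < t" "t < h"
    "f (x + h *\<^sub>R v + h *\<^sub>R w) - f (x + h *\<^sub>R v) - f (x + h *\<^sub>R w) + f x = h * (h * ?a (x + s *\<^sub>R v + t *\<^sub>R w))"
    using second_difference_mean_value[OF assms(2) h S] by blast
  have S': "x + s *\<^sub>R w + t *\<^sub>R v \<in> S" if "0 \<le> s" "s \<le> h" "0 \<le> t" "t \<le> h" for s t
    using S[of t s] that by (simp add: algebra_simps)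
  obtain s' t' where 2: "0 < s'" "s' < h" "0 < t'" "t' < h"
    "f (x + h *\<^sub>R w + h *\<^sub>R v) - f (x + h *\<^sub>R w) - f (x + h *\<^sub>R v) + f x = h * (h * ?b (x + s' *\<^sub>R w + t' *\<^sub>R v))"
    using second_difference_mean_value[OF assms(2) h S'] by blast
  have "h * (h * ?a (x + s *\<^sub>R v + t *\<^sub>R w)) = h * (h * ?b (x + t' *\<^sub>R v + s' *\<^sub>R w))"
    using 1(5) 2(5) by (simp add: algebra_simps)
  then have eq: "?a (x + s *\<^sub>R v + t *\<^sub>R w) = ?b (x + t' *\<^sub>R v + s' *\<^sub>R w)" using h by simp
  have "\<bar>?a (x + s *\<^sub>R v + t *\<^sub>R w) - ?a x\<bar> < e" using near[of s t] 1 d(2) by simp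
  moreover have "\<bar>?b (x + t' *\<^sub>R v + s' *\<^sub>R w) - ?b x\<bar> < e" using near[of t' s'] 2 d(4) by simp
  ultimately have "\<bar>?a x - ?b x\<bar> < 2 * e" using eq by linarith
  then show False by (simp add: e_def)
qed

lemma frechet_derivative_bounded_linear:
  assumes "bounded_linear L" "f differentiable (at x)"
  shows "frechet_derivative (\<lambda>x. L (f x)) (at x) v = L (frechet_derivative f (at x) v)"
  using frechet_derivative_at[OF bounded_linear.has_derivative[OF assms(1)
        assms(2)[unfolded frechet_derivative_works]]] by (metis)

lemma second_derivative_symmetric:
  fixes f :: "'a::real_normed_vector \<Rightarrow> 'b::real_normed_vector"
  assumes "finite_dim TYPE('b)" "open S" "smooth_on S f" "x \<in> S"
  shows "frechet_derivative (\<lambda>y. frechet_derivative f (at y) v) (at x) w =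
    frechet_derivative (\<lambda>y. frechet_derivative f (at y) w) (at x) v"
proof -
  obtain B :: "'b set" where B: "finite B" "independent B" "span B = UNIV"
    using finite_dim_basis[OF assms(1)] .
  have rep: "representation B (frechet_derivative (\<lambda>y. frechet_derivative f (at y) v) (at x) w) b =
    frechet_derivative (\<lambda>y. frechet_derivative (\<lambda>z. representation B (f z) b) (at y) v) (at x) w" for v w b
  proof -
    note L = bounded_linear_representation[OF B, of b]
    have "frechet_derivative (\<lambda>y. frechet_derivative (\<lambda>z. representation B (f z) b) (at y) v) (at x) =
      frechet_derivative (\<lambda>y. representation B (frechet_derivative f (at y) v) b) (at x)"
      using frechet_derivative_bounded_linear[OF L smooth_on_differentiable[OF assms(3)]]
      by (intro frechet_derivative_cong_open[OF assms(2,4)])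
    then show ?thesis
      using frechet_derivative_bounded_linear[OF L
          smooth_on_differentiable[OF smooth_on_frechet_derivative[OF assms(3)] assms(4)]] by simp
  qed
  have "representation B (frechet_derivative (\<lambda>y. frechet_derivative f (at y) v) (at x) w) =
    representation B (frechet_derivative (\<lambda>y. frechet_derivative f (at y) w) (at x) v)"
    unfolding rep fun_eq_iff
    using second_derivative_symmetric_real[OF assms(2) smooth_on_bounded_linear[OF assms(2)
          bounded_linear_representation[OF B] assms(3)] assms(4)] by blast
  from arg_cong[OF this, of "\<lambda>r. \<Sum>b\<in>B. r b *\<^sub>R b"]
  show ?thesis using B by (simp add: sum_representation_eq)
qed

section \<open>Alternating forms and the exterior derivative on normed spaces\<close>

lemma alternating_form_linear_at:
  assumes "alternating_form T k f" "length us + length vs + 1 = k" "set us \<subseteq> T" "set vs \<subseteq> T"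
    and "u \<in> T" "v \<in> T"
  shows "f (us @ (a *\<^sub>R u + b *\<^sub>R v) # vs) = a * f (us @ u # vs) + b * f (us @ v # vs)"
proof -
  have "f ((us @ u # vs)[length us := a *\<^sub>R u + b *\<^sub>R v]) =
    a * f ((us @ u # vs)[length us := u]) + b * f ((us @ u # vs)[length us := v])"
  proof -
    have *: "length (us @ u # vs) = k \<and> set (us @ u # vs) \<subseteq> T \<and> length us < k" using assms by auto
    show ?thesis using assms(1,5,6) * unfolding alternating_form_def by blast
  qed
  then show ?thesis by simp
qed

lemma alternating_form_improper:
  "alternating_form T k f \<Longrightarrow> \<not> (length vs = k \<and> set vs \<subseteq> T) \<Longrightarrow> f vs = 0"
  unfolding alternating_form_def by blast

lemma alternating_form_zero_arg:
  assumes "alternating_form T k f" "0 \<in> T"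
  shows "f (us @ 0 # vs) = 0"
proof (cases "length (us @ 0 # vs) = k \<and> set (us @ 0 # vs) \<subseteq> T")
  case True
  then have "f (us @ (0 *\<^sub>R 0 + 0 *\<^sub>R 0) # vs) = 0 * f (us @ 0 # vs) + 0 * f (us @ 0 # vs)"
    using assms by (intro alternating_form_linear_at[OF assms(1)]) auto
  then show ?thesis by simp
next
  case False
  then show ?thesis using assms alternating_form_improper by blast
qed

lemma alternating_form_repeat:
  assumes "alternating_form T k f" "length us + length vs + 2 = k" "set us \<subseteq> T" "set vs \<subseteq> T" "u \<in> T"
  shows "f (us @ u # u # vs) = 0"
proof -
  let ?l = "us @ u # u # vs"
  have *: "length ?l = k \<and> set ?l \<subseteq> T \<and> length us < Suc (length us) \<and> Suc (length us) < k \<and>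
    ?l ! length us = ?l ! Suc (length us)"
    using assms by (auto simp: nth_append)
  show ?thesis using assms(1) * unfolding alternating_form_def by blast
qed

text \<open>Polarization: the vanishing value at the repeated argument u + v is expanded.\<close>

lemma alternating_form_swap:
  assumes f: "alternating_form T k f" and T: "subspace T" and *: "length us + length vs + 2 = k"
    "set us \<subseteq> T" "set vs \<subseteq> T" "u \<in> T" "v \<in> T"
  shows "f (us @ u # v # vs) = - f (us @ v # u # vs)"
proof -
  have uv: "u + v \<in> T" using T * by (simp add: subspace_add)
  have "0 = f (us @ (1 *\<^sub>R u + 1 *\<^sub>R v) # (u + v) # vs)"
    using alternating_form_repeat[OF f *(1-3) uv] by simp
  also have "\<dots> = f (us @ u # (u + v) # vs) + f (us @ v # (u + v) # vs)"
    using * uv by (subst alternating_form_linear_at[OF f]) auto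
  also have "f (us @ u # (u + v) # vs) = f ((us @ [u]) @ (1 *\<^sub>R u + 1 *\<^sub>R v) # vs)" by simp
  also have "\<dots> = f (us @ u # u # vs) + f (us @ u # v # vs)"
    using * by (subst alternating_form_linear_at[OF f]) auto
  also have "f (us @ v # (u + v) # vs) = f ((us @ [v]) @ (1 *\<^sub>R u + 1 *\<^sub>R v) # vs)" by simp
  also have "\<dots> = f (us @ v # u # vs) + f (us @ v # v # vs)"
    using * by (subst alternating_form_linear_at[OF f]) auto
  finally show ?thesis
    using alternating_form_repeat[OF f *(1-3)] * by simp
qed

lemma alternating_form_move:
  assumes f: "alternating_form T k f" and T: "subspace T"
  shows "length us + length ys + length zs + 1 = k \<Longrightarrow> set us \<subseteq> T \<Longrightarrow> set ys \<subseteq> T \<Longrightarrow> set zs \<subseteq> T \<Longrightarrow> s \<in> T \<Longrightarrow>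
    f (us @ ys @ s # zs) = (- 1) ^ length ys * f (us @ s # ys @ zs)"
proof (induction ys arbitrary: us)
  case (Cons y ys)
  have "f (us @ (y # ys) @ s # zs) = f ((us @ [y]) @ ys @ s # zs)" by simp
  also have "\<dots> = (- 1) ^ length ys * f ((us @ [y]) @ s # ys @ zs)"
    using Cons.prems by (intro Cons.IH) auto
  also have "f ((us @ [y]) @ s # ys @ zs) = f (us @ y # s # (ys @ zs))" by simp
  also have "\<dots> = - f (us @ s # y # (ys @ zs))"
    using Cons.prems by (intro alternating_form_swap[OF f T]) auto
  finally show ?case by simp
qed simp

lemma alternating_form_linear:
  assumes "alternating_form UNIV k f" "length us + length vs + 1 = k"
  shows "linear (\<lambda>u. f (us @ u # vs))"
proof (rule linearI)
  fix u v and c :: real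
  show "f (us @ (u + v) # vs) = f (us @ u # vs) + f (us @ v # vs)"
    using alternating_form_linear_at[OF assms, of u v 1 1] by simp
  show "f (us @ (c *\<^sub>R u) # vs) = c *\<^sub>R f (us @ u # vs)"
    using alternating_form_linear_at[OF assms, of u u c 0] by simp
qed

section \<open>Differential forms on open sets of a normed space\<close>

definition form_on :: "'b::real_normed_vector set \<Rightarrow> nat \<Rightarrow> ('b \<Rightarrow> 'b list \<Rightarrow> real) \<Rightarrow> bool"
  where "form_on T k G \<longleftrightarrow> open T \<and> (\<forall>x\<in>T. alternating_form UNIV k (G x)) \<and>
    (\<forall>ws. length ws = k \<longrightarrow> smooth_on T (\<lambda>x. G x ws))"

lemma form_on_coeff_has_derivative:
  assumes "form_on T k G" "z \<in> T" "length ws = k"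
  shows "((\<lambda>z. G z ws) has_derivative frechet_derivative (\<lambda>z. G z ws) (at z)) (at z)"
  using assms unfolding form_on_def by (intro smooth_on_has_derivative[of T]) simp_all

text \<open>Smoothness of a form is given for constant arguments only. The variable ones are treated
  one at a time: the first is expanded in a basis, after which it joins the constant prefix
  \<open>us\<close> and the induction hypothesis applies.\<close>

lemma form_on_smooth_args:
  fixes \<phi> :: "'a::real_normed_vector \<Rightarrow> 'b::real_normed_vector"
  assumes fd: "finite_dim TYPE('b)" and G: "form_on T k G" and S: "open S"
    and \<phi>: "smooth_on S \<phi>" "\<phi> ` S \<subseteq> T"
  shows "\<lbrakk>\<forall>V\<in>set Vs. smooth_on S V; length us + length Vs = k\<rbrakk> \<Longrightarrow>
    smooth_on S (\<lambda>x. G (\<phi> x) (us @ map (\<lambda>V. V x) Vs))"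
proof (induction Vs arbitrary: us)
  case Nil
  then have "smooth_on T (\<lambda>x. G x us)" using G unfolding form_on_def by simp
  then have "smooth_on S (\<lambda>x. G (\<phi> x) us)"
    using smooth_on_compose[OF fd S _ \<phi>(2,1)] G unfolding form_on_def by blast
  then show ?case by simp
next
  case (Cons V Vs)
  obtain B :: "'b set" where B: "finite B" "independent B" "span B = UNIV"
    using finite_dim_basis[OF fd] .
  let ?F = "\<lambda>x. \<Sum>b\<in>B. representation B (V x) b * G (\<phi> x) ((us @ [b]) @ map (\<lambda>V. V x) Vs)"
  have "smooth_on S (\<lambda>x. G (\<phi> x) ((us @ [b]) @ map (\<lambda>V. V x) Vs))" for b
    using Cons.prems by (intro Cons.IH) auto
  moreover have "smooth_on S (\<lambda>x. representation B (V x) b)" for b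
    using Cons.prems by (intro smooth_on_bounded_linear[OF S bounded_linear_representation[OF B]]) simp
  ultimately have F: "smooth_on S ?F"
    by (intro smooth_on_sum[OF S] smooth_on_mult[OF S])
  have "?F x = G (\<phi> x) (us @ map (\<lambda>V. V x) (V # Vs))" if "x \<in> S" for x
  proof -
    have "alternating_form UNIV k (G (\<phi> x))" using G \<phi> that unfolding form_on_def by blast
    from linear_expansion[OF B alternating_form_linear[OF this], of us "map (\<lambda>V. V x) Vs" "V x"]
    show ?thesis using Cons.prems by simp
  qed
  from smooth_on_cong[OF S this F] show ?case .
qed

text \<open>Linearity in the slot has to hold on a neighbourhood of z, not just at z, before it can
  be differentiated.\<close>

lemma form_on_frechet_linear:
  assumes G: "form_on T k G" and "z \<in> T" "length us + length vs + 1 = k"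
  shows "linear (\<lambda>u. frechet_derivative (\<lambda>z. G z (us @ u # vs)) (at z) y)"
proof -
  have T: "open T" using G unfolding form_on_def by blast
  let ?D = "\<lambda>u. frechet_derivative (\<lambda>z. G z (us @ u # vs)) (at z)"
  have D: "((\<lambda>z. G z (us @ u # vs)) has_derivative ?D u) (at z)" for u
    using assms(3) by (intro form_on_coeff_has_derivative[OF G assms(2)]) simp
  have *: "?D (a *\<^sub>R u + b *\<^sub>R v) y = a * ?D u y + b * ?D v y" for a b u v
  proof -
    have "((\<lambda>z. a * G z (us @ u # vs) + b * G z (us @ v # vs)) has_derivative
      (\<lambda>y. a * ?D u y + b * ?D v y)) (at z)"
      by (intro has_derivative_add has_derivative_mult_right D)
    then have "((\<lambda>z. G z (us @ (a *\<^sub>R u + b *\<^sub>R v) # vs)) has_derivative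
      (\<lambda>y. a * ?D u y + b * ?D v y)) (at z)"
    proof (rule has_derivative_transform_within_open[OF _ T assms(2)])
      fix x assume "x \<in> T"
      then have "alternating_form UNIV k (G x)" using G unfolding form_on_def by blast
      from alternating_form_linear_at[OF this, of us vs u v a b]
      show "a * G x (us @ u # vs) + b * G x (us @ v # vs) = G x (us @ (a *\<^sub>R u + b *\<^sub>R v) # vs)"
        using assms(3) by simp
    qed
    from frechet_derivative_at[OF this] show ?thesis by metis
  qed
  show ?thesis using *[of 1 _ 1] *[of _ _ 0] by (intro linearI) simp_all
qed

text \<open>The product rule for a multilinear expression whose base point and arguments all move.
  Each entry of \<open>Vs\<close> pairs a function with its derivative at \<open>x0\<close>; the
  induction again turns moving arguments into constant ones.\<close>

lemma form_on_has_derivative: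
  fixes \<phi> :: "'a::real_normed_vector \<Rightarrow> 'b::real_normed_vector"
  assumes fd: "finite_dim TYPE('b)" and G: "form_on T k G" and S: "open S" "x0 \<in> S" "\<phi> ` S \<subseteq> T"
    and \<phi>: "(\<phi> has_derivative \<phi>') (at x0)"
  shows "\<lbrakk>\<forall>(V, V')\<in>set Vs. (V has_derivative V') (at x0); length us + length Vs = k\<rbrakk> \<Longrightarrow>
    ((\<lambda>x. G (\<phi> x) (us @ map (\<lambda>p. fst p x) Vs)) has_derivative
      (\<lambda>v. frechet_derivative (\<lambda>z. G z (us @ map (\<lambda>p. fst p x0) Vs)) (at (\<phi> x0)) (\<phi>' v) +
        (\<Sum>j<length Vs. G (\<phi> x0) (us @ (map (\<lambda>p. fst p x0) Vs)[j := snd (Vs ! j) v])))) (at x0)"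
proof (induction Vs arbitrary: us)
  case Nil
  have "\<phi> x0 \<in> T" using S by blast
  then have "((\<lambda>z. G z us) has_derivative frechet_derivative (\<lambda>z. G z us) (at (\<phi> x0))) (at (\<phi> x0))"
    using Nil by (intro form_on_coeff_has_derivative[OF G]) simp_all
  from has_derivative_compose[OF \<phi> this] show ?case by simp
next
  case (Cons p Vs)
  obtain V V' where p: "p = (V, V')" by (cases p)
  then have V: "(V has_derivative V') (at x0)" using Cons.prems by simp
  obtain B :: "'b set" where B: "finite B" "independent B" "span B = UNIV"
    using finite_dim_basis[OF fd] .
  let ?W = "map (\<lambda>p. fst p x0) Vs"
  let ?H = "\<lambda>b x. G (\<phi> x) ((us @ [b]) @ map (\<lambda>p. fst p x) Vs)"
  let ?L = "\<lambda>v u. frechet_derivative (\<lambda>z. G z (us @ u # ?W)) (at (\<phi> x0)) (\<phi>' v) +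
        (\<Sum>j<length Vs. G (\<phi> x0) (us @ u # ?W[j := snd (Vs ! j) v]))"
  let ?F = "\<lambda>x. \<Sum>b\<in>B. representation B (V x) b * ?H b x"
  have alt: "alternating_form UNIV k (G (\<phi> x))" if "x \<in> S" for x
    using G S that unfolding form_on_def by blast
  have "(?H b has_derivative (\<lambda>v. ?L v b)) (at x0)" for b
    using Cons.IH[of "us @ [b]"] Cons.prems by simp
  then have "(?F has_derivative (\<lambda>v. \<Sum>b\<in>B. representation B (V x0) b * ?L v b +
      representation B (V' v) b * ?H b x0)) (at x0)"
    by (intro has_derivative_sum has_derivative_mult
        bounded_linear.has_derivative[OF bounded_linear_representation[OF B]] V)
  moreover have "?F x = G (\<phi> x) (us @ map (\<lambda>p. fst p x) (p # Vs))" if "x \<in> S" for x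
    using linear_expansion[OF B alternating_form_linear[OF alt[OF that]], of us "map (\<lambda>p. fst p x) Vs" "V x"]
      Cons.prems p by simp
  ultimately have "((\<lambda>x. G (\<phi> x) (us @ map (\<lambda>p. fst p x) (p # Vs))) has_derivative
     (\<lambda>v. \<Sum>b\<in>B. representation B (V x0) b * ?L v b + representation B (V' v) b * ?H b x0)) (at x0)"
    by (rule has_derivative_transform_within_open[OF _ S(1,2)])
  \<comment> \<open>The sums over the basis are folded back: the first by linearity in the slot of
    the differentiated expression, the second by linearity of the form itself.\<close>
  moreover have "(\<Sum>b\<in>B. representation B (V x0) b * ?L v b + representation B (V' v) b * ?H b x0) =
     ?L v (V x0) + G (\<phi> x0) (us @ V' v # ?W)" for v
  proof -
    have "linear (?L v)"
      using Cons.prems S by (intro linear_compose_add linear_compose_sum ballI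
          form_on_frechet_linear[OF G] alternating_form_linear[OF alt]) auto
    from linear_expansion[OF B this, of "V x0"]
    have "(\<Sum>b\<in>B. representation B (V x0) b * ?L v b) = ?L v (V x0)" by simp
    moreover have "(\<Sum>b\<in>B. representation B (V' v) b * ?H b x0) = G (\<phi> x0) (us @ V' v # ?W)"
      using linear_expansion[OF B alternating_form_linear[OF alt[OF S(2)]], of us ?W "V' v"]
        Cons.prems by simp
    ultimately show ?thesis by (simp add: sum.distrib)
  qed
  ultimately show ?case
    by (simp add: p sum.lessThan_Suc_shift add_ac del: sum.lessThan_Suc)
qed

section \<open>Naturality of the exterior derivative\<close>

definition local_ext_deriv ::
    "('b::real_normed_vector \<Rightarrow> 'b list \<Rightarrow> real) \<Rightarrow> 'b \<Rightarrow> 'b list \<Rightarrow> real"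
  where "local_ext_deriv G x ws = (\<Sum>i<length ws. (-1) ^ i *
    frechet_derivative (\<lambda>x. G x (take i ws @ drop (Suc i) ws)) (at x) (ws ! i))"

text \<open>By the product rule, the derivative of a pulled-back coefficient is the pulled-back
  derivative plus terms with a second derivative of \<phi> as one argument. The former make up the
  right-hand side; the latter cancel, being symmetric second derivatives inside an alternating
  form.\<close>

lemma local_ext_deriv_pullback:
  fixes \<phi> :: "'a::real_normed_vector \<Rightarrow> 'b::real_normed_vector"
  assumes fd: "finite_dim TYPE('b)" and G: "form_on T k G" and S: "open S" "x \<in> S" "\<phi> ` S \<subseteq> T"
    and \<phi>: "smooth_on S \<phi>" and ws: "length ws = Suc k"
  shows "local_ext_deriv (\<lambda>x us. G (\<phi> x) (map (frechet_derivative \<phi> (at x)) us)) x ws =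
    local_ext_deriv G (\<phi> x) (map (frechet_derivative \<phi> (at x)) ws)"
proof -
  let ?D = "\<lambda>x. frechet_derivative \<phi> (at x)"
  let ?W = "map (?D x) ws"
  let ?DD = "\<lambda>u v. frechet_derivative (\<lambda>y. ?D y u) (at x) v"
  let ?omit = "\<lambda>i. take i ws @ drop (Suc i) ws"
  let ?A = "\<lambda>i j. G (\<phi> x) ((map (?D x) (?omit i))[j := ?DD (?omit i ! j) (ws ! i)])"
  have alt: "alternating_form UNIV k (G (\<phi> x))" using G S unfolding form_on_def by blast
  have deriv: "frechet_derivative (\<lambda>y. G (\<phi> y) (map (?D y) (?omit i))) (at x) (ws ! i) =
     frechet_derivative (\<lambda>z. G z (take i ?W @ drop (Suc i) ?W)) (at (\<phi> x)) (?W ! i) + (\<Sum>j<k. ?A i j)"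
    if "i < Suc k" for i
  proof -
    let ?Vs = "map (\<lambda>u. (\<lambda>y. ?D y u, ?DD u)) (?omit i)"
    have len: "length (?omit i) = k" using that ws by simp
    have "\<forall>(V, V')\<in>set ?Vs. (V has_derivative V') (at x)"
      using smooth_on_has_derivative[OF smooth_on_frechet_derivative[OF \<phi>] S(2)] by auto
    from form_on_has_derivative[OF fd G S smooth_on_has_derivative[OF \<phi> S(2)] this, of "[]"]
    have "((\<lambda>y. G (\<phi> y) (map (\<lambda>p. fst p y) ?Vs)) has_derivative
      (\<lambda>v. frechet_derivative (\<lambda>z. G z (map (\<lambda>p. fst p x) ?Vs)) (at (\<phi> x)) (?D x v) +
        (\<Sum>j<k. G (\<phi> x) ((map (\<lambda>p. fst p x) ?Vs)[j := snd (?Vs ! j) v])))) (at x)"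
      using len by simp
    then have "((\<lambda>y. G (\<phi> y) (map (?D y) (?omit i))) has_derivative
      (\<lambda>v. frechet_derivative (\<lambda>z. G z (map (?D x) (?omit i))) (at (\<phi> x)) (?D x v) +
        (\<Sum>j<k. G (\<phi> x) ((map (?D x) (?omit i))[j := snd (?Vs ! j) v])))) (at x)"
      by (simp add: comp_def)
    from fun_cong[OF frechet_derivative_at[OF this], of "ws ! i"]
    have "frechet_derivative (\<lambda>y. G (\<phi> y) (map (?D y) (?omit i))) (at x) (ws ! i) =
      frechet_derivative (\<lambda>z. G z (map (?D x) (?omit i))) (at (\<phi> x)) (?D x (ws ! i)) +
        (\<Sum>j<k. G (\<phi> x) ((map (?D x) (?omit i))[j := snd (?Vs ! j) (ws ! i)]))" by simp
    also have "(\<Sum>j<k. G (\<phi> x) ((map (?D x) (?omit i))[j := snd (?Vs ! j) (ws ! i)])) = (\<Sum>j<k. ?A i j)"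
      using len by (intro sum.cong refl) (simp only: nth_map lessThan_iff snd_conv)
    finally show ?thesis using that ws by (simp add: take_map drop_map)
  qed
  txt \<open>The terms with a second derivative of \<open>\<phi>\<close> cancel in pairs: omitting argument \<open>i\<close> and differentiating
    argument \<open>j + 1\<close>, or the other way round.\<close>
  have pair: "(-1) ^ i * ?A i j + (-1) ^ Suc j * ?A (Suc j) i = 0" if ij: "i \<le> j" "j < k" for i j
  proof -
    obtain as u rest where 1: "ws = as @ u # rest" "length as = i"
      using id_take_nth_drop[of i ws] ij ws by (metis (no_types) length_take less_Suc_eq_le min.absorb2 less_imp_le_nat order.strict_trans1 Suc_leD)
    have "j - i < length rest" using 1 ij ws by simp
    then obtain bs v cs where 2: "rest = bs @ v # cs" "length bs = j - i"
      using id_take_nth_drop[of "j - i" rest] by (metis length_take less_imp_le_nat min.absorb2)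
    let ?m = "map (?D x)"
    have eq: "ws = as @ u # bs @ v # cs" using 1 2 by simp
    have j: "j = length as + length bs" using 1 2 ij by simp
    have k: "length as + length bs + length cs + 1 = k" using ws eq by simp
    \<comment> \<open>The two terms differ in whether the second derivative stands before or after
      the block \<open>bs\<close>; moving it across supplies the sign (-1)^(j - i) relating the
      prefactors.\<close>
    have "?A i j = G (\<phi> x) (?m as @ ?m bs @ ?DD v u # ?m cs)"
      using j 1(2) by (simp add: eq nth_append list_update_append)
    also have "\<dots> = (-1) ^ length (?m bs) * G (\<phi> x) (?m as @ ?DD v u # ?m bs @ ?m cs)"
      using k by (intro alternating_form_move[OF alt]) auto
    also have "?DD v u = ?DD u v" by (rule second_derivative_symmetric[OF fd S(1) \<phi> S(2)])
    also have "G (\<phi> x) (?m as @ ?DD u v # ?m bs @ ?m cs) = ?A (Suc j) i"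
      using j 1(2) by (simp add: eq nth_append list_update_append)
    finally have "?A i j = (-1) ^ length bs * ?A (Suc j) i" by simp
    then show ?thesis using j 1(2) by (simp add: power_add flip: power_mult_distrib)
  qed
  define A where "A i j = ?A i j" for i j
  have pair: "(-1) ^ i * A i j + (-1) ^ Suc j * A (Suc j) i = 0" if "i \<le> j" "j < k" for i j
    unfolding A_def using that by (rule pair)
  let ?a = "\<lambda>(i, j). (-1) ^ i * A i j"
  have "(\<Sum>i<Suc k. \<Sum>j<k. (-1) ^ i * A i j) = (\<Sum>p\<in>{..<Suc k} \<times> {..<k}. ?a p)"
    by (simp only: sum.cartesian_product)
  \<comment> \<open>Position j of the list without entry i is position j + 1 of the full list
    exactly when i \<le> j. The map from (i, j) to (j + 1, i) therefore exchanges the two parts of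
    the index rectangle.\<close>
  also have "{..<Suc k} \<times> {..<k} = {(i, j). i \<le> j \<and> j < k} \<union> {(i, j). j < i \<and> i \<le> k}" by auto
  also have "sum ?a \<dots> = sum ?a {(i, j). i \<le> j \<and> j < k} + sum ?a {(i, j). j < i \<and> i \<le> k}"
  proof (rule sum.union_disjoint)
    show "finite {(i, j). i \<le> j \<and> j < k}"
      by (rule finite_subset[of _ "{..k} \<times> {..k}"]) auto
    show "finite {(i, j). j < i \<and> i \<le> k}"
      by (rule finite_subset[of _ "{..k} \<times> {..k}"]) auto
  qed auto
  also have "sum ?a {(i, j). j < i \<and> i \<le> k} = (\<Sum>(i, j)\<in>{(i, j). i \<le> j \<and> j < k}. ?a (Suc j, i))"
    by (rule sum.reindex_bij_witness[of _ "\<lambda>(i, j). (Suc j, i)" "\<lambda>(i, j). (j, i - 1)"])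
      (auto simp del: power_Suc)
  also have "sum ?a {(i, j). i \<le> j \<and> j < k} + \<dots> =
     (\<Sum>(i, j)\<in>{(i, j). i \<le> j \<and> j < k}. ?a (i, j) + ?a (Suc j, i))"
    by (simp only: sum.distrib case_prod_unfold prod.collapse fst_conv snd_conv)
  also have "\<dots> = 0"
    using pair by (intro sum.neutral) auto
  finally have "(\<Sum>i<Suc k. \<Sum>j<k. (-1) ^ i * A i j) = 0" .
  then show ?thesis
    unfolding local_ext_deriv_def using deriv[folded A_def] ws
    by (simp add: distrib_left sum.distrib sum_distrib_left del: sum.lessThan_Suc)
qed

text \<open>Induction on \<open>dim E\<close>: if \<open>a i t0 v \<noteq> 0\<close>, then \<open>\<theta> t e = a i t v *\<^sub>R e - a i t e *\<^sub>R v\<close> maps the fixed hyperplane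
  \<open>ker (a i t0)\<close> of \<open>E\<close> isomorphically onto \<open>ker (a i t)\<close> for \<open>t\<close> near \<open>t0\<close>. As \<open>\<theta>\<close> is polynomial in the
  data, no inverse matrix has to be differentiated; the price is the scalar \<open>l\<close> in the conclusion.\<close>

lemma smooth_kernel_section:
  fixes a :: "'i \<Rightarrow> 'x::real_normed_vector \<Rightarrow> 'v::real_normed_vector \<Rightarrow> real"
  assumes fd: "finite_dim TYPE('v)" and "open S" "t0 \<in> S" "subspace E"
    and "\<And>i t. t \<in> S \<Longrightarrow> linear (a i t)" "\<And>i v. smooth_on S (\<lambda>t. a i t v)"
    and "\<And>t. t \<in> S \<Longrightarrow> dim {e \<in> E. \<forall>i. a i t e = 0} = r"
    and "u0 \<in> E" "\<And>i. a i t0 u0 = 0"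
  shows "\<exists>S' u l. open S' \<and> t0 \<in> S' \<and> S' \<subseteq> S \<and> smooth_on S' u \<and> u t0 = l *\<^sub>R u0 \<and> l \<noteq> 0 \<and>
    (\<forall>t\<in>S'. u t \<in> E \<and> (\<forall>i. a i t (u t) = 0))"
  using assms(2-)
proof (induction "dim E" arbitrary: a S E rule: less_induct)
  case less
  note E = \<open>subspace E\<close> and lin = less.prems(4) and smooth = less.prems(5)
  have sub: "subspace {e \<in> E. \<forall>i. a i t e = 0}" if "t \<in> S" for t
    using E lin[OF that] by (auto simp: subspace_def linear_0 linear_add linear_scale)
  show ?case
  proof (cases "\<forall>i. \<forall>e\<in>E. a i t0 e = 0")
    \<comment> \<open>At \<open>t0\<close> the kernel is all of \<open>E\<close>, so r = dim E, and
      constancy of the rank makes it all of \<open>E\<close> on \<open>S\<close>: a constant section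
      serves.\<close>
    case True
    then have "{e \<in> E. \<forall>i. a i t0 e = 0} = E" by blast
    then have "r = dim E" using less.prems(6)[OF less.prems(2)] by simp
    then have "{e \<in> E. \<forall>i. a i t e = 0} = E" if "t \<in> S" for t
      using finite_dim_dim_psubset[OF fd sub[OF that] E] less.prems(6)[OF that] by fastforce
    then have "\<forall>t\<in>S. u0 \<in> E \<and> (\<forall>i. a i t u0 = 0)" using less.prems(7) by blast
    then show ?thesis
      using less.prems(1,2) by (intro exI[of _ S] exI[of _ "\<lambda>_. u0"] exI[of _ 1]) simp
  next
    case False
    then obtain i v where iv: "v \<in> E" "a i t0 v \<noteq> 0" by blast
    define E1 where "E1 = {e \<in> E. a i t0 e = 0}"
    define S1 where "S1 = S \<inter> (\<lambda>t. a i t v) -` (- {0})"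
    have S1: "open S1" "t0 \<in> S1" "S1 \<subseteq> S"
      using continuous_open_preimage[OF smooth_on_continuous[OF smooth[of i v]] less.prems(1), of "- {0}"]
        less.prems(2) iv by (auto simp: S1_def)
    have E1: "subspace E1"
      using E lin[OF less.prems(2), of i] by (auto simp: E1_def subspace_def linear_0 linear_add linear_scale)
    have "E1 \<subset> E" using iv by (auto simp: E1_def)
    then have dimE1: "dim E1 < dim E" by (rule finite_dim_dim_psubset[OF fd E1 E])
    define \<theta> where "\<theta> t e = a i t v *\<^sub>R e - a i t e *\<^sub>R v" for t e
    have lin\<theta>: "linear (\<theta> t)" if "t \<in> S" for t
      using lin[OF that, of i] by (auto simp: \<theta>_def linear_add linear_scale algebra_simps intro!: linearI)
    have a\<theta>: "a j t (\<theta> t e) = a i t v * a j t e - a i t e * a j t v" if "t \<in> S" for j t e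
      using lin[OF that, of j] by (simp add: \<theta>_def linear_diff linear_scale)
    \<comment> \<open>\<open>\<theta> t\<close> maps the solutions of the new system in
      \<open>E1\<close> bijectively to those of the old one in \<open>E\<close>, so the rank
      hypothesis survives the passage to the hyperplane.\<close>
    have dims: "dim {e \<in> E1. \<forall>j. a j t (\<theta> t e) = 0} = r" if t: "t \<in> S1" for t
    proof -
      have tS: "t \<in> S" and nz: "a i t v \<noteq> 0" using t by (auto simp: S1_def)
      have sub1: "subspace {e \<in> E1. \<forall>j. a j t (\<theta> t e) = 0}"
        using E1 lin[OF tS] lin\<theta>[OF tS] by (auto simp: subspace_def linear_0 linear_add linear_scale)
      \<comment> \<open>A zero of \<open>\<theta> t\<close> is a multiple of v, but
        \<open>a i t0\<close> vanishes on e and not on v.\<close>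
      have "e = 0" if "e \<in> E1" "\<theta> t e = 0" for e
      proof -
        have e: "a i t v *\<^sub>R e = a i t e *\<^sub>R v" using that(2) by (simp add: \<theta>_def)
        have "a i t e * a i t0 v = a i t0 (a i t e *\<^sub>R v)"
          using lin[OF less.prems(2), of i] by (simp add: linear_scale)
        also have "\<dots> = a i t v * a i t0 e"
          unfolding e[symmetric] using lin[OF less.prems(2), of i] by (simp add: linear_scale)
        also have "\<dots> = 0" using that(1) by (simp add: E1_def)
        finally have "a i t e = 0" using iv by simp
        then show ?thesis using e nz by simp
      qed
      then have inj: "inj_on (\<theta> t) {e \<in> E1. \<forall>j. a j t (\<theta> t e) = 0}"
        using linear_injective_on_subspace_0[OF lin\<theta>[OF tS] sub1] by blast
      have "\<theta> t ` {e \<in> E1. \<forall>j. a j t (\<theta> t e) = 0} = {e \<in> E. \<forall>j. a j t e = 0}"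
      proof (intro equalityI subsetI)
        fix e assume "e \<in> \<theta> t ` {e \<in> E1. \<forall>j. a j t (\<theta> t e) = 0}"
        then obtain e1 where e1: "e1 \<in> E" "e = \<theta> t e1" "\<forall>j. a j t (\<theta> t e1) = 0"
          by (auto simp: E1_def)
        have "\<theta> t e1 \<in> E"
          unfolding \<theta>_def using E e1(1) iv(1) by (intro subspace_diff subspace_scale)
        then show "e \<in> {e \<in> E. \<forall>j. a j t e = 0}" using e1 by simp
      next
        fix e assume e: "e \<in> {e \<in> E. \<forall>j. a j t e = 0}"
        \<comment> \<open>Removing the multiple of v seen by \<open>a i t0\<close> brings e into
          \<open>E1\<close>; the division in the next line compensates the factor
          \<open>a i t v\<close> in \<open>\<theta>\<close>.\<close>
        let ?s = "a i t0 e / a i t0 v"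
        let ?e = "(1 / a i t v) *\<^sub>R (e - ?s *\<^sub>R v)"
        have "e - ?s *\<^sub>R v \<in> E" using E e iv by (intro subspace_diff subspace_scale) auto
        moreover have "a i t0 (e - ?s *\<^sub>R v) = 0"
          using lin[OF less.prems(2), of i] iv by (simp add: linear_diff linear_scale)
        ultimately have "?e \<in> E1"
          using E1 by (intro subspace_scale) (auto simp: E1_def)
        moreover have "\<theta> t ?e = e"
          using lin[OF tS, of i] e nz by (simp add: \<theta>_def linear_diff linear_scale algebra_simps)
        ultimately show "e \<in> \<theta> t ` {e \<in> E1. \<forall>j. a j t (\<theta> t e) = 0}"
          using e by (intro image_eqI[of _ _ ?e]) auto
      qed
      then have "dim (\<theta> t ` {e \<in> E1. \<forall>j. a j t (\<theta> t e) = 0}) = r" using less.prems(6)[OF tS] by simp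
      then show ?thesis using finite_dim_dim_image[OF fd lin\<theta>[OF tS] sub1 inj] by simp
    qed
    have smooth1: "smooth_on S1 (\<lambda>t. a j t (\<theta> t e))" for j e
    proof (rule smooth_on_cong[OF S1(1)])
      show "smooth_on S1 (\<lambda>t. a i t v * a j t e - a i t e * a j t v)"
        by (intro smooth_on_diff[OF S1(1)] smooth_on_mult[OF S1(1)] smooth_on_subset[OF smooth S1(3)])
      show "a i t v * a j t e - a i t e * a j t v = a j t (\<theta> t e)" if "t \<in> S1" for t
        using a\<theta> S1(3) that by fastforce
    qed
    have lin1: "linear (\<lambda>e. a j t (\<theta> t e))" if "t \<in> S1" for j t
      using linear_compose[OF lin\<theta> lin] S1(3) that by (auto simp: comp_def)
    have u0: "u0 \<in> E1" using less.prems(7,8) by (simp add: E1_def)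
    have zero: "a j t0 (\<theta> t0 u0) = 0" for j
      using a\<theta>[OF less.prems(2)] less.prems(8) by simp
    from less.hyps[OF dimE1, of S1 "\<lambda>j t e. a j t (\<theta> t e)", OF S1(1,2) E1 lin1 smooth1 dims u0 zero]
    obtain S' u l where u: "open S'" "t0 \<in> S'" "S' \<subseteq> S1" "smooth_on S' u" "u t0 = l *\<^sub>R u0" "l \<noteq> 0"
      "\<forall>t\<in>S'. u t \<in> E1 \<and> (\<forall>j. a j t (\<theta> t (u t)) = 0)" by blast
    obtain B :: "'v set" where B: "finite B" "independent B" "span B = UNIV"
      using finite_dim_basis[OF fd] .
    have S': "S' \<subseteq> S" using u S1 by blast
    have "smooth_on S' (\<lambda>t. \<Sum>b\<in>B. representation B (u t) b * a i t b)"
      by (intro smooth_on_sum[OF u(1)] smooth_on_mult[OF u(1)] smooth_on_subset[OF smooth S']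
          smooth_on_bounded_linear[OF u(1) bounded_linear_representation[OF B] u(4)])
    then have "smooth_on S' (\<lambda>t. a i t (u t))"
    proof (rule smooth_on_cong[OF u(1), rotated])
      show "(\<Sum>b\<in>B. representation B (u t) b * a i t b) = a i t (u t)" if "t \<in> S'" for t
        using linear_expansion[OF B lin, of t i "u t"] S' that by auto
    qed
    then have "smooth_on S' (\<lambda>t. \<theta> t (u t))"
      unfolding \<theta>_def
      by (intro smooth_on_diff[OF u(1)] smooth_on_scaleR[OF u(1)] smooth_on_subset[OF smooth S']
          u(4) smooth_on_const)
    \<comment> \<open>Each level of the induction multiplies the value at \<open>t0\<close> by the
      nonzero number \<open>a i t0 v\<close>; this is where \<open>l\<close> comes from.\<close>
    moreover have "\<theta> t0 (u t0) = (a i t0 v * l) *\<^sub>R u0"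
      using u(5) less.prems(8) lin[OF less.prems(2), of i] by (simp add: \<theta>_def linear_scale)
    moreover have "\<theta> t (u t) \<in> E" if "t \<in> S'" for t
      unfolding \<theta>_def using E iv u(7) that by (intro subspace_diff subspace_scale) (auto simp: E1_def)
    ultimately show ?thesis
      using u S' iv
      by (intro exI[of _ S'] exI[of _ "\<lambda>t. \<theta> t (u t)"] exI[of _ "a i t0 v * l"]) auto
  qed
qed

section \<open>Parametrizations of manifolds\<close>

lemma smooth_manifold_finite_dim:
  "smooth_manifold (M :: ('a, 'e::real_normed_vector) manifold) \<Longrightarrow> finite_dim TYPE('e)"
  unfolding smooth_manifold_def finite_dim_def by blast

lemma chart_openin: "smooth_manifold M \<Longrightarrow> c \<in> atlas M \<Longrightarrow> openin (mtop M) (fst c)"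
  and chart_image_open: "smooth_manifold M \<Longrightarrow> c \<in> atlas M \<Longrightarrow> open (chart_image c)"
  and chart_homeomorphic: "smooth_manifold M \<Longrightarrow> c \<in> atlas M \<Longrightarrow>
    homeomorphic_map (subtopology (mtop M) (fst c)) (top_of_set (chart_image c)) (snd c)"
  and chart_transition_smooth: "smooth_manifold M \<Longrightarrow> c \<in> atlas M \<Longrightarrow> d \<in> atlas M \<Longrightarrow>
    smooth_on (snd c ` (fst c \<inter> fst d)) (snd d \<circ> chart_inv c)"
  and charts_cover: "smooth_manifold M \<Longrightarrow> (\<Union>c\<in>atlas M. fst c) = carrier M"
  unfolding smooth_manifold_def by blast+

lemma chart_subset_carrier: "smooth_manifold M \<Longrightarrow> c \<in> atlas M \<Longrightarrow> fst c \<subseteq> carrier M"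
  using charts_cover by blast

lemma chart_inj:
  assumes "smooth_manifold M" "c \<in> atlas M" shows "inj_on (snd c) (fst c)"
proof -
  have "topspace (subtopology (mtop M) (fst c)) = fst c"
    using chart_subset_carrier[OF assms] by (auto simp: carrier_def)
  then show ?thesis
    using homeomorphic_imp_injective_map[OF chart_homeomorphic[OF assms]] by simp
qed

lemma chart_inv_chart: "smooth_manifold M \<Longrightarrow> c \<in> atlas M \<Longrightarrow> y \<in> fst c \<Longrightarrow> chart_inv c (snd c y) = y"
  unfolding chart_inv_def using chart_inj inv_into_f_f by fast

lemma chart_chart_inv: "x \<in> chart_image c \<Longrightarrow> snd c (chart_inv c x) = x"
  unfolding chart_image_def chart_inv_def by (rule f_inv_into_f)

lemma chart_inv_in: "x \<in> chart_image c \<Longrightarrow> chart_inv c x \<in> fst c"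
  unfolding chart_image_def chart_inv_def by (rule inv_into_into)

lemma chart_in_image: "y \<in> fst c \<Longrightarrow> snd c y \<in> chart_image c"
  unfolding chart_image_def by simp

lemma chart_image_Int:
  assumes "smooth_manifold M" "c \<in> atlas M"
  shows "snd c ` (fst c \<inter> W) = {x \<in> chart_image c. chart_inv c x \<in> W}"
proof (intro equalityI subsetI)
  fix x assume "x \<in> snd c ` (fst c \<inter> W)"
  then obtain y where "x = snd c y" "y \<in> fst c" "y \<in> W" by blast
  then show "x \<in> {x \<in> chart_image c. chart_inv c x \<in> W}"
    using chart_inv_chart[OF assms, of y] chart_in_image[of y c] by simp
next
  fix x assume "x \<in> {x \<in> chart_image c. chart_inv c x \<in> W}"
  then show "x \<in> snd c ` (fst c \<inter> W)"
    using chart_chart_inv[of x c] chart_inv_in[of x c] by (intro image_eqI[of _ _ "chart_inv c x"]) auto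
qed

lemma chart_image_Int_open:
  assumes "smooth_manifold M" "c \<in> atlas M" "openin (mtop M) W"
  shows "open (snd c ` (fst c \<inter> W))"
proof -
  have "openin (subtopology (mtop M) (fst c)) (fst c \<inter> W)"
    using assms(3) by (rule openin_subtopology_Int2)
  then have "openin (top_of_set (chart_image c)) (snd c ` (fst c \<inter> W))"
    using homeomorphic_imp_open_map[OF chart_homeomorphic[OF assms(1,2)]] unfolding open_map_def by blast
  then show ?thesis using openin_open_trans chart_image_open[OF assms(1,2)] by blast
qed

lemma charts_at_obtain:
  assumes "smooth_manifold M" "y \<in> carrier M"
  obtains c where "c \<in> charts_at M y"
  using assms charts_cover[OF assms(1)] unfolding charts_at_def by blast

lemma some_chart_in: "smooth_manifold M \<Longrightarrow> y \<in> carrier M \<Longrightarrow> some_chart M y \<in> charts_at M y"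
  unfolding some_chart_def using charts_at_obtain someI[of "\<lambda>c. c \<in> charts_at M y"] by metis

lemma charts_atD: "c \<in> charts_at M y \<Longrightarrow> c \<in> atlas M" "c \<in> charts_at M y \<Longrightarrow> y \<in> fst c"
  unfolding charts_at_def by auto

text \<open>The common form in which chart inverses, trivializations and local sections enter. The
  map may be degenerate and its domain may have another dimension than \<open>M\<close>, so that
  such maps can be composed freely.\<close>

definition param ::
    "('a, 'e::real_normed_vector) manifold \<Rightarrow> 'x::real_normed_vector set \<Rightarrow> ('x \<Rightarrow> 'a) \<Rightarrow> bool"
  where "param M S f \<longleftrightarrow> open S \<and> continuous_map (top_of_set S) (mtop M) f \<and>
    (\<forall>c\<in>atlas M. smooth_on (S \<inter> f -` fst c) (\<lambda>x. snd c (f x)))"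

text \<open>The tangent map of \<open>f\<close> with the tangent space of the domain identified with
  the vector space itself. For chart inverses it is \<open>coord_tvec\<close>.\<close>

definition push ::
    "('a, 'e::real_normed_vector) manifold \<Rightarrow> ('x::real_normed_vector \<Rightarrow> 'a) \<Rightarrow> 'x \<Rightarrow> 'x \<Rightarrow> ('a, 'e) tvec"
  where "push M f x w = (\<lambda>d. if d \<in> charts_at M (f x)
    then frechet_derivative (\<lambda>z. snd d (f z)) (at x) w else 0)"

lemma param_open: "param M S f \<Longrightarrow> open S"
  unfolding param_def by blast

lemma param_open_vimage:
  assumes "param M S f" "openin (mtop M) W" shows "open (S \<inter> f -` W)"
proof -
  have "openin (top_of_set S) {x \<in> topspace (top_of_set S). f x \<in> W}"
    using assms unfolding param_def continuous_map_def by blast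
  moreover have "{x \<in> topspace (top_of_set S). f x \<in> W} = S \<inter> f -` W" by auto
  ultimately show ?thesis using openin_open_trans assms(1) unfolding param_def by metis
qed

lemma param_carrier: "param M S f \<Longrightarrow> x \<in> S \<Longrightarrow> f x \<in> carrier M"
  unfolding param_def continuous_map_def carrier_def by auto

lemma param_smooth: "param M S f \<Longrightarrow> c \<in> atlas M \<Longrightarrow> smooth_on (S \<inter> f -` fst c) (\<lambda>x. snd c (f x))"
  unfolding param_def by blast

lemma param_chart_vimage_open:
  "smooth_manifold M \<Longrightarrow> param M S f \<Longrightarrow> c \<in> atlas M \<Longrightarrow> open (S \<inter> f -` fst c)"
  using param_open_vimage chart_openin by blast

lemma param_has_derivative:
  assumes "param M S f" "x \<in> S" "c \<in> charts_at M (f x)"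
  shows "((\<lambda>z. snd c (f z)) has_derivative frechet_derivative (\<lambda>z. snd c (f z)) (at x)) (at x)"
  using assms by (intro smooth_on_has_derivative[OF param_smooth]) (auto simp: charts_at_def)

lemma param_subset:
  assumes "param M S f" "open T" "T \<subseteq> S" shows "param M T f"
  using assms unfolding param_def
  by (auto intro: continuous_map_from_subtopology_mono elim!: smooth_on_subset)

lemma param_chart_inv:
  assumes "smooth_manifold M" "c \<in> atlas M" shows "param M (chart_image c) (chart_inv c)"
  unfolding param_def
proof (intro conjI ballI)
  show "open (chart_image c)" by (rule chart_image_open[OF assms])
  show "continuous_map (top_of_set (chart_image c)) (mtop M) (chart_inv c)"
    unfolding continuous_map_def
  proof (intro conjI allI impI)
    show "chart_inv c \<in> topspace (top_of_set (chart_image c)) \<rightarrow> topspace (mtop M)"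
      using chart_inv_in[of _ c] chart_subset_carrier[OF assms] by (auto simp: carrier_def)
    fix W assume "openin (mtop M) W"
    then have "open {x \<in> chart_image c. chart_inv c x \<in> W}"
      using chart_image_Int_open[OF assms] chart_image_Int[OF assms] by simp
    then show "openin (top_of_set (chart_image c)) {x \<in> topspace (top_of_set (chart_image c)). chart_inv c x \<in> W}"
      by (auto intro: open_subset)
  qed
  fix d assume d: "d \<in> atlas M"
  have "chart_image c \<inter> chart_inv c -` fst d = snd c ` (fst c \<inter> fst d)"
    unfolding chart_image_Int[OF assms] by auto
  then show "smooth_on (chart_image c \<inter> chart_inv c -` fst d) (\<lambda>x. snd d (chart_inv c x))"
    using chart_transition_smooth[OF assms d] by (simp add: comp_def)
qed

lemma param_compose:
  fixes f :: "'x::real_normed_vector \<Rightarrow> 'a"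
  assumes M: "smooth_manifold M" and fd: "finite_dim TYPE('x)" and f: "param M S f"
    and \<phi>: "open T" "smooth_on T \<phi>" "\<phi> ` T \<subseteq> S"
  shows "param M T (\<lambda>x. f (\<phi> x))"
  unfolding param_def
proof (intro conjI ballI)
  show "open T" by fact
  have "continuous_map (top_of_set T) (top_of_set S) \<phi>"
    using smooth_on_continuous[OF \<phi>(2)] \<phi>(3) by auto
  then show cont: "continuous_map (top_of_set T) (mtop M) (\<lambda>x. f (\<phi> x))"
    using f continuous_map_compose[of _ _ \<phi> _ f] unfolding param_def comp_def by blast
  fix c assume c: "c \<in> atlas M"
  have "open (T \<inter> \<phi> -` (S \<inter> f -` fst c))"
    using continuous_open_preimage[OF smooth_on_continuous[OF \<phi>(2)] \<phi>(1)]
      param_chart_vimage_open[OF M f c] by blast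
  moreover have eq: "T \<inter> \<phi> -` (S \<inter> f -` fst c) = T \<inter> (\<lambda>x. f (\<phi> x)) -` fst c" using \<phi>(3) by auto
  ultimately have "open (T \<inter> (\<lambda>x. f (\<phi> x)) -` fst c)" by simp
  then show "smooth_on (T \<inter> (\<lambda>x. f (\<phi> x)) -` fst c) (\<lambda>x. snd c (f (\<phi> x)))"
    using \<phi> by (intro smooth_on_compose[OF fd _ param_chart_vimage_open[OF M f c] _ _ param_smooth[OF f c]])
      (auto intro: smooth_on_subset)
qed

lemma param_smooth_map:
  fixes M :: "('a, 'e::real_normed_vector) manifold"
  assumes M: "smooth_manifold M" and N: "smooth_manifold N" and f: "param M S f"
    and h: "smooth_map M N U h" and sub: "f ` S \<subseteq> U"
  shows "param N S (\<lambda>x. h (f x))"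
  unfolding param_def
proof (intro conjI ballI)
  show "open S" by (rule param_open[OF f])
  have "continuous_map (top_of_set S) (subtopology (mtop M) U) f"
    using f sub unfolding param_def by (auto simp: continuous_map_in_subtopology)
  then show cont: "continuous_map (top_of_set S) (mtop N) (\<lambda>x. h (f x))"
    using h continuous_map_compose[of _ _ f _ h] unfolding smooth_map_def comp_def by blast
  fix d assume d: "d \<in> atlas N"
  have hU: "openin (mtop M) U" using h unfolding smooth_map_def by blast
  have hcont: "continuous_map (subtopology (mtop M) U) (mtop N) h"
    using h unfolding smooth_map_def by blast
  have "openin (subtopology (mtop M) U) {y \<in> topspace (subtopology (mtop M) U). h y \<in> fst d}"
    using hcont chart_openin[OF N d] unfolding continuous_map_def by blast
  moreover have "{y \<in> topspace (subtopology (mtop M) U). h y \<in> fst d} = U \<inter> h -` fst d"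
    using openin_subset[OF hU] by auto
  ultimately have V: "openin (mtop M) (U \<inter> h -` fst d)"
    using openin_open_subtopology[OF hU] by auto
  show "smooth_on (S \<inter> (\<lambda>x. h (f x)) -` fst d) (\<lambda>x. snd d (h (f x)))"
  proof (rule smooth_on_local)
    fix x assume x: "x \<in> S \<inter> (\<lambda>x. h (f x)) -` fst d"
    then obtain c where c: "c \<in> charts_at M (f x)"
      using charts_at_obtain[OF M] param_carrier[OF f] by blast
    let ?A = "S \<inter> f -` (fst c \<inter> (U \<inter> h -` fst d))"
    have A: "open ?A"
      using c by (intro param_open_vimage[OF f] openin_Int V chart_openin[OF M]) (rule charts_atD)
    let ?T = "snd c ` (fst c \<inter> U \<inter> h -` fst d)"
    have T: "open ?T"
      using chart_image_Int_open[OF M charts_atD(1)[OF c] V] by (simp add: Int_assoc)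
    have g: "smooth_on ?T (snd d \<circ> h \<circ> chart_inv c)"
      using h charts_atD(1)[OF c] d unfolding smooth_map_def by blast
    have \<phi>: "smooth_on ?A (\<lambda>x. snd c (f x))"
      by (rule smooth_on_subset[OF param_smooth[OF f charts_atD(1)[OF c]]]) auto
    have "(\<lambda>x. snd c (f x)) ` ?A \<subseteq> ?T" by auto
    then have "smooth_on ?A (\<lambda>x. (snd d \<circ> h \<circ> chart_inv c) (snd c (f x)))"
      by (rule smooth_on_compose[OF smooth_manifold_finite_dim[OF M] A T _ \<phi> g])
    then have "smooth_on ?A (\<lambda>x. snd d (h (f x)))"
      by (rule smooth_on_cong[OF A, rotated]) (auto simp: chart_inv_chart[OF M charts_atD(1)[OF c]])
    moreover have "x \<in> ?A" using x c sub by (auto simp: charts_at_def)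
    ultimately show "\<exists>T. open T \<and> x \<in> T \<and> smooth_on T (\<lambda>x. snd d (h (f x)))"
      using A by blast
  qed
qed

lemma smooth_map_openin: "smooth_map M N U h \<Longrightarrow> openin (mtop M) U"
  unfolding smooth_map_def by blast

lemma smooth_map_chart_param:
  assumes "smooth_manifold M" "smooth_manifold N" "smooth_map M N U h" "c \<in> atlas M"
  shows "param N (snd c ` (fst c \<inter> U)) (\<lambda>x. h (chart_inv c x))"
proof (rule param_smooth_map[OF assms(1,2) _ assms(3)])
  show "param M (snd c ` (fst c \<inter> U)) (chart_inv c)"
    using chart_image_Int_open[OF assms(1,4) smooth_map_openin[OF assms(3)]]
    by (intro param_subset[OF param_chart_inv[OF assms(1,4)]]) (auto simp: chart_image_def)
  show "chart_inv c ` snd c ` (fst c \<inter> U) \<subseteq> U"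
    using chart_inv_chart[OF assms(1,4)] by auto
qed

lemma smooth_map_maps: "smooth_map M N U h \<Longrightarrow> y \<in> U \<Longrightarrow> h y \<in> carrier N"
  using openin_subset[of "mtop M" U] unfolding smooth_map_def continuous_map_def carrier_def by auto

lemma smooth_map_compose:
  assumes M: "smooth_manifold M" and N: "smooth_manifold N" and K: "smooth_manifold K"
    and f: "smooth_map M N U f" and g: "smooth_map N K V g" and sub: "f ` U \<subseteq> V"
  shows "smooth_map M K U (g \<circ> f)"
  unfolding smooth_map_def
proof (intro conjI ballI)
  show "openin (mtop M) U" by (rule smooth_map_openin[OF f])
  have "continuous_map (subtopology (mtop M) U) (subtopology (mtop N) V) f"
    using f sub openin_subset[OF smooth_map_openin[OF f]]
    unfolding smooth_map_def by (auto simp: continuous_map_in_subtopology)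
  then show "continuous_map (subtopology (mtop M) U) (mtop K) (g \<circ> f)"
    using g continuous_map_compose unfolding smooth_map_def by blast
  fix c d assume c: "c \<in> atlas M" and d: "d \<in> atlas K"
  have "param K (snd c ` (fst c \<inter> U)) (\<lambda>x. g (f (chart_inv c x)))"
    using sub chart_inv_chart[OF M c]
    by (intro param_smooth_map[OF N K smooth_map_chart_param[OF M N f c] g]) auto
  moreover have "snd c ` (fst c \<inter> U) \<inter> (\<lambda>x. g (f (chart_inv c x))) -` fst d =
      snd c ` (fst c \<inter> U \<inter> (g \<circ> f) -` fst d)"
    using chart_inv_chart[OF M c] by auto
  ultimately show "smooth_on (snd c ` (fst c \<inter> U \<inter> (g \<circ> f) -` fst d)) (snd d \<circ> (g \<circ> f) \<circ> chart_inv c)"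
    using param_smooth[of K _ _ d] d by (fastforce simp: comp_def)
qed

section \<open>Tangent vectors as derivatives of parametrizations\<close>

lemma push_cong:
  fixes M :: "('a, 'e::real_normed_vector) manifold"
  assumes "open S" "x \<in> S" "\<And>z. z \<in> S \<Longrightarrow> f z = g z"
  shows "push M f x = push M g x"
proof -
  have "frechet_derivative (\<lambda>z. snd d (f z)) (at x) = frechet_derivative (\<lambda>z. snd d (g z)) (at x)"
    for d :: "('a, 'e) chart"
    using assms(3) by (intro frechet_derivative_cong_open[OF assms(1,2)]) simp
  then show ?thesis unfolding push_def using assms by (intro ext) simp
qed

lemma push_compose:
  assumes "param M S f" "\<phi> x \<in> S" "\<phi> differentiable (at x)"
  shows "push M (\<lambda>z. f (\<phi> z)) x w = push M f (\<phi> x) (frechet_derivative \<phi> (at x) w)"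
proof -
  have "frechet_derivative (\<lambda>z. snd d (f (\<phi> z))) (at x) w =
    frechet_derivative (\<lambda>z. snd d (f z)) (at (\<phi> x)) (frechet_derivative \<phi> (at x) w)"
    if d: "d \<in> charts_at M (f (\<phi> x))" for d
  proof -
    have "((\<lambda>z. snd d (f (\<phi> z))) has_derivative
      (\<lambda>w. frechet_derivative (\<lambda>z. snd d (f z)) (at (\<phi> x)) (frechet_derivative \<phi> (at x) w))) (at x)"
      using assms(3) d
      by (intro has_derivative_compose[of \<phi> _ x UNIV "\<lambda>z. snd d (f z)"] param_has_derivative[OF assms(1,2)])
        (simp_all add: frechet_derivative_works)
    from fun_cong[OF frechet_derivative_at[OF this]] show ?thesis by simp
  qed
  then show ?thesis unfolding push_def by (intro ext) simp
qed

lemma push_linear: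
  assumes "param M S f" "x \<in> S" shows "linear (push M f x)"
proof -
  have "linear (frechet_derivative (\<lambda>z. snd d (f z)) (at x))" if "d \<in> charts_at M (f x)" for d
    using has_derivative_linear[OF param_has_derivative[OF assms that]] .
  then show ?thesis
    by (intro linearI ext) (simp_all add: push_def scaleR_fun_def linear_add linear_scale)
qed

text \<open>Locally \<open>f\<close> is the chart inverse after the coordinate expression of
  \<open>f\<close>. The compatibility of components between charts in \<open>push_tangent\<close>
  thereby becomes the chain rule.\<close>

lemma push_chart:
  assumes M: "smooth_manifold M" and f: "param M S f" "x \<in> S" and c: "c \<in> charts_at M (f x)"
  shows "push M f x w = push M (chart_inv c) (snd c (f x)) (frechet_derivative (\<lambda>z. snd c (f z)) (at x) w)"
proof -
  let ?T = "S \<inter> f -` fst c"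
  have x: "open ?T" "x \<in> ?T"
    using param_chart_vimage_open[OF M f(1)] c f(2) by (auto simp: charts_at_def)
  have "push M f x w = push M (\<lambda>z. chart_inv c (snd c (f z))) x w"
    using chart_inv_chart[OF M] c by (subst push_cong[OF x]) (auto simp: charts_at_def)
  also have "\<dots> = push M (chart_inv c) (snd c (f x)) (frechet_derivative (\<lambda>z. snd c (f z)) (at x) w)"
    using param_has_derivative[OF f c] differentiableI charts_atD[OF c]
    by (intro push_compose[OF param_chart_inv[OF M]] chart_in_image) blast+
  finally show ?thesis .
qed

lemma coord_tvec_eq_push:
  "x \<in> chart_image c \<Longrightarrow> coord_tvec M c (chart_inv c x) = push M (chart_inv c) x"
  unfolding coord_tvec_def push_def by (intro ext) (simp add: chart_chart_inv comp_def)

lemma tangent_eq_push: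
  assumes "smooth_manifold M" "\<xi> \<in> tangent_space M y" "c \<in> charts_at M y"
  shows "\<xi> = push M (chart_inv c) (snd c y) (\<xi> c)"
proof (rule ext)
  fix d
  have y: "chart_inv c (snd c y) = y" by (rule chart_inv_chart[OF assms(1) charts_atD[OF assms(3)]])
  show "\<xi> d = push M (chart_inv c) (snd c y) (\<xi> c) d"
  proof (cases "d \<in> charts_at M y")
    case True
    then have "\<xi> d = frechet_derivative (snd d \<circ> chart_inv c) (at (snd c y)) (\<xi> c)"
      using assms(2,3) unfolding tangent_space_def by blast
    also have "\<dots> = push M (chart_inv c) (snd c y) (\<xi> c) d"
      using True y by (simp add: push_def comp_def)
    finally show ?thesis .
  next
    case False
    then have "\<xi> d = 0" using assms(2) unfolding tangent_space_def by blast
    also have "\<dots> = push M (chart_inv c) (snd c y) (\<xi> c) d"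
      using False y by (simp add: push_def)
    finally show ?thesis .
  qed
qed

lemma push_tangent:
  assumes M: "smooth_manifold M" and f: "param M S f" "x \<in> S"
  shows "push M f x w \<in> tangent_space M (f x)"
proof -
  have "push M f x w d = frechet_derivative (snd d \<circ> chart_inv c) (at (snd c (f x))) (push M f x w c)"
    if c: "c \<in> charts_at M (f x)" and d: "d \<in> charts_at M (f x)" for c d
    using fun_cong[OF push_chart[OF M f c], of w d] c d chart_inv_chart[OF M charts_atD[OF c]]
    by (simp add: push_def comp_def)
  moreover have "push M f x w d = 0" if "d \<notin> charts_at M (f x)" for d
    using that by (simp add: push_def)
  ultimately show ?thesis unfolding tangent_space_def by blast
qed

text \<open>The chart chosen inside \<open>tangent_map\<close> cancels by the chain rule. From here
  on tangent maps are computed on vectors of the form \<open>push\<close>, and the choice is not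
  unfolded again.\<close>

lemma tangent_map_push:
  assumes M: "smooth_manifold M" and N: "smooth_manifold N" and h: "smooth_map M N U h"
    and f: "param M S f" "x \<in> S" "f x \<in> U"
  shows "tangent_map M N h (f x) (push M f x w) = push N (\<lambda>z. h (f z)) x w"
proof -
  define c where "c = some_chart M (f x)"
  have c: "c \<in> charts_at M (f x)"
    unfolding c_def using param_carrier[OF f(1,2)] by (rule some_chart_in[OF M])
  note cA = charts_atD[OF c]
  let ?T = "S \<inter> f -` (fst c \<inter> U)"
  have T: "open ?T" "x \<in> ?T"
    using f cA param_open_vimage[OF f(1) openin_Int[OF chart_openin[OF M cA(1)] smooth_map_openin[OF h]]]
    by auto
  have "push N (\<lambda>z. h (f z)) x w = push N (\<lambda>z. h (chart_inv c (snd c (f z)))) x w"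
    using chart_inv_chart[OF M cA(1)] by (subst push_cong[OF T]) auto
  also have "\<dots> = push N (\<lambda>x. h (chart_inv c x)) (snd c (f x)) (frechet_derivative (\<lambda>z. snd c (f z)) (at x) w)"
    using param_has_derivative[OF f(1,2) c] differentiableI cA f(3)
    by (intro push_compose[OF smooth_map_chart_param[OF M N h cA(1)]]) blast+
  also have "\<dots> = tangent_map M N h (f x) (push M f x w)"
    unfolding tangent_map_def c_def[symmetric]
    using c chart_inv_chart[OF M cA] by (intro ext) (simp add: push_def comp_def)
  finally show ?thesis by simp
qed

lemma push_chart_inv_component:
  assumes M: "smooth_manifold M" and c: "c \<in> atlas M" and x: "x \<in> chart_image c"
  shows "push M (chart_inv c) x v c = v"
proof -
  have "frechet_derivative (\<lambda>z. snd c (chart_inv c z)) (at x) = frechet_derivative (\<lambda>z. z) (at x)"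
    using chart_chart_inv by (intro frechet_derivative_cong_open[OF chart_image_open[OF M c] x])
  moreover have "c \<in> charts_at M (chart_inv c x)" using c chart_inv_in[OF x] by (simp add: charts_at_def)
  ultimately show ?thesis by (simp add: push_def)
qed

text \<open>Turns statements about tangent vectors at y into statements about \<open>push\<close>,
  where linearity and the chain rule are at hand. The image stays inside \<open>U\<close> so that
  maps defined only on \<open>U\<close> can be applied.\<close>

lemma tangent_param:
  fixes M :: "('a, 'e::real_normed_vector) manifold"
  assumes M: "smooth_manifold M" and "openin (mtop M) U" "y \<in> U"
  obtains S and f :: "'e \<Rightarrow> 'a" and x where "param M S f" "x \<in> S" "f x = y" "f ` S \<subseteq> U"
    "tangent_space M y = range (push M f x)" "inj (push M f x)"
proof -
  have "y \<in> carrier M" using assms openin_subset unfolding carrier_def by blast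
  then obtain c where c: "c \<in> charts_at M y" using charts_at_obtain[OF M] by blast
  note cA = charts_atD[OF c]
  let ?S = "snd c ` (fst c \<inter> U)"
  have S: "param M ?S (chart_inv c)"
    using chart_image_Int_open[OF M cA(1) assms(2)]
    by (intro param_subset[OF param_chart_inv[OF M cA(1)]]) (auto simp: chart_image_def)
  have x: "snd c y \<in> ?S" using assms cA by blast
  show ?thesis
  proof
    show "param M ?S (chart_inv c)" "snd c y \<in> ?S" by fact+
    show y: "chart_inv c (snd c y) = y" using chart_inv_chart[OF M cA] .
    show "chart_inv c ` ?S \<subseteq> U" using chart_inv_chart[OF M cA(1)] by auto
    show "tangent_space M y = range (push M (chart_inv c) (snd c y))"
      using tangent_eq_push[OF M _ c] push_tangent[OF M S x] y by auto
    show "inj (push M (chart_inv c) (snd c y))"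
      using push_chart_inv_component[OF M cA(1) chart_in_image[OF cA(2)]] by (metis injI)
  qed
qed

lemma subspace_tangent_space:
  assumes "smooth_manifold M" "y \<in> carrier M" shows "subspace (tangent_space M y)"
proof -
  have "openin (mtop M) (carrier M)" unfolding carrier_def by simp
  from tangent_param[OF assms(1) this assms(2)]
  show ?thesis using push_linear linear_subspace_image subspace_UNIV by metis
qed

lemma tangent_map_linear:
  fixes M :: "('a, 'e::real_normed_vector) manifold"
  assumes M: "smooth_manifold M" and N: "smooth_manifold N" and h: "smooth_map M N U h" and "y \<in> U"
    and "\<xi> \<in> tangent_space M y" "\<eta> \<in> tangent_space M y"
  shows "tangent_map M N h y (a *\<^sub>R \<xi> + b *\<^sub>R \<eta>) = a *\<^sub>R tangent_map M N h y \<xi> + b *\<^sub>R tangent_map M N h y \<eta>"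
proof -
  obtain S and f :: "'e \<Rightarrow> 'a" and x where f: "param M S f" "x \<in> S" "f x = y" "f ` S \<subseteq> U" "tangent_space M y = range (push M f x)" "inj (push M f x)"
    using tangent_param[OF M smooth_map_openin[OF h] assms(4)] .
  obtain u v where uv: "\<xi> = push M f x u" "\<eta> = push M f x v" using assms f(5) by blast
  have P: "tangent_map M N h y (push M f x w) = push N (\<lambda>z. h (f z)) x w" for w
    using tangent_map_push[OF M N h f(1,2)] f assms(4) by auto
  have "a *\<^sub>R \<xi> + b *\<^sub>R \<eta> = push M f x (a *\<^sub>R u + b *\<^sub>R v)"
    using push_linear[OF f(1,2)] by (simp add: uv linear_add linear_scale)
  then show ?thesis
    using push_linear[OF param_smooth_map[OF M N f(1) h f(4)] f(2)]
    by (simp add: P uv linear_add linear_scale)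
qed

lemma tangent_map_tangent:
  fixes M :: "('a, 'e::real_normed_vector) manifold"
  assumes M: "smooth_manifold M" and N: "smooth_manifold N" and h: "smooth_map M N U h" and "y \<in> U"
    and "\<xi> \<in> tangent_space M y"
  shows "tangent_map M N h y \<xi> \<in> tangent_space N (h y)"
proof -
  obtain S and f :: "'e \<Rightarrow> 'a" and x where f: "param M S f" "x \<in> S" "f x = y" "f ` S \<subseteq> U" "tangent_space M y = range (push M f x)" "inj (push M f x)"
    using tangent_param[OF M smooth_map_openin[OF h] assms(4)] .
  obtain u where u: "\<xi> = push M f x u" using assms f(5) by blast
  show ?thesis
    using push_tangent[OF N param_smooth_map[OF M N f(1) h f(4)] f(2), of u]
      tangent_map_push[OF M N h f(1,2), of u] f u assms(4) by auto
qed

text \<open>The composite is a separate map \<open>a\<close>, because identities such as that of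
  \<alpha>' after \<pp> with \<alpha> hold only on the carrier and not as equations of
  functions.\<close>

lemma tangent_map_compose:
  fixes M :: "('a, 'e::real_normed_vector) manifold"
  assumes M: "smooth_manifold M" and N: "smooth_manifold N" and K: "smooth_manifold K"
    and h: "smooth_map M N U h" and g: "smooth_map N K V g" and a: "smooth_map M K U a"
    and eq: "\<And>z. z \<in> U \<Longrightarrow> h z \<in> V \<and> g (h z) = a z" and y: "y \<in> U" "\<xi> \<in> tangent_space M y"
  shows "tangent_map N K g (h y) (tangent_map M N h y \<xi>) = tangent_map M K a y \<xi>"
proof -
  obtain S and f :: "'e \<Rightarrow> 'a" and x where f: "param M S f" "x \<in> S" "f x = y" "f ` S \<subseteq> U" "tangent_space M y = range (push M f x)" "inj (push M f x)"
    using tangent_param[OF M smooth_map_openin[OF h] y(1)] .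
  obtain u where u: "\<xi> = push M f x u" using y f(5) by blast
  have hf: "param N S (\<lambda>z. h (f z))" by (rule param_smooth_map[OF M N f(1) h f(4)])
  have "tangent_map N K g (h y) (tangent_map M N h y \<xi>) = tangent_map N K g (h (f x)) (push N (\<lambda>z. h (f z)) x u)"
    using tangent_map_push[OF M N h f(1,2), of u] f y u by auto
  also have "\<dots> = push K (\<lambda>z. g (h (f z))) x u"
    using tangent_map_push[OF N K g hf f(2), of u] eq y f by auto
  also have "\<dots> = push K (\<lambda>z. a (f z)) x u"
  proof -
    have "push K (\<lambda>z. g (h (f z))) x = push K (\<lambda>z. a (f z)) x"
      using eq f(4) by (intro push_cong[OF param_open[OF f(1)] f(2)]) blast
    then show ?thesis by simp
  qed
  also have "\<dots> = tangent_map M K a y \<xi>"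
    using tangent_map_push[OF M K a f(1,2), of u] f y u by auto
  finally show ?thesis .
qed

text \<open>The pullback of an alternating form along \<open>R\<close>. That forms vanish on
  improper arguments is part of what has to be shown, hence the two cases in the description of
  \<open>g\<close>.\<close>

lemma alternating_form_map:
  assumes f: "alternating_form T k f"
    and R: "\<And>u. u \<in> T' \<Longrightarrow> R u \<in> T"
    and lin: "\<And>u v a b. u \<in> T' \<Longrightarrow> v \<in> T' \<Longrightarrow> R (a *\<^sub>R u + b *\<^sub>R v) = a *\<^sub>R R u + b *\<^sub>R R v"
    and g: "\<And>vs. set vs \<subseteq> T' \<Longrightarrow> g vs = f (map R vs)" "\<And>vs. \<not> set vs \<subseteq> T' \<Longrightarrow> g vs = 0"
    and T': "subspace T'"
  shows "alternating_form T' k g"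
  unfolding alternating_form_def
proof (intro conjI allI impI ballI)
  have sub: "set (map R vs) \<subseteq> T" if "set vs \<subseteq> T'" for vs using R that by auto
  fix vs
  show "g vs = 0" if "\<not> (length vs = k \<and> set vs \<subseteq> T')"
    using that g alternating_form_improper[OF f, of "map R vs"] by (cases "set vs \<subseteq> T'") auto
  fix i
  {
    fix u v a b assume vs: "length vs = k \<and> set vs \<subseteq> T' \<and> i < k" and uv: "u \<in> T'" "v \<in> T'"
    have au: "a *\<^sub>R u + b *\<^sub>R v \<in> T'" using T' uv by (simp add: subspace_add subspace_scale)
    have "set (vs[i := w]) \<subseteq> T'" if "w \<in> T'" for w
      using vs that set_update_subset_insert[of vs i w] by auto
    then have up: "g (vs[i := w]) = f ((map R vs)[i := R w])" if "w \<in> T'" for w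
      using g(1) that by (simp add: map_update)
    have *: "length (map R vs) = k \<and> set (map R vs) \<subseteq> T \<and> i < k" using vs sub by auto
    have "f ((map R vs)[i := a *\<^sub>R R u + b *\<^sub>R R v]) =
        a * f ((map R vs)[i := R u]) + b * f ((map R vs)[i := R v])"
      using f * R[OF uv(1)] R[OF uv(2)] unfolding alternating_form_def by blast
    then show "g (vs[i := a *\<^sub>R u + b *\<^sub>R v]) = a * g (vs[i := u]) + b * g (vs[i := v])"
      using up au uv lin by simp
  }
  fix j assume *: "length vs = k \<and> set vs \<subseteq> T' \<and> i < j \<and> j < k \<and> vs ! i = vs ! j"
  then have "length (map R vs) = k \<and> set (map R vs) \<subseteq> T \<and> i < j \<and> j < k \<and> map R vs ! i = map R vs ! j"
    using sub by auto
  then have "f (map R vs) = 0" using f unfolding alternating_form_def by blast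
  then show "g vs = 0" using g(1) * by simp
qed

section \<open>Pullback of forms along parametrizations\<close>

definition param_pullback ::
    "('a, 'e::real_normed_vector) manifold \<Rightarrow> ('x::real_normed_vector \<Rightarrow> 'a) \<Rightarrow> ('a, 'e) form \<Rightarrow> 'x \<Rightarrow> 'x list \<Rightarrow> real"
  where "param_pullback M f \<omega> x ws = \<omega> (f x) (map (push M f x) ws)"

lemma forms_alternating:
  "\<omega> \<in> forms M k \<Longrightarrow> y \<in> carrier M \<Longrightarrow> alternating_form (tangent_space M y) k (\<omega> y)"
  unfolding forms_def by blast

lemma param_pullback_alternating:
  assumes "smooth_manifold M" "\<omega> \<in> forms M k" "param M S f" "x \<in> S"
  shows "alternating_form UNIV k (param_pullback M f \<omega> x)"
  using push_tangent[OF assms(1,3,4)] push_linear[OF assms(3,4)]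
  by (intro alternating_form_map[OF forms_alternating[OF assms(2) param_carrier[OF assms(3,4)]], where R = "push M f x"])
    (auto simp: param_pullback_def linear_add linear_scale)

lemma form_on_chart:
  assumes M: "smooth_manifold M" and \<omega>: "\<omega> \<in> forms M k" and c: "c \<in> atlas M"
  shows "form_on (chart_image c) k (param_pullback M (chart_inv c) \<omega>)"
  unfolding form_on_def
proof (intro conjI ballI allI impI)
  note P = param_chart_inv[OF M c]
  show op: "open (chart_image c)" by (rule chart_image_open[OF M c])
  show "alternating_form UNIV k (param_pullback M (chart_inv c) \<omega> x)" if "x \<in> chart_image c" for x
    by (rule param_pullback_alternating[OF M \<omega> P that])
  fix ws :: "'b list" assume "length ws = k"
  then have "smooth_on (chart_image c)
         (\<lambda>x. \<omega> (chart_inv c x) (map (coord_tvec M c (chart_inv c x)) ws))"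
    using \<omega> c unfolding forms_def by blast
  then show "smooth_on (chart_image c) (\<lambda>x. param_pullback M (chart_inv c) \<omega> x ws)"
    by (rule smooth_on_cong[OF op, rotated]) (simp add: param_pullback_def coord_tvec_eq_push)
qed

lemma param_pullback_chart:
  assumes M: "smooth_manifold M" and f: "param M S f" "x \<in> S" and c: "c \<in> charts_at M (f x)"
  shows "param_pullback M f \<omega> x ws = param_pullback M (chart_inv c) \<omega> (snd c (f x))
    (map (frechet_derivative (\<lambda>z. snd c (f z)) (at x)) ws)"
proof -
  have "push M f x = push M (chart_inv c) (snd c (f x)) \<circ> frechet_derivative (\<lambda>z. snd c (f z)) (at x)"
    by (rule ext) (simp add: push_chart[OF M f c])
  then show ?thesis
    unfolding param_pullback_def by (simp add: chart_inv_chart[OF M charts_atD[OF c]])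
qed

text \<open>Forms are smooth by definition in charts with constant arguments. In terms of a chart,
  the arguments here are derivatives of the coordinate expression of \<open>f\<close>, which vary
  with the point, so \<open>form_on_smooth_args\<close> is needed.\<close>

lemma form_on_param:
  assumes M: "smooth_manifold M" and \<omega>: "\<omega> \<in> forms M k" and f: "param M S f"
  shows "form_on S k (param_pullback M f \<omega>)"
  unfolding form_on_def
proof (intro conjI ballI allI impI)
  show "open S" by (rule param_open[OF f])
  show "alternating_form UNIV k (param_pullback M f \<omega> x)" if "x \<in> S" for x
    by (rule param_pullback_alternating[OF M \<omega> f that])
  fix ws :: "'c list" assume ws: "length ws = k"
  show "smooth_on S (\<lambda>x. param_pullback M f \<omega> x ws)"
  proof (rule smooth_on_local)
    fix x assume x: "x \<in> S"
    obtain c where c: "c \<in> charts_at M (f x)" using charts_at_obtain[OF M param_carrier[OF f x]] .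
    note cA = charts_atD[OF c]
    let ?T = "S \<inter> f -` fst c"
    have T: "open ?T" by (rule param_chart_vimage_open[OF M f cA(1)])
    let ?\<phi> = "\<lambda>z. snd c (f z)"
    have \<phi>: "smooth_on ?T ?\<phi>" by (rule param_smooth[OF f cA(1)])
    let ?Vs = "map (\<lambda>w z. frechet_derivative ?\<phi> (at z) w) ws"
    have "\<forall>V\<in>set ?Vs. smooth_on ?T V" using smooth_on_frechet_derivative[OF \<phi>] by auto
    moreover have "?\<phi> ` ?T \<subseteq> chart_image c" by (auto simp: chart_image_def)
    ultimately have "smooth_on ?T (\<lambda>z. param_pullback M (chart_inv c) \<omega> (?\<phi> z) ([] @ map (\<lambda>V. V z) ?Vs))"
      using ws
      by (intro form_on_smooth_args[OF smooth_manifold_finite_dim[OF M] form_on_chart[OF M \<omega> cA(1)] T \<phi>]) auto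
    then have "smooth_on ?T (\<lambda>x. param_pullback M f \<omega> x ws)"
    proof (rule smooth_on_cong[OF T, rotated])
      fix z assume "z \<in> ?T"
      then have "z \<in> S" "c \<in> charts_at M (f z)" using cA by (auto simp: charts_at_def)
      from param_pullback_chart[OF M f this]
      show "param_pullback M (chart_inv c) \<omega> (?\<phi> z) ([] @ map (\<lambda>V. V z) ?Vs) = param_pullback M f \<omega> z ws"
        by (simp add: comp_def)
    qed
    then show "\<exists>T. open T \<and> x \<in> T \<and> smooth_on T (\<lambda>x. param_pullback M f \<omega> x ws)"
      using T x cA by blast
  qed
qed

lemma local_ext_deriv_cong:
  assumes "open S" "x \<in> S" "\<And>y. y \<in> S \<Longrightarrow> G y = H y"
  shows "local_ext_deriv G x ws = local_ext_deriv H x ws"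
proof -
  have "frechet_derivative (\<lambda>y. G y us) (at x) = frechet_derivative (\<lambda>y. H y us) (at x)" for us
    using assms(3) by (intro frechet_derivative_cong_open[OF assms(1,2)]) simp
  then show ?thesis unfolding local_ext_deriv_def by simp
qed

text \<open>At \<open>f x\<close> the vanishing of \<open>ext_deriv\<close> is information in the
  single chart \<open>some_chart\<close>. The same chart is used to factor \<open>f\<close>, and
  naturality transports the vanishing to the coordinates of \<open>f\<close>; chart independence of
  d is a result of this, not a prerequisite.\<close>

lemma param_pullback_closed:
  assumes M: "smooth_manifold M" and \<omega>: "\<omega> \<in> forms M k" "ext_deriv M \<omega> = 0"
    and f: "param M S f" "x \<in> S" and ws: "length ws = Suc k"
  shows "local_ext_deriv (param_pullback M f \<omega>) x ws = 0"
proof -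
  define c where "c = some_chart M (f x)"
  have y: "f x \<in> carrier M" by (rule param_carrier[OF f])
  have c: "c \<in> charts_at M (f x)" unfolding c_def by (rule some_chart_in[OF M y])
  note cA = charts_atD[OF c]
  note inv = param_chart_inv[OF M cA(1)]
  let ?T = "S \<inter> f -` fst c"
  have T: "open ?T" "x \<in> ?T" using param_chart_vimage_open[OF M f(1) cA(1)] f cA by auto
  let ?\<phi> = "\<lambda>z. snd c (f z)"
  have \<phi>: "smooth_on ?T ?\<phi>" by (rule param_smooth[OF f(1) cA(1)])
  have img: "?\<phi> ` ?T \<subseteq> chart_image c" by (auto simp: chart_image_def)
  let ?G = "param_pullback M (chart_inv c) \<omega>"
  let ?vs = "map (frechet_derivative ?\<phi> (at x)) ws"
  have "local_ext_deriv (param_pullback M f \<omega>) x ws =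
    local_ext_deriv (\<lambda>x us. ?G (?\<phi> x) (map (frechet_derivative ?\<phi> (at x)) us)) x ws"
    using param_pullback_chart[OF M f(1)] cA
    by (intro local_ext_deriv_cong[OF T]) (auto simp: charts_at_def fun_eq_iff)
  also have "\<dots> = local_ext_deriv ?G (?\<phi> x) ?vs"
    by (rule local_ext_deriv_pullback[OF smooth_manifold_finite_dim[OF M] form_on_chart[OF M \<omega>(1) cA(1)] T img \<phi> ws])
  also have "\<dots> = 0"
  proof -
    let ?x = "snd c (f x)"
    let ?\<xi> = "map (push M (chart_inv c) ?x) ?vs"
    have x: "?x \<in> chart_image c" using img T by blast
    have inv_x: "chart_inv c ?x = f x" by (rule chart_inv_chart[OF M cA])
    note comp = push_chart_inv_component[OF M cA(1) x]
    have sub: "set ?\<xi> \<subseteq> tangent_space M (f x)"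
      using push_tangent[OF M inv x] inv_x by auto
    have "0 = ext_deriv M \<omega> (f x) ?\<xi>" using \<omega>(2) by simp
    also have "\<dots> = (\<Sum>i<length ?vs. (-1) ^ i *
           frechet_derivative (\<lambda>x. \<omega> (chart_inv c x)
                (map (coord_tvec M c (chart_inv c x)) (take i ?vs @ drop (Suc i) ?vs)))
             (at ?x) (?vs ! i))"
    proof -
      have m: "map (\<lambda>\<xi>. \<xi> c) ?\<xi> = ?vs" by (simp add: comp_def comp)
      have "ext_deriv M \<omega> (f x) \<xi>s = (let ws = map (\<lambda>\<xi>. \<xi> c) \<xi>s in \<Sum>i<length ws. (-1) ^ i *
           frechet_derivative (\<lambda>x. \<omega> (chart_inv c x)
                (map (coord_tvec M c (chart_inv c x)) (take i ws @ drop (Suc i) ws)))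
             (at ?x) (ws ! i))" if "set \<xi>s \<subseteq> tangent_space M (f x)" for \<xi>s
        using y that by (simp add: ext_deriv_def c_def Let_def)
      from this[OF sub] show ?thesis unfolding m Let_def .
    qed
    also have "\<dots> = local_ext_deriv ?G ?x ?vs"
      unfolding local_ext_deriv_def
    proof (intro sum.cong refl)
      fix i
      have "frechet_derivative (\<lambda>x. \<omega> (chart_inv c x)
                (map (coord_tvec M c (chart_inv c x)) (take i ?vs @ drop (Suc i) ?vs))) (at ?x) =
        frechet_derivative (\<lambda>x. ?G x (take i ?vs @ drop (Suc i) ?vs)) (at ?x)"
        by (intro frechet_derivative_cong_open[OF chart_image_open[OF M cA(1)] x])
          (simp add: param_pullback_def coord_tvec_eq_push)
      then show "(-1) ^ i * frechet_derivative (\<lambda>x. \<omega> (chart_inv c x)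
                (map (coord_tvec M c (chart_inv c x)) (take i ?vs @ drop (Suc i) ?vs))) (at ?x) (?vs ! i) =
         (-1) ^ i * frechet_derivative (\<lambda>x. ?G x (take i ?vs @ drop (Suc i) ?vs)) (at ?x) (?vs ! i)" by simp
    qed
    finally show ?thesis by simp
  qed
  finally show ?thesis .
qed

section \<open>Local trivializations\<close>

text \<open>A bundle chart written from coordinates to points. The base coordinate is that of a
  chart \<open>c\<close> of \<open>M\<close>, so \<alpha> becomes the first projection and vertical
  vectors have first component 0. Smoothness of the inverse \<psi> is stated in charts of
  \<open>P\<close>, since its values lie in a vector space.\<close>

definition local_triv ::
    "('p, 'e::real_normed_vector) manifold \<Rightarrow> ('m, 'b::real_normed_vector) manifold \<Rightarrow> ('p \<Rightarrow> 'm) \<Rightarrow>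
     ('m, 'b) chart \<Rightarrow> 'b set \<Rightarrow> 'g::real_normed_vector set \<Rightarrow> ('b \<times> 'g \<Rightarrow> 'p) \<Rightarrow> ('p \<Rightarrow> 'b \<times> 'g) \<Rightarrow> bool"
  where "local_triv P M \<alpha> c A B \<Phi> \<psi> \<longleftrightarrow>
    c \<in> atlas M \<and> open A \<and> open B \<and> A \<subseteq> chart_image c \<and> param P (A \<times> B) \<Phi> \<and>
    openin (mtop P) (\<Phi> ` (A \<times> B)) \<and>
    (\<forall>t\<in>A \<times> B. \<psi> (\<Phi> t) = t \<and> \<alpha> (\<Phi> t) = chart_inv c (fst t)) \<and>
    (\<forall>d\<in>atlas P. smooth_on (snd d ` (fst d \<inter> \<Phi> ` (A \<times> B))) (\<lambda>x. \<psi> (chart_inv d x)))"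

lemma fiber_bundle_manifolds:
  assumes "fiber_bundle P M F \<alpha>"
  shows "smooth_manifold P" "smooth_manifold M" "smooth_manifold F"
    and "smooth_map P M (carrier P) \<alpha>" "\<alpha> ` carrier P = carrier M"
  using assms unfolding fiber_bundle_def by blast+

lemma fiber_bundle_local_triv:
  fixes P :: "('p, 'e::real_normed_vector) manifold" and M :: "('m, 'b::real_normed_vector) manifold"
    and F :: "('f, 'g::real_normed_vector) manifold"
  assumes fb: "fiber_bundle P M F \<alpha>" and y: "y \<in> carrier P"
  obtains c A and B :: "'g set" and \<Phi> \<psi> t where "local_triv P M \<alpha> c A B \<Phi> \<psi>" "t \<in> A \<times> B" "\<Phi> t = y"
proof -
  note PM = fiber_bundle_manifolds[OF fb]
  have "\<alpha> y \<in> carrier M" using PM(5) y by blast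
  then obtain U \<Psi> where U: "openin (mtop M) U" "\<alpha> y \<in> U"
    "bij_betw \<Psi> (carrier P \<inter> \<alpha> -` U) (U \<times> carrier F)"
    "\<forall>y\<in>carrier P \<inter> \<alpha> -` U. fst (\<Psi> y) = \<alpha> y"
    "smooth_map P (prod_manifold M F) (carrier P \<inter> \<alpha> -` U) \<Psi>"
    "smooth_map (prod_manifold M F) P (U \<times> carrier F) (inv_into (carrier P \<inter> \<alpha> -` U) \<Psi>)"
    using fb unfolding fiber_bundle_def by blast
  define E where "E = carrier P \<inter> \<alpha> -` U"
  define inv where "inv = inv_into E \<Psi>"
  note U = U[folded E_def, folded inv_def]
  have yE: "y \<in> E" using y U(2) by (simp add: E_def)
  have UM: "U \<subseteq> carrier M" using openin_subset[OF U(1)] by (simp add: carrier_def)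
  have \<Psi>E: "\<Psi> z \<in> U \<times> carrier F" if "z \<in> E" for z using U(3) that by (auto simp: bij_betw_def)
  have inv\<Psi>: "inv (\<Psi> z) = z" if "z \<in> E" for z
    unfolding inv_def using U(3) that by (simp add: bij_betw_def)
  have \<Psi>inv: "\<Psi> (inv q) = q" "inv q \<in> E" if "q \<in> U \<times> carrier F" for q
    unfolding inv_def using U(3) that by (auto simp: bij_betw_def f_inv_into_f inv_into_into)
  obtain c where c: "c \<in> charts_at M (\<alpha> y)" using charts_at_obtain[OF PM(2)] UM U(2) by blast
  have "snd (\<Psi> y) \<in> carrier F" using \<Psi>E[OF yE] by auto
  then obtain g where g: "g \<in> charts_at F (snd (\<Psi> y))" using charts_at_obtain[OF PM(3)] by blast
  note cA = charts_atD[OF c] and gA = charts_atD[OF g]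
  define A where "A = snd c ` (fst c \<inter> U)"
  define B where "B = chart_image g"
  define q where "q t = (chart_inv c (fst t), chart_inv g (snd t))" for t
  define \<Phi> where "\<Phi> t = inv (q t)" for t
  define \<psi> where "\<psi> z = (snd c (fst (\<Psi> z)), snd g (snd (\<Psi> z)))" for z
  \<comment> \<open>Smoothness of \<Psi> and of its inverse is given in the atlas of the product
    manifold, so the charts of base and fibre are joined into one of its charts.\<close>
  define pc where "pc = (fst c \<times> fst g, map_prod (snd c) (snd g))"
  have pc: "pc \<in> atlas (prod_manifold M F)"
    unfolding pc_def prod_manifold_def using cA gA by auto
  have A: "open A" "A \<subseteq> chart_image c" and B: "open B"
    unfolding A_def B_def using chart_image_Int_open[OF PM(2) cA(1) U(1)] chart_image_open[OF PM(3) gA(1)]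
    by (auto simp: chart_image_def)
  have A': "chart_inv c a \<in> fst c" "chart_inv c a \<in> U" "snd c (chart_inv c a) = a" if "a \<in> A" for a
    using that A(2) chart_inv_chart[OF PM(2) cA(1)] by (auto simp: A_def)
  have B': "chart_inv g b \<in> fst g" "chart_inv g b \<in> carrier F" "snd g (chart_inv g b) = b" if "b \<in> B" for b
    using that chart_inv_in[of b g] chart_chart_inv[of b g] chart_subset_carrier[OF PM(3) gA(1)]
    by (auto simp: B_def)
  have q: "q t \<in> U \<times> carrier F" "q t \<in> fst pc" if "t \<in> A \<times> B" for t
    using that A' B' by (auto simp: q_def pc_def)
  have \<Phi>E: "\<Phi> t \<in> E" and \<Psi>\<Phi>: "\<Psi> (\<Phi> t) = q t" if "t \<in> A \<times> B" for t
    unfolding \<Phi>_def using \<Psi>inv[OF q(1)[OF that]] by simp_all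
  have \<psi>\<Phi>: "\<psi> (\<Phi> t) = t" if "t \<in> A \<times> B" for t
    using \<Psi>\<Phi>[OF that] that A' B' by (auto simp: \<psi>_def q_def)
  have \<alpha>\<Phi>: "\<alpha> (\<Phi> t) = chart_inv c (fst t)" if "t \<in> A \<times> B" for t
    using U(4) \<Phi>E[OF that] \<Psi>\<Phi>[OF that] by (metis q_def fst_conv)
  \<comment> \<open>Described as a preimage under \<Psi>, the image is open by continuity.\<close>
  have img: "\<Phi> ` (A \<times> B) = {z \<in> E. \<Psi> z \<in> (fst c \<inter> U) \<times> fst g}"
  proof (intro equalityI subsetI)
    fix z assume "z \<in> \<Phi> ` (A \<times> B)"
    then show "z \<in> {z \<in> E. \<Psi> z \<in> (fst c \<inter> U) \<times> fst g}"
      using \<Phi>E \<Psi>\<Phi> A' B' by (auto simp: q_def)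
  next
    fix z assume z: "z \<in> {z \<in> E. \<Psi> z \<in> (fst c \<inter> U) \<times> fst g}"
    then have "\<psi> z \<in> A \<times> B" by (auto simp: \<psi>_def A_def B_def chart_image_def)
    moreover have "q (\<psi> z) = \<Psi> z"
      using z chart_inv_chart[OF PM(2) cA(1)] chart_inv_chart[OF PM(3) gA(1)]
      by (auto simp: q_def \<psi>_def mem_Times_iff)
    then have "\<Phi> (\<psi> z) = z" unfolding \<Phi>_def using inv\<Psi> z by simp
    ultimately show "z \<in> \<Phi> ` (A \<times> B)" by (metis image_eqI)
  qed
  have openE: "openin (mtop P) E" by (rule smooth_map_openin[OF U(5)])
  have img_open: "openin (mtop P) (\<Phi> ` (A \<times> B))"
  proof -
    have "openin (prod_topology (mtop M) (mtop F)) ((fst c \<inter> U) \<times> fst g)"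
      using openin_Int[OF chart_openin[OF PM(2) cA(1)] U(1)] chart_openin[OF PM(3) gA(1)]
      by (simp add: openin_prod_Times_iff)
    moreover have "continuous_map (subtopology (mtop P) E) (prod_topology (mtop M) (mtop F)) \<Psi>"
      using U(5) unfolding smooth_map_def prod_manifold_def by simp
    ultimately have "openin (subtopology (mtop P) E)
        {z \<in> topspace (subtopology (mtop P) E). \<Psi> z \<in> (fst c \<inter> U) \<times> fst g}"
      unfolding continuous_map_def by blast
    moreover have "topspace (subtopology (mtop P) E) = E" using openin_subset[OF openE] by auto
    ultimately have "openin (subtopology (mtop P) E) {z \<in> E. \<Psi> z \<in> (fst c \<inter> U) \<times> fst g}" by (simp only:)
    then show ?thesis unfolding img using openin_open_subtopology[OF openE] by blast
  qed
  have cont: "continuous_map (top_of_set (A \<times> B)) (mtop P) \<Phi>"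
  proof -
    have proj: "continuous_map (top_of_set (A \<times> B)) (top_of_set A) fst"
      "continuous_map (top_of_set (A \<times> B)) (top_of_set B) snd"
      by (auto intro: continuous_on_fst continuous_on_snd continuous_on_id)
    have inv: "continuous_map (top_of_set A) (mtop M) (chart_inv c)"
      "continuous_map (top_of_set B) (mtop F) (chart_inv g)"
      using param_subset[OF param_chart_inv[OF PM(2) cA(1)] A] param_chart_inv[OF PM(3) gA(1)]
      by (simp_all add: param_def B_def)
    have "continuous_map (top_of_set (A \<times> B)) (mtop M) (chart_inv c \<circ> fst)"
      "continuous_map (top_of_set (A \<times> B)) (mtop F) (chart_inv g \<circ> snd)"
      by (rule continuous_map_compose[OF proj(1) inv(1)], rule continuous_map_compose[OF proj(2) inv(2)])
    then have "continuous_map (top_of_set (A \<times> B)) (prod_topology (mtop M) (mtop F)) q"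
      unfolding q_def by (simp add: continuous_map_pairwise comp_def)
    then have "continuous_map (top_of_set (A \<times> B)) (subtopology (prod_topology (mtop M) (mtop F)) (U \<times> carrier F)) q"
      using q(1) by (auto simp: continuous_map_in_subtopology)
    moreover have "continuous_map (subtopology (prod_topology (mtop M) (mtop F)) (U \<times> carrier F)) (mtop P) inv"
      using U(6) unfolding smooth_map_def prod_manifold_def by simp
    ultimately have "continuous_map (top_of_set (A \<times> B)) (mtop P) (inv \<circ> q)"
      by (rule continuous_map_compose)
    then show ?thesis unfolding comp_def \<Phi>_def .
  qed
  have "param P (A \<times> B) \<Phi>"
    unfolding param_def
  proof (intro conjI ballI cont open_Times A B)
    fix d assume d: "d \<in> atlas P"
    have "openin (top_of_set (A \<times> B)) {t \<in> topspace (top_of_set (A \<times> B)). \<Phi> t \<in> fst d}"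
      using cont chart_openin[OF PM(1) d] unfolding continuous_map_def by blast
    moreover have "{t \<in> topspace (top_of_set (A \<times> B)). \<Phi> t \<in> fst d} = A \<times> B \<inter> \<Phi> -` fst d" by auto
    ultimately have op: "open (A \<times> B \<inter> \<Phi> -` fst d)"
      using openin_open_trans open_Times[OF A(1) B] by metis
    have inj: "inj_on (map_prod (snd c) (snd g)) (fst c \<times> fst g)"
      using chart_inj[OF PM(2) cA(1)] chart_inj[OF PM(3) gA(1)] by (rule map_prod_inj_on)
    have snd_q: "snd pc (q t) = t" if "t \<in> A \<times> B" for t
      using that A' B' by (auto simp: pc_def q_def)
    have inv_pc: "chart_inv pc t = q t" if "t \<in> A \<times> B" for t
      unfolding chart_inv_def
      using inj by (intro inv_into_f_eq q(2)[OF that] snd_q[OF that]) (simp add: pc_def)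
    have "A \<times> B \<inter> \<Phi> -` fst d \<subseteq> snd pc ` (fst pc \<inter> (U \<times> carrier F) \<inter> inv -` fst d)"
    proof
      fix t assume t: "t \<in> A \<times> B \<inter> \<Phi> -` fst d"
      then show "t \<in> snd pc ` (fst pc \<inter> (U \<times> carrier F) \<inter> inv -` fst d)"
        using q snd_q by (intro image_eqI[of _ _ "q t"]) (auto simp: \<Phi>_def)
    qed
    moreover have "smooth_on (snd pc ` (fst pc \<inter> (U \<times> carrier F) \<inter> inv -` fst d)) (snd d \<circ> inv \<circ> chart_inv pc)"
      using U(6) pc d unfolding smooth_map_def by blast
    ultimately have "smooth_on (A \<times> B \<inter> \<Phi> -` fst d) (snd d \<circ> inv \<circ> chart_inv pc)"
      by (rule smooth_on_subset[rotated])
    then show "smooth_on (A \<times> B \<inter> \<Phi> -` fst d) (\<lambda>t. snd d (\<Phi> t))"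
      by (rule smooth_on_cong[OF op, rotated]) (use inv_pc in \<open>simp add: \<Phi>_def\<close>)
  qed
  moreover have "smooth_on (snd d ` (fst d \<inter> \<Phi> ` (A \<times> B))) (\<lambda>x. \<psi> (chart_inv d x))" if d: "d \<in> atlas P" for d
  proof -
    have "smooth_on (snd d ` (fst d \<inter> E \<inter> \<Psi> -` fst pc)) (snd pc \<circ> \<Psi> \<circ> chart_inv d)"
      using U(5) pc d unfolding smooth_map_def by blast
    moreover have "snd pc \<circ> \<Psi> \<circ> chart_inv d = (\<lambda>x. \<psi> (chart_inv d x))"
      by (simp add: fun_eq_iff \<psi>_def pc_def map_prod_def case_prod_unfold)
    moreover have "snd d ` (fst d \<inter> \<Phi> ` (A \<times> B)) \<subseteq> snd d ` (fst d \<inter> E \<inter> \<Psi> -` fst pc)"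
      unfolding img pc_def by auto
    ultimately show ?thesis using smooth_on_subset by fastforce
  qed
  ultimately have "local_triv P M \<alpha> c A B \<Phi> \<psi>"
    unfolding local_triv_def using cA A B img_open \<psi>\<Phi> \<alpha>\<Phi> by blast
  moreover have "y \<in> \<Phi> ` (A \<times> B)"
    unfolding img using yE U(2,4) cA gA by (auto simp: mem_Times_iff)
  ultimately show ?thesis using that by blast
qed

text \<open>Formulated for any bundle, because it serves \<alpha> and \<alpha>' as well as \<pp>,
  whose base has the leaves as points.\<close>

locale bundle_triv =
  fixes P :: "('p, 'e::real_normed_vector) manifold" and M :: "('m, 'b::real_normed_vector) manifold"
    and F :: "('f, 'g::real_normed_vector) manifold" and \<alpha> :: "'p \<Rightarrow> 'm"
    and c :: "('m, 'b) chart" and A :: "'b set" and B :: "'g set"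
    and \<Phi> :: "'b \<times> 'g \<Rightarrow> 'p" and \<psi> :: "'p \<Rightarrow> 'b \<times> 'g"
  assumes fb: "fiber_bundle P M F \<alpha>" and triv: "local_triv P M \<alpha> c A B \<Phi> \<psi>"
begin

lemmas P = fiber_bundle_manifolds(1)[OF fb] and M = fiber_bundle_manifolds(2)[OF fb]
  and F = fiber_bundle_manifolds(3)[OF fb] and \<alpha>_smooth = fiber_bundle_manifolds(4)[OF fb]

lemma c: "c \<in> atlas M" and A: "open A" "A \<subseteq> chart_image c" and B: "open B"
  and \<Phi>: "param P (A \<times> B) \<Phi>" and image_open: "openin (mtop P) (\<Phi> ` (A \<times> B))"
  and \<psi>_\<Phi>: "\<And>t. t \<in> A \<times> B \<Longrightarrow> \<psi> (\<Phi> t) = t"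
  and \<alpha>_\<Phi>: "\<And>t. t \<in> A \<times> B \<Longrightarrow> \<alpha> (\<Phi> t) = chart_inv c (fst t)"
  and \<psi>_smooth: "\<And>d. d \<in> atlas P \<Longrightarrow> smooth_on (snd d ` (fst d \<inter> \<Phi> ` (A \<times> B))) (\<lambda>x. \<psi> (chart_inv d x))"
  using triv unfolding local_triv_def by blast+

lemma total_finite_dim: "finite_dim TYPE('b \<times> 'g)"
  by (intro finite_dim_prod smooth_manifold_finite_dim[OF M] smooth_manifold_finite_dim[OF F])

text \<open>Near \<open>\<Phi> t\<close> the chart inverse factors as \<Phi> after \<psi> in that
  chart, so a push along it is a push along \<Phi>.\<close>

lemma push_surj:
  assumes t: "t \<in> A \<times> B" shows "range (push P \<Phi> t) = tangent_space P (\<Phi> t)"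
proof (intro equalityI subsetI)
  fix \<xi> assume "\<xi> \<in> range (push P \<Phi> t)"
  then show "\<xi> \<in> tangent_space P (\<Phi> t)" using push_tangent[OF P \<Phi> t] by blast
next
  fix \<xi> assume \<xi>: "\<xi> \<in> tangent_space P (\<Phi> t)"
  obtain d where d: "d \<in> charts_at P (\<Phi> t)" using charts_at_obtain[OF P param_carrier[OF \<Phi> t]] .
  note dA = charts_atD[OF d]
  let ?D = "snd d ` (fst d \<inter> \<Phi> ` (A \<times> B))" and ?x = "snd d (\<Phi> t)" and ?\<chi> = "\<lambda>x. \<psi> (chart_inv d x)"
  have D: "open ?D" "?x \<in> ?D" using chart_image_Int_open[OF P dA(1) image_open] dA t by blast+
  have x: "?\<chi> ?x = t" using chart_inv_chart[OF P dA] \<psi>_\<Phi>[OF t] by simp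
  have "\<xi> = push P (chart_inv d) ?x (\<xi> d)" by (rule tangent_eq_push[OF P \<xi> d])
  also have "push P (chart_inv d) ?x = push P (\<lambda>x. \<Phi> (?\<chi> x)) ?x"
    using chart_inv_chart[OF P dA(1)] \<psi>_\<Phi> by (intro push_cong[OF D]) auto
  also have "\<dots> (\<xi> d) = push P \<Phi> (?\<chi> ?x) (frechet_derivative ?\<chi> (at ?x) (\<xi> d))"
    using smooth_on_differentiable[OF \<psi>_smooth[OF dA(1)] D(2)] x t by (intro push_compose[OF \<Phi>]) simp_all
  finally show "\<xi> \<in> range (push P \<Phi> t)" unfolding x by blast
qed

text \<open>In a chart, \<psi> is a left inverse of \<Phi>; differentiating this identity gives a
  left inverse of the derivative.\<close>

lemma push_inj:
  assumes t: "t \<in> A \<times> B" shows "inj (push P \<Phi> t)"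
proof -
  obtain d where d: "d \<in> charts_at P (\<Phi> t)" using charts_at_obtain[OF P param_carrier[OF \<Phi> t]] .
  note dA = charts_atD[OF d]
  let ?D = "snd d ` (fst d \<inter> \<Phi> ` (A \<times> B))" and ?x = "snd d (\<Phi> t)" and ?\<chi> = "\<lambda>x. \<psi> (chart_inv d x)"
  let ?h = "\<lambda>z. snd d (\<Phi> z)"
  let ?T = "A \<times> B \<inter> \<Phi> -` fst d"
  have T: "open ?T" "t \<in> ?T" using param_chart_vimage_open[OF P \<Phi> dA(1)] dA t by auto
  have x: "?x \<in> ?D" using dA t by blast
  note D\<chi> = smooth_on_has_derivative[OF \<psi>_smooth[OF dA(1)] x]
  have "((\<lambda>z. ?\<chi> (?h z)) has_derivative
      (\<lambda>w. frechet_derivative ?\<chi> (at ?x) (frechet_derivative ?h (at t) w))) (at t)"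
    by (rule has_derivative_compose[of ?h _ t UNIV ?\<chi>, OF param_has_derivative[OF \<Phi> t d] D\<chi>])
  then have "((\<lambda>z. z) has_derivative
      (\<lambda>w. frechet_derivative ?\<chi> (at ?x) (frechet_derivative ?h (at t) w))) (at t)"
    by (rule has_derivative_transform_within_open[OF _ T])
      (use chart_inv_chart[OF P dA(1)] \<psi>_\<Phi> in auto)
  from has_derivative_unique[OF this has_derivative_ident]
  have w: "frechet_derivative ?\<chi> (at ?x) (frechet_derivative ?h (at t) w) = w" for w by (metis)
  have "w = frechet_derivative ?\<chi> (at ?x) (push P \<Phi> t w d)" for w
    using d w by (simp add: push_def)
  then show ?thesis by (metis injI)
qed

lemma tangent_map_push_triv:
  assumes t: "t \<in> A \<times> B"
  shows "tangent_map P M \<alpha> (\<Phi> t) (push P \<Phi> t w) = push M (chart_inv c) (fst t) (fst w)"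
proof -
  have "tangent_map P M \<alpha> (\<Phi> t) (push P \<Phi> t w) = push M (\<lambda>z. \<alpha> (\<Phi> z)) t w"
    by (rule tangent_map_push[OF P M \<alpha>_smooth \<Phi> t param_carrier[OF \<Phi> t]])
  also have "push M (\<lambda>z. \<alpha> (\<Phi> z)) t = push M (\<lambda>z. chart_inv c (fst z)) t"
    by (rule push_cong[OF open_Times[OF A(1) B] t \<alpha>_\<Phi>])
  also have "\<dots> w = push M (chart_inv c) (fst t) (frechet_derivative fst (at t) w)"
    using t A(2) by (intro push_compose[OF param_chart_inv[OF M c]])
      (auto intro: bounded_linear_imp_differentiable bounded_linear_fst)
  also have "frechet_derivative fst (at t) w = fst w"
    using fun_cong[OF frechet_derivative_at[OF bounded_linear_imp_has_derivative[OF bounded_linear_fst]]]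
    by metis
  finally show ?thesis .
qed

lemma push_vertical_iff:
  assumes t: "t \<in> A \<times> B"
  shows "push P \<Phi> t w \<in> vertical_space P M \<alpha> (\<Phi> t) \<longleftrightarrow> fst w = 0"
proof -
  have x: "fst t \<in> chart_image c" using t A by auto
  have "push M (chart_inv c) (fst t) (fst w) = 0 \<longleftrightarrow> fst w = 0"
    using push_chart_inv_component[OF M c x, of "fst w"] linear_0[OF push_linear[OF param_chart_inv[OF M c] x]]
    by (metis zero_fun_apply)
  then show ?thesis
    unfolding vertical_space_def using push_tangent[OF P \<Phi> t] tangent_map_push_triv[OF t] by simp
qed

lemma vertical_space_eq:
  assumes t: "t \<in> A \<times> B"
  shows "vertical_space P M \<alpha> (\<Phi> t) = range (\<lambda>u. push P \<Phi> t (0, u))"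
proof (intro equalityI subsetI)
  fix \<xi> assume \<xi>: "\<xi> \<in> vertical_space P M \<alpha> (\<Phi> t)"
  then obtain w where "\<xi> = push P \<Phi> t w" using push_surj[OF t] unfolding vertical_space_def by blast
  then show "\<xi> \<in> range (\<lambda>u. push P \<Phi> t (0, u))" using push_vertical_iff[OF t] \<xi> by (metis prod.collapse rangeI)
qed (use push_vertical_iff[OF t] in auto)

text \<open>A bump function with compact support lets a local field be continued by 0. By the last
  conclusion the result is everywhere 0 or a multiple of the local field, so it stays in every
  linear distribution that contains the latter.\<close>

lemma global_vertical_field:
  assumes T: "open T" "T \<subseteq> A \<times> B" "t0 \<in> T" and u: "smooth_on T u"
  obtains Y where "Y \<in> vertical_fields P M \<alpha>" "Y (\<Phi> t0) = push P \<Phi> t0 (0, u t0)"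
    "\<And>z. z \<in> carrier P \<Longrightarrow> Y z = 0 \<or> (\<exists>t\<in>T. \<exists>r. z = \<Phi> t \<and> Y z = r *\<^sub>R push P \<Phi> t (0, u t))"
proof -
  obtain \<beta>0 :: "'b \<times> 'g \<Rightarrow> real" and K where \<beta>0: "smooth_on UNIV \<beta>0" "\<beta>0 t0 \<noteq> 0" "compact K" "K \<subseteq> T"
    "\<And>t. t \<notin> K \<Longrightarrow> \<beta>0 t = 0"
    using bump_function[OF total_finite_dim T(1,3)] by blast
  \<comment> \<open>\<open>bump_function\<close> only promises a nonzero value at \<open>t0\<close>;
    the field must take the prescribed value there.\<close>
  define \<beta> where "\<beta> t = \<beta>0 t * inverse (\<beta>0 t0)" for t
  have \<beta>: "smooth_on UNIV \<beta>" "\<beta> t0 = 1" "\<And>t. t \<notin> K \<Longrightarrow> \<beta> t = 0"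
    unfolding \<beta>_def using \<beta>0 smooth_on_bounded_linear[OF open_UNIV bounded_linear_mult_left \<beta>0(1)] by auto
  define Y where "Y z = (if z \<in> \<Phi> ` T then \<beta> (\<psi> z) *\<^sub>R push P \<Phi> (\<psi> z) (0, u (\<psi> z)) else 0)" for z
  have Y_\<Phi>: "Y (\<Phi> t) = \<beta> t *\<^sub>R push P \<Phi> t (0, u t)" if "t \<in> T" for t
    using that \<psi>_\<Phi> T(2) by (auto simp: Y_def)
  obtain C :: "'g set" where C: "finite C" "independent C" "span C = UNIV"
    using finite_dim_basis[OF smooth_manifold_finite_dim[OF F]] .
  show ?thesis
  proof
    show "Y (\<Phi> t0) = push P \<Phi> t0 (0, u t0)" using Y_\<Phi>[OF T(3)] \<beta> by simp
    show "Y z = 0 \<or> (\<exists>t\<in>T. \<exists>r. z = \<Phi> t \<and> Y z = r *\<^sub>R push P \<Phi> t (0, u t))" for z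
    proof (cases "z \<in> \<Phi> ` T")
      case True
      then show ?thesis using Y_\<Phi> by blast
    qed (simp add: Y_def)
    show "Y \<in> vertical_fields P M \<alpha>"
      unfolding vertical_fields_def
    proof (intro CollectI conjI allI ballI impI)
      fix z
      show "Y z = 0" if "z \<notin> carrier P"
        using that param_carrier[OF \<Phi>] T(2) by (auto simp: Y_def)
      show "Y z \<in> vertical_space P M \<alpha> z" if z: "z \<in> carrier P"
      proof (cases "z \<in> \<Phi> ` T")
        case True
        then obtain t where t: "t \<in> T" "z = \<Phi> t" by blast
        then have tAB: "t \<in> A \<times> B" using T(2) by blast
        have "Y z = push P \<Phi> t (\<beta> t *\<^sub>R (0, u t))"
          using Y_\<Phi>[OF t(1)] t(2) by (simp only: linear_scale[OF push_linear[OF \<Phi> tAB]])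
        then show ?thesis using push_vertical_iff[OF tAB] t(2) by simp
      next
        case False
        obtain S and f :: "'e \<Rightarrow> 'p" and x where f: "param P S f" "x \<in> S" "f x = z"
          using tangent_param[OF P _ z] unfolding carrier_def by (metis openin_topspace)
        have "push P f x 0 = 0" by (rule linear_0[OF push_linear[OF f(1,2)]])
        moreover have "tangent_map P M \<alpha> z (push P f x 0) = push M (\<lambda>z. \<alpha> (f z)) x 0"
          using tangent_map_push[OF P M \<alpha>_smooth f(1,2)] f(3) z by simp
        moreover have "push M (\<lambda>z. \<alpha> (f z)) x 0 = 0"
          using linear_0[OF push_linear[OF param_smooth_map[OF P M f(1) \<alpha>_smooth] f(2)]] param_carrier[OF f(1)] by blast
        ultimately have "0 \<in> vertical_space P M \<alpha> z"
          using push_tangent[OF P f(1,2), of 0] f(3) unfolding vertical_space_def by simp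
        then show ?thesis using False by (simp add: Y_def)
      qed
    next
      fix d assume d: "d \<in> atlas P"
      let ?D = "snd d ` (fst d \<inter> \<Phi> ` (A \<times> B))" and ?\<chi> = "\<lambda>x. \<psi> (chart_inv d x)"
      have D: "open ?D" by (rule chart_image_Int_open[OF P d image_open])
      show "smooth_on (chart_image d) (\<lambda>x. Y (chart_inv d x) d)"
      proof (rule smooth_on_local)
        fix x assume x: "x \<in> chart_image d"
        show "\<exists>S. open S \<and> x \<in> S \<and> smooth_on S (\<lambda>x. Y (chart_inv d x) d)"
        proof (cases "chart_inv d x \<in> \<Phi> ` T")
          case True
          let ?S = "?D \<inter> ?\<chi> -` T"
          have S: "open ?S"
            by (rule continuous_open_preimage[OF smooth_on_continuous[OF \<psi>_smooth[OF d]] D T(1)])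
          have "x = snd d (chart_inv d x)" using chart_chart_inv[OF x] by simp
          then have xD: "x \<in> ?D" using chart_inv_in[OF x] True T(2) by blast
          then have xS: "x \<in> ?S" using True \<psi>_\<Phi> T(2) by auto
          let ?T = "T \<inter> \<Phi> -` fst d"
          have "?T = T \<inter> (A \<times> B \<inter> \<Phi> -` fst d)" using T by auto
          then have T': "open ?T" using T(1) param_chart_vimage_open[OF P \<Phi> d] by auto
          \<comment> \<open>Derivatives of \<Phi> are known to be smooth in constant directions; the
            variable direction \<open>u t\<close> is expanded in the basis \<open>C\<close> of the
            fibre model.\<close>
          let ?H = "\<lambda>t. \<beta> t *\<^sub>R (\<Sum>b\<in>C. representation C (u t) b *\<^sub>R
            frechet_derivative (\<lambda>t. snd d (\<Phi> t)) (at t) (0, b))"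
          have "smooth_on ?T u" by (rule smooth_on_subset[OF u]) simp
          then have 1: "smooth_on ?T (\<lambda>t. representation C (u t) b)" for b
            by (rule smooth_on_bounded_linear[OF T' bounded_linear_representation[OF C]])
          have 2: "smooth_on ?T (\<lambda>t. frechet_derivative (\<lambda>t. snd d (\<Phi> t)) (at t) (0, b))" for b
            by (rule smooth_on_frechet_derivative[OF smooth_on_subset[OF param_smooth[OF \<Phi> d]]]) (use T in auto)
          have H: "smooth_on ?T ?H"
            by (rule smooth_on_scaleR[OF T' smooth_on_subset[OF \<beta>(1) subset_UNIV]
                  smooth_on_sum[OF T' smooth_on_scaleR[OF T' 1 2]]])
          have \<Phi>\<chi>: "\<Phi> (?\<chi> x) = chart_inv d x" "chart_inv d x \<in> fst d" if "x \<in> ?D" for x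
            using that chart_inv_chart[OF P d] \<psi>_\<Phi> by auto
          have "?\<chi> ` ?S \<subseteq> ?T"
          proof
            fix t assume "t \<in> ?\<chi> ` ?S"
            then obtain x where "t = ?\<chi> x" "x \<in> ?D" "?\<chi> x \<in> T" by blast
            then show "t \<in> ?T" using \<Phi>\<chi>[of x] by simp
          qed
          then have "smooth_on ?S (\<lambda>x. ?H (?\<chi> x))"
            by (rule smooth_on_compose[OF total_finite_dim S T' _ smooth_on_subset[OF \<psi>_smooth[OF d]] H]) simp
          moreover have "?H (?\<chi> x) = Y (chart_inv d x) d" if "x \<in> ?S" for x
          proof -
            let ?t = "?\<chi> x"
            have t: "?t \<in> T" "\<Phi> ?t = chart_inv d x" using that \<Phi>\<chi> by auto
            have dt: "d \<in> charts_at P (\<Phi> ?t)" using \<Phi>\<chi>[of x] that d by (auto simp: charts_at_def)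
            have tAB: "?t \<in> A \<times> B" using t T(2) by blast
            have "linear (\<lambda>b. frechet_derivative (\<lambda>t. snd d (\<Phi> t)) (at ?t) (0, b))"
            proof -
              note lin = has_derivative_linear[OF param_has_derivative[OF \<Phi> tAB dt]]
              have "linear (\<lambda>b::'g. (0::'b, b))" by (auto intro!: linearI)
              from linear_compose[OF this lin] show ?thesis by (simp add: comp_def)
            qed
            from linear_expansion[OF C this, of "u ?t"]
            have "?H ?t = \<beta> ?t *\<^sub>R frechet_derivative (\<lambda>t. snd d (\<Phi> t)) (at ?t) (0, u ?t)" by simp
            also have "\<dots> = Y (\<Phi> ?t) d"
              unfolding Y_\<Phi>[OF t(1)] using dt by (simp add: push_def scaleR_fun_def)
            finally show ?thesis using t(2) by simp
          qed
          ultimately have "smooth_on ?S (\<lambda>x. Y (chart_inv d x) d)"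
            by (rule smooth_on_cong[OF S, rotated])
          then show ?thesis using S xS by blast
        next
          case False
          \<comment> \<open>The image of the support is compact, hence closed because
            \<open>P\<close> is Hausdorff. So x has a neighbourhood avoiding it, on which the field
            is 0.\<close>
          have "compactin (mtop P) (\<Phi> ` K)"
          proof (rule image_compactin)
            show "compactin (top_of_set (A \<times> B)) K"
              using \<beta>0(3,4) T(2) by (auto simp: compactin_subtopology)
            show "continuous_map (top_of_set (A \<times> B)) (mtop P) \<Phi>" using \<Phi> unfolding param_def by blast
          qed
          then have "closedin (mtop P) (\<Phi> ` K)"
            using P compactin_imp_closedin unfolding smooth_manifold_def by blast
          then have "openin (mtop P) (carrier P - \<Phi> ` K)" unfolding carrier_def by blast
          from chart_image_Int_open[OF P d this]
          have "open {x \<in> chart_image d. chart_inv d x \<in> carrier P - \<Phi> ` K}"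
            unfolding chart_image_Int[OF P d] .
          moreover have "Y (chart_inv d x) d = 0" if "chart_inv d x \<in> carrier P - \<Phi> ` K" for x
          proof (cases "chart_inv d x \<in> \<Phi> ` T")
            case True
            then obtain t where t: "t \<in> T" "chart_inv d x = \<Phi> t" by blast
            then have "t \<notin> K" using that by auto
            then show ?thesis using Y_\<Phi>[OF t(1)] t(2) \<beta>(3) by simp
          qed (simp add: Y_def)
          then have "smooth_on {x \<in> chart_image d. chart_inv d x \<in> carrier P - \<Phi> ` K} (\<lambda>x. Y (chart_inv d x) d)"
            using calculation by (intro smooth_on_cong[OF _ _ smooth_on_const[of _ 0]]) auto
          moreover have "chart_inv d x \<in> carrier P - \<Phi> ` K"
            using False \<beta>0(4) chart_inv_in[OF x] chart_subset_carrier[OF P d] by blast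
          ultimately show ?thesis using x by blast
        qed
      qed
    qed
  qed
qed

end

section \<open>Extension of vertical vectors and kernel distributions\<close>

lemma tangent_map_diff:
  assumes "smooth_manifold M" "smooth_manifold N" "smooth_map M N U h" "y \<in> U"
    and "\<xi> \<in> tangent_space M y" "\<eta> \<in> tangent_space M y"
  shows "tangent_map M N h y (\<xi> - \<eta>) = tangent_map M N h y \<xi> - tangent_map M N h y \<eta>"
  using tangent_map_linear[OF assms, of 1 "-1"] by simp

lemma tangent_map_zero:
  assumes "smooth_manifold M" "smooth_manifold N" "smooth_map M N U h" "y \<in> U" "y \<in> carrier M"
  shows "tangent_map M N h y 0 = 0"
  using tangent_map_diff[OF assms(1-4), of 0 0] subspace_0[OF subspace_tangent_space[OF assms(1,5)]] by simp

lemma subspace_vertical_space: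
  assumes fb: "fiber_bundle P M F \<alpha>" and y: "y \<in> carrier P"
  shows "subspace (vertical_space P M \<alpha> y)"
proof -
  note PM = fiber_bundle_manifolds[OF fb]
  note sub = subspace_tangent_space[OF PM(1) y]
  note lin = tangent_map_linear[OF PM(1,2,4) y]
  show ?thesis
    unfolding subspace_def
  proof (intro conjI ballI allI)
    show "0 \<in> vertical_space P M \<alpha> y"
      unfolding vertical_space_def using subspace_0[OF sub] tangent_map_zero[OF PM(1,2,4) y y] by simp
    fix \<xi> \<eta> and r :: real
    assume \<xi>: "\<xi> \<in> vertical_space P M \<alpha> y"
    show "r *\<^sub>R \<xi> \<in> vertical_space P M \<alpha> y"
      using lin[of \<xi> \<xi> r 0] \<xi> subspace_scale[OF sub] unfolding vertical_space_def by simp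
    assume \<eta>: "\<eta> \<in> vertical_space P M \<alpha> y"
    show "\<xi> + \<eta> \<in> vertical_space P M \<alpha> y"
      using lin[of \<xi> \<eta> 1 1] \<xi> \<eta> subspace_add[OF sub] unfolding vertical_space_def by simp
  qed
qed

text \<open>Kernels and degree conditions are defined by contraction with global vertical fields;
  through such extensions they can be tested on single vertical vectors.\<close>

lemma vertical_extension:
  fixes P :: "('p, 'e::real_normed_vector) manifold" and M :: "('m, 'b::real_normed_vector) manifold"
    and F :: "('f, 'g::real_normed_vector) manifold"
  assumes fb: "fiber_bundle P M F \<alpha>" and y: "y \<in> carrier P" and v: "v \<in> vertical_space P M \<alpha> y"
  obtains Y where "Y \<in> vertical_fields P M \<alpha>" "Y y = v"
proof -
  obtain c A and B :: "'g set" and \<Phi> \<psi> t where t: "local_triv P M \<alpha> c A B \<Phi> \<psi>" "t \<in> A \<times> B" "\<Phi> t = y"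
    using fiber_bundle_local_triv[OF fb y] by blast
  interpret bundle_triv P M F \<alpha> c A B \<Phi> \<psi> using fb t by unfold_locales
  obtain u where u: "v = push P \<Phi> t (0, u)" using v vertical_space_eq[OF t(2)] t(3) by blast
  show ?thesis
    using global_vertical_field[OF open_Times[OF A(1) B] subset_refl t(2) smooth_on_const[of _ u]]
      that u t(3) by metis
qed

lemma forms_off_carrier: "\<omega> \<in> forms M k \<Longrightarrow> y \<notin> carrier M \<Longrightarrow> \<omega> y = 0"
  unfolding forms_def by blast

lemma forms_improper:
  assumes "\<omega> \<in> forms M k" "\<not> (length \<xi>s = k \<and> set \<xi>s \<subseteq> tangent_space M y)"
  shows "\<omega> y \<xi>s = 0"
  using alternating_form_improper[OF forms_alternating[OF assms(1)] assms(2)] forms_off_carrier[OF assms(1), of y]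
  by (cases "y \<in> carrier M") auto

lemma forms_zero_arg:
  assumes "smooth_manifold M" "\<omega> \<in> forms M k" shows "\<omega> y (us @ 0 # vs) = 0"
  using alternating_form_zero_arg[OF forms_alternating[OF assms(2)]
      subspace_0[OF subspace_tangent_space[OF assms(1)]]] forms_off_carrier[OF assms(2), of y]
  by (cases "y \<in> carrier M") auto

lemma zero_in_kernel_dist_class:
  assumes fb: "fiber_bundle P M F \<alpha>" and \<omega>: "\<omega> \<in> forms P k" and y: "y \<in> carrier P"
  shows "0 \<in> kernel_dist_class P M \<alpha> \<omega> y"
  using subspace_0[OF subspace_vertical_space[OF fb y]]
    forms_zero_arg[OF fiber_bundle_manifolds(1)[OF fb] \<omega>, of y "[]"]
  unfolding kernel_dist_class_def by simp

text \<open>In a trivialization, the kernel of the class is the solution space of a family of linear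
  equations for the fibre component u, with coefficients smooth in t. This is the situation of
  \<open>smooth_kernel_section\<close>.\<close>

lemma kernel_class_extension:
  fixes P :: "('p, 'e::real_normed_vector) manifold" and M :: "('m, 'b::real_normed_vector) manifold"
    and F :: "('f, 'g::real_normed_vector) manifold"
  assumes fb: "fiber_bundle P M F \<alpha>" and \<omega>: "\<omega> \<in> forms P k"
    and rank: "constant_rank P (kernel_dist_class P M \<alpha> \<omega>)"
    and y: "y \<in> carrier P" and \<xi>: "\<xi> \<in> kernel_dist_class P M \<alpha> \<omega> y"
  obtains Y where "Y \<in> vertical_fields P M \<alpha>" "Y y = \<xi>"
    "\<And>z. z \<in> carrier P \<Longrightarrow> Y z \<in> kernel_dist_class P M \<alpha> \<omega> z"
proof -
  obtain c A and B :: "'g set" and \<Phi> \<psi> t0 where t0: "local_triv P M \<alpha> c A B \<Phi> \<psi>" "t0 \<in> A \<times> B" "\<Phi> t0 = y"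
    using fiber_bundle_local_triv[OF fb y] by blast
  interpret bundle_triv P M F \<alpha> c A B \<Phi> \<psi> using fb t0 by unfold_locales
  have AB: "open (A \<times> B)" by (rule open_Times[OF A(1) B])
  define r where "r = dim (kernel_dist_class P M \<alpha> \<omega> y)"
  have r: "dim (kernel_dist_class P M \<alpha> \<omega> z) = r" if "z \<in> carrier P" for z
    using rank that y unfolding constant_rank_def r_def by metis
  \<comment> \<open>One equation for each choice of the other arguments, the first of them vertical
    and the rest free. Lists of wrong length give the trivial equation, so the index set can be a
    whole type.\<close>
  define a where "a i t u = param_pullback P \<Phi> \<omega> t ((0, u) # (0, fst i) # snd i)"
    for i :: "'g \<times> ('b \<times> 'g) list" and t and u :: 'g
  note form = form_on_param[OF P \<omega> \<Phi>]
  have alt: "alternating_form UNIV k (param_pullback P \<Phi> \<omega> t)" if "t \<in> A \<times> B" for t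
    using form that unfolding form_on_def by blast
  have improper: "a i t u = 0" if "t \<in> A \<times> B" "length (snd i) + 2 \<noteq> k" for i t u
    using alternating_form_improper[OF alt[OF that(1)]] that(2) unfolding a_def by simp
  have lin: "linear (a i t)" if t: "t \<in> A \<times> B" for i t
  proof (cases "length (snd i) + 2 = k")
    case True
    have "linear (\<lambda>w. param_pullback P \<Phi> \<omega> t ([] @ w # (0, fst i) # snd i))"
      using True by (intro alternating_form_linear[OF alt[OF t]]) simp
    moreover have "linear (\<lambda>u::'g. (0::'b, u))" by (auto intro!: linearI)
    ultimately show ?thesis unfolding a_def using linear_compose by (fastforce simp: comp_def)
  next
    case False
    then show ?thesis by (intro linearI) (simp_all add: improper[OF t])
  qed
  have smooth: "smooth_on (A \<times> B) (\<lambda>t. a i t u)" for i u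
  proof (cases "length (snd i) + 2 = k")
    case True
    then show ?thesis using form unfolding form_on_def a_def by simp
  next
    case False
    then show ?thesis using improper by (intro smooth_on_cong[OF AB _ smooth_on_const[of _ 0]]) simp
  qed
  define K where "K t = {u \<in> UNIV. \<forall>i. a i t u = 0}" for t
  have class_iff: "push P \<Phi> t (0, u) \<in> kernel_dist_class P M \<alpha> \<omega> (\<Phi> t) \<longleftrightarrow> u \<in> K t"
    if t: "t \<in> A \<times> B" for t u
  proof
    assume L: "push P \<Phi> t (0, u) \<in> kernel_dist_class P M \<alpha> \<omega> (\<Phi> t)"
    have "a i t u = 0" for i
      using L push_vertical_iff[OF t, of "(0, fst i)"]
      unfolding a_def param_pullback_def kernel_dist_class_def by simp
    then show "u \<in> K t" unfolding K_def by blast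
  next
    assume u: "u \<in> K t"
    have "\<omega> (\<Phi> t) (push P \<Phi> t (0, u) # \<eta> # \<xi>s) = 0" if \<eta>: "\<eta> \<in> vertical_space P M \<alpha> (\<Phi> t)" for \<eta> \<xi>s
    proof (cases "set \<xi>s \<subseteq> tangent_space P (\<Phi> t)")
      case True
      then have "\<xi>s \<in> lists (range (push P \<Phi> t))" using push_surj[OF t] by auto
      then obtain ws where ws: "\<xi>s = map (push P \<Phi> t) ws" unfolding lists_image by blast
      obtain v where v: "\<eta> = push P \<Phi> t (0, v)" using \<eta> vertical_space_eq[OF t] by blast
      have "a (v, ws) t u = 0" using u unfolding K_def by blast
      then show ?thesis using v ws unfolding a_def param_pullback_def by simp
    next
      case False
      then show ?thesis by (intro forms_improper[OF \<omega>]) auto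
    qed
    then show "push P \<Phi> t (0, u) \<in> kernel_dist_class P M \<alpha> \<omega> (\<Phi> t)"
      unfolding kernel_dist_class_def using push_vertical_iff[OF t, of "(0, u)"] by simp
  qed
  have dims: "dim {u \<in> UNIV. \<forall>i. a i t u = 0} = r" if t: "t \<in> A \<times> B" for t
  proof -
    have "linear (\<lambda>u::'g. (0::'b, u))" by (auto intro!: linearI)
    then have l: "linear (\<lambda>u. push P \<Phi> t (0, u))"
      using linear_compose[OF _ push_linear[OF \<Phi> t], of "\<lambda>u. (0, u)"] by (simp add: comp_def)
    have inj: "inj_on (\<lambda>u. push P \<Phi> t (0, u)) (K t)"
      using push_inj[OF t] by (auto simp: inj_on_def dest: injD)
    have sub: "subspace (K t)"
      using lin[OF t] unfolding K_def by (auto simp: subspace_def linear_0 linear_add linear_scale)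
    have "(\<lambda>u. push P \<Phi> t (0, u)) ` K t = kernel_dist_class P M \<alpha> \<omega> (\<Phi> t)"
    proof (intro equalityI subsetI)
      fix \<eta> assume \<eta>: "\<eta> \<in> kernel_dist_class P M \<alpha> \<omega> (\<Phi> t)"
      then have "\<eta> \<in> vertical_space P M \<alpha> (\<Phi> t)" unfolding kernel_dist_class_def by blast
      then obtain u where "\<eta> = push P \<Phi> t (0, u)" using vertical_space_eq[OF t] by blast
      then show "\<eta> \<in> (\<lambda>u. push P \<Phi> t (0, u)) ` K t" using class_iff[OF t] \<eta> by blast
    qed (use class_iff[OF t] in blast)
    then have "dim (K t) = r"
      using finite_dim_dim_image[OF smooth_manifold_finite_dim[OF F] l sub inj] r[OF param_carrier[OF \<Phi> t]] by simp
    then show ?thesis unfolding K_def .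
  qed
  have "\<xi> \<in> vertical_space P M \<alpha> y" using \<xi> unfolding kernel_dist_class_def by blast
  then obtain u0 where u0: "\<xi> = push P \<Phi> t0 (0, u0)" using vertical_space_eq[OF t0(2)] t0(3) by blast
  then have "\<And>i. a i t0 u0 = 0" using class_iff[OF t0(2)] \<xi> t0(3) unfolding K_def by blast
  from smooth_kernel_section[OF smooth_manifold_finite_dim[OF F] AB t0(2) subspace_UNIV lin smooth dims UNIV_I this]
  obtain S u l where u: "open S" "t0 \<in> S" "S \<subseteq> A \<times> B" "smooth_on S u" "u t0 = l *\<^sub>R u0" "l \<noteq> 0"
    "\<forall>t\<in>S. \<forall>i. a i t (u t) = 0" by blast
  \<comment> \<open>\<open>smooth_kernel_section\<close> reaches only a nonzero multiple of
    \<open>u0\<close>; the factor is divided out.\<close>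
  have "smooth_on S (\<lambda>t. inverse l *\<^sub>R u t)"
    by (rule smooth_on_bounded_linear[OF u(1) bounded_linear_scaleR_right u(4)])
  from global_vertical_field[OF u(1,3,2) this]
  obtain Y where Y: "Y \<in> vertical_fields P M \<alpha>" "Y (\<Phi> t0) = push P \<Phi> t0 (0, inverse l *\<^sub>R u t0)"
    "\<And>z. z \<in> carrier P \<Longrightarrow> Y z = 0 \<or> (\<exists>t\<in>S. \<exists>r. z = \<Phi> t \<and> Y z = r *\<^sub>R push P \<Phi> t (0, inverse l *\<^sub>R u t))"
    by blast
  show ?thesis
  proof
    show "Y \<in> vertical_fields P M \<alpha>" by fact
    show "Y y = \<xi>" using Y(2) u(5,6) u0 t0(3) by simp
    fix z assume z: "z \<in> carrier P"
    show "Y z \<in> kernel_dist_class P M \<alpha> \<omega> z"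
    proof (cases "Y z = 0")
      case True
      then show ?thesis using zero_in_kernel_dist_class[OF fb \<omega> z] by simp
    next
      case False
      then obtain t s where t: "t \<in> S" "z = \<Phi> t" "Y z = s *\<^sub>R push P \<Phi> t (0, inverse l *\<^sub>R u t)"
        using Y(3)[OF z] by blast
      then have tAB: "t \<in> A \<times> B" using u(3) by blast
      have "(s * inverse l) *\<^sub>R u t \<in> K t"
        unfolding K_def using u(7) t(1) lin[OF tAB] by (simp add: linear_scale)
      moreover have "Y z = push P \<Phi> t (0, (s * inverse l) *\<^sub>R u t)"
        using linear_scale[OF push_linear[OF \<Phi> tAB], of s "(0, inverse l *\<^sub>R u t)"] t(3) by simp
      ultimately show ?thesis using class_iff[OF tAB] t(2) by simp
    qed
  qed
qed

lemma kernel_dist_eq_class: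
  assumes fb: "fiber_bundle P M F \<alpha>" and \<omega>: "\<omega> \<in> forms P k"
    and rank: "constant_rank P (kernel_dist_class P M \<alpha> \<omega>)"
    and ker: "ker_form P M \<alpha> \<omega> = ker_form_class P M \<alpha> \<omega>" and y: "y \<in> carrier P"
  shows "kernel_dist P M \<alpha> \<omega> y = kernel_dist_class P M \<alpha> \<omega> y"
proof
  show "kernel_dist P M \<alpha> \<omega> y \<subseteq> kernel_dist_class P M \<alpha> \<omega> y"
    unfolding kernel_dist_def kernel_dist_class_def by blast
  show "kernel_dist_class P M \<alpha> \<omega> y \<subseteq> kernel_dist P M \<alpha> \<omega> y"
  proof
    fix \<xi> assume \<xi>: "\<xi> \<in> kernel_dist_class P M \<alpha> \<omega> y"
    obtain Y where Y: "Y \<in> vertical_fields P M \<alpha>" "Y y = \<xi>"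
      "\<And>z. z \<in> carrier P \<Longrightarrow> Y z \<in> kernel_dist_class P M \<alpha> \<omega> z"
      using kernel_class_extension[OF fb \<omega> rank y \<xi>] by blast
    have "interior W (interior Y \<omega>) = 0" if W: "W \<in> vertical_fields P M \<alpha>" for W
    proof (intro ext)
      fix z \<xi>s
      show "interior W (interior Y \<omega>) z \<xi>s = 0 z \<xi>s"
      proof (cases "z \<in> carrier P")
        case True
        then have "W z \<in> vertical_space P M \<alpha> z" using W unfolding vertical_fields_def by blast
        then show ?thesis using Y(3)[OF True] unfolding kernel_dist_class_def interior_def by simp
      next
        case False
        then show ?thesis using forms_off_carrier[OF \<omega>] by (simp add: interior_def)
      qed
    qed
    \<comment> \<open>Here the hypothesis on global fields enters; evaluation at \<open>y\<close>
      then returns to vectors.\<close>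
    then have "Y \<in> ker_form P M \<alpha> \<omega>" unfolding ker ker_form_class_def using Y(1) by blast
    then have "interior Y \<omega> = 0" unfolding ker_form_def by blast
    then have "\<omega> y (\<xi> # \<xi>s) = 0" for \<xi>s
    proof -
      have "interior Y \<omega> y \<xi>s = 0" using \<open>interior Y \<omega> = 0\<close> by simp
      then show ?thesis using Y(2) by (simp add: interior_def)
    qed
    then show "\<xi> \<in> kernel_dist P M \<alpha> \<omega> y"
      using \<xi> unfolding kernel_dist_def kernel_dist_class_def by blast
  qed
qed

text \<open>The innermost contraction comes from the last field and supplies the first argument,
  hence the reversal.\<close>

lemma foldr_interior: "foldr interior Ys \<omega> y \<xi>s = \<omega> y (map (\<lambda>Y. Y y) (rev Ys) @ \<xi>s)"
  by (induction Ys arbitrary: \<xi>s) (simp_all add: interior_def)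

lemma Lambda_forms_vertical:
  assumes fb: "fiber_bundle P M F \<alpha>" and \<omega>: "\<omega> \<in> Lambda_forms P M \<alpha> p k" and "p \<le> k"
    and y: "y \<in> carrier P" and vs: "set vs \<subseteq> vertical_space P M \<alpha> y" "length vs = k - p + 1"
  shows "\<omega> y (vs @ \<xi>s) = 0"
proof -
  have "\<exists>Y. Y \<in> vertical_fields P M \<alpha> \<and> Y y = v" if "v \<in> set vs" for v
    using vertical_extension[OF fb y] vs(1) that by blast
  then obtain Y where Y: "\<And>v. v \<in> set vs \<Longrightarrow> Y v \<in> vertical_fields P M \<alpha>" "\<And>v. v \<in> set vs \<Longrightarrow> Y v y = v"
    by metis
  let ?Ys = "rev (map Y vs)"
  have "\<forall>Ys. set Ys \<subseteq> vertical_fields P M \<alpha> \<and> length Ys = k - p + 1 \<longrightarrow> foldr interior Ys \<omega> = 0"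
    using \<omega> \<open>p \<le> k\<close> unfolding Lambda_forms_def by (simp split: if_splits)
  moreover have "set ?Ys \<subseteq> vertical_fields P M \<alpha>" "length ?Ys = k - p + 1" using Y(1) vs(2) by auto
  ultimately have "foldr interior ?Ys \<omega> = 0" by blast
  then have "\<omega> y (map (\<lambda>Y. Y y) (rev ?Ys) @ \<xi>s) = 0"
    using foldr_interior[of ?Ys \<omega> y \<xi>s] by simp
  moreover have "map (\<lambda>Y. Y y) (rev ?Ys) = vs"
    using Y(2) by (simp add: comp_def map_idI)
  ultimately show ?thesis by simp
qed

context bundle_triv begin

text \<open>\<open>local_triv\<close> gives openness of the whole image; neighbourhoods inside a
  trivialization need it for smaller sets. In a chart the image is the preimage of \<open>T\<close>
  under \<psi>.\<close>

lemma image_openin: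
  assumes T: "open T" "T \<subseteq> A \<times> B" shows "openin (mtop P) (\<Phi> ` T)"
proof (subst openin_subopen, intro ballI)
  fix z assume "z \<in> \<Phi> ` T"
  then obtain t where t: "t \<in> T" "z = \<Phi> t" by blast
  have z: "z \<in> carrier P" using t T param_carrier[OF \<Phi>] by blast
  obtain d where d: "d \<in> charts_at P z" using charts_at_obtain[OF P z] .
  note dA = charts_atD[OF d]
  let ?D = "snd d ` (fst d \<inter> \<Phi> ` (A \<times> B))" and ?\<chi> = "\<lambda>x. \<psi> (chart_inv d x)"
  have D: "open ?D" by (rule chart_image_Int_open[OF P dA(1) image_open])
  let ?S = "?D \<inter> ?\<chi> -` T"
  have S: "open ?S"
    by (rule continuous_open_preimage[OF smooth_on_continuous[OF \<psi>_smooth[OF dA(1)]] D T(1)])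
  let ?W = "{z \<in> topspace (subtopology (mtop P) (fst d)). snd d z \<in> ?S}"
  have "openin (top_of_set (chart_image d)) ?S" using S by (auto intro: open_subset simp: chart_image_def)
  then have "openin (subtopology (mtop P) (fst d)) ?W"
    using homeomorphic_imp_continuous_map[OF chart_homeomorphic[OF P dA(1)]] unfolding continuous_map_def by blast
  then have W: "openin (mtop P) ?W" using openin_open_subtopology[OF chart_openin[OF P dA(1)]] by blast
  have "z \<in> ?W"
    using z t dA T(2) \<psi>_\<Phi> chart_inv_chart[OF P dA] by (auto simp: carrier_def)
  moreover have "?W \<subseteq> \<Phi> ` T"
  proof
    fix z' assume z': "z' \<in> ?W"
    then have fd: "z' \<in> fst d" by simp
    have "snd d z' \<in> ?D" "?\<chi> (snd d z') \<in> T" using z' by auto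
    then obtain z'' where "z'' \<in> fst d" "z'' \<in> \<Phi> ` (A \<times> B)" "snd d z'' = snd d z'" by force
    then have "z' \<in> \<Phi> ` (A \<times> B)" using chart_inj[OF P dA(1)] fd by (metis inj_onD)
    moreover have "\<psi> z' \<in> T" using \<open>?\<chi> (snd d z') \<in> T\<close> chart_inv_chart[OF P dA(1) fd] by simp
    ultimately show "z' \<in> \<Phi> ` T" using \<psi>_\<Phi> by auto
  qed
  ultimately show "\<exists>W. openin (mtop P) W \<and> z \<in> W \<and> W \<subseteq> \<Phi> ` T" using W by blast
qed

end

section \<open>Local sections and jets\<close>

text \<open>\<open>D\<close> is annihilated in the first slot and, by alternation, in every slot, so
  the form descends to the quotient by \<open>D\<close>. Arguments are exchanged one at a time
  behind a fixed prefix \<open>us\<close>; for lists of wrong length both values are 0.\<close>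

lemma alternating_form_cong_mod:
  assumes f: "alternating_form T k f" and T: "subspace T" and D: "\<And>d vs. d \<in> D \<Longrightarrow> f (d # vs) = 0"
  shows "list_all2 (\<lambda>\<xi> \<eta>. \<xi> - \<eta> \<in> D) \<xi>s \<eta>s \<Longrightarrow> set us \<subseteq> T \<Longrightarrow> set \<xi>s \<subseteq> T \<Longrightarrow> set \<eta>s \<subseteq> T \<Longrightarrow>
    f (us @ \<xi>s) = f (us @ \<eta>s)"
proof (induction \<xi>s \<eta>s arbitrary: us rule: list_all2_induct)
  case (Cons \<xi> \<xi>s \<eta> \<eta>s)
  have len: "length \<xi>s = length \<eta>s" using Cons.hyps(2) by (rule list_all2_lengthD)
  have IH: "f (us @ \<xi> # \<xi>s) = f (us @ \<xi> # \<eta>s)"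
    using Cons.IH[of "us @ [\<xi>]"] Cons.prems by simp
  show ?case
  proof (cases "length us + length \<eta>s + 1 = k")
    case True
    have d: "\<xi> - \<eta> \<in> T" using T Cons.prems by (simp add: subspace_diff)
    have "f (us @ (1 *\<^sub>R (\<xi> - \<eta>) + 1 *\<^sub>R \<eta>) # \<eta>s) = 1 * f (us @ (\<xi> - \<eta>) # \<eta>s) + 1 * f (us @ \<eta> # \<eta>s)"
      using True Cons.prems d by (intro alternating_form_linear_at[OF f]) auto
    moreover have "f ([] @ us @ (\<xi> - \<eta>) # \<eta>s) = (- 1) ^ length us * f ([] @ (\<xi> - \<eta>) # us @ \<eta>s)"
      using True Cons.prems d by (intro alternating_form_move[OF f T]) auto
    ultimately show ?thesis using IH D[OF Cons.hyps(1)] by simp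
  next
    case False
    then show ?thesis using len by (simp add: alternating_form_improper[OF f])
  qed
qed simp

lemma push_const: "push M (\<lambda>z. a) x w = 0"
  unfolding push_def by (intro ext) (simp add: frechet_derivative_const)

lemma local_section_smooth: "local_section P M \<alpha> U \<sigma> \<Longrightarrow> smooth_map M P U \<sigma>"
  unfolding local_section_def by blast

lemma local_section_tangent:
  fixes M :: "('m, 'b::real_normed_vector) manifold"
  assumes fb: "fiber_bundle P M F \<alpha>" and \<sigma>: "local_section P M \<alpha> U \<sigma>" and x: "x \<in> U"
    and v: "v \<in> tangent_space M x"
  shows "tangent_map P M \<alpha> (\<sigma> x) (tangent_map M P \<sigma> x v) = v"
proof -
  note PM = fiber_bundle_manifolds[OF fb] and \<sigma>s = local_section_smooth[OF \<sigma>]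
  obtain S and f :: "'b \<Rightarrow> 'm" and s where f: "param M S f" "s \<in> S" "f s = x" "f ` S \<subseteq> U"
    "tangent_space M x = range (push M f s)" "inj (push M f s)"
    using tangent_param[OF PM(2) smooth_map_openin[OF \<sigma>s] x] .
  obtain w where w: "v = push M f s w" using v f(5) by blast
  have \<sigma>f: "param P S (\<lambda>z. \<sigma> (f z))" by (rule param_smooth_map[OF PM(2,1) f(1) \<sigma>s f(4)])
  have "tangent_map M P \<sigma> x v = push P (\<lambda>z. \<sigma> (f z)) s w"
    using tangent_map_push[OF PM(2,1) \<sigma>s f(1,2), of w] f(3) x w by simp
  moreover have "tangent_map P M \<alpha> (\<sigma> (f s)) (push P (\<lambda>z. \<sigma> (f z)) s w) = push M (\<lambda>z. \<alpha> (\<sigma> (f z))) s w"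
    using tangent_map_push[OF PM(1,2,4) \<sigma>f f(2)] param_carrier[OF \<sigma>f f(2)] by simp
  moreover have "push M (\<lambda>z. \<alpha> (\<sigma> (f z))) s = push M f s"
    using \<sigma> f(4) unfolding local_section_def by (intro push_cong[OF param_open[OF f(1)] f(2)]) blast
  ultimately show ?thesis using f(3) w by simp
qed

text \<open>Since T\<alpha> after T\<sigma> is the identity, T\<sigma> after T\<alpha> projects onto
  the jet of \<sigma> along the vertical space. This replaces the definite description in
  \<open>horizontal_part\<close> by a formula.\<close>

lemma local_section_split:
  assumes fb: "fiber_bundle P M F \<alpha>" and \<sigma>: "local_section P M \<alpha> U \<sigma>" and x: "x \<in> U"
    and \<xi>: "\<xi> \<in> tangent_space P (\<sigma> x)"
  defines "h \<equiv> tangent_map M P \<sigma> x (tangent_map P M \<alpha> (\<sigma> x) \<xi>)"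
  shows "h \<in> jet_prolongation P M \<sigma> x" "h \<in> tangent_space P (\<sigma> x)" "\<xi> - h \<in> vertical_space P M \<alpha> (\<sigma> x)"
proof -
  note PM = fiber_bundle_manifolds[OF fb] and \<sigma>s = local_section_smooth[OF \<sigma>]
  have y: "\<sigma> x \<in> carrier P" by (rule smooth_map_maps[OF \<sigma>s x])
  have \<alpha>: "tangent_map P M \<alpha> (\<sigma> x) \<xi> \<in> tangent_space M x"
    using tangent_map_tangent[OF PM(1,2,4) y \<xi>] \<sigma> x unfolding local_section_def by simp
  show "h \<in> jet_prolongation P M \<sigma> x" unfolding h_def jet_prolongation_def using \<alpha> by blast
  show hT: "h \<in> tangent_space P (\<sigma> x)"
    unfolding h_def by (rule tangent_map_tangent[OF PM(2,1) \<sigma>s x \<alpha>])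
  have "tangent_map P M \<alpha> (\<sigma> x) h = tangent_map P M \<alpha> (\<sigma> x) \<xi>"
    unfolding h_def by (rule local_section_tangent[OF fb \<sigma> x \<alpha>])
  then show "\<xi> - h \<in> vertical_space P M \<alpha> (\<sigma> x)"
    unfolding vertical_space_def
    using tangent_map_diff[OF PM(1,2,4) y \<xi> hT] subspace_diff[OF subspace_tangent_space[OF PM(1) y] \<xi> hT]
    by simp
qed

lemma jet_prolongation_Int_vertical:
  assumes fb: "fiber_bundle P M F \<alpha>" and \<sigma>: "local_section P M \<alpha> U \<sigma>" and x: "x \<in> U"
  shows "jet_prolongation P M \<sigma> x \<inter> vertical_space P M \<alpha> (\<sigma> x) = {0}"
    and "subspace (jet_prolongation P M \<sigma> x)"
    and "jet_prolongation P M \<sigma> x \<subseteq> tangent_space P (\<sigma> x)"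
proof -
  note PM = fiber_bundle_manifolds[OF fb] and \<sigma>s = local_section_smooth[OF \<sigma>]
  have xM: "x \<in> carrier M"
    using openin_subset[OF smooth_map_openin[OF \<sigma>s]] x unfolding carrier_def by blast
  have y: "\<sigma> x \<in> carrier P" by (rule smooth_map_maps[OF \<sigma>s x])
  note sub = subspace_tangent_space[OF PM(2) xM]
  note lin = tangent_map_linear[OF PM(2,1) \<sigma>s x]
  have zero: "tangent_map M P \<sigma> x 0 = 0" by (rule tangent_map_zero[OF PM(2,1) \<sigma>s x xM])
  show "subspace (jet_prolongation P M \<sigma> x)"
    unfolding subspace_def
  proof (intro conjI ballI allI)
    show "0 \<in> jet_prolongation P M \<sigma> x"
      unfolding jet_prolongation_def using zero subspace_0[OF sub] by force
    fix \<xi> \<eta> and r :: real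
    assume "\<xi> \<in> jet_prolongation P M \<sigma> x"
    then obtain v where v: "\<xi> = tangent_map M P \<sigma> x v" "v \<in> tangent_space M x" unfolding jet_prolongation_def by blast
    have "r *\<^sub>R \<xi> = tangent_map M P \<sigma> x (r *\<^sub>R v)" using lin[OF v(2) v(2), of r 0] v(1) by simp
    then show "r *\<^sub>R \<xi> \<in> jet_prolongation P M \<sigma> x"
      unfolding jet_prolongation_def using subspace_scale[OF sub v(2)] by blast
    assume "\<eta> \<in> jet_prolongation P M \<sigma> x"
    then obtain w where w: "\<eta> = tangent_map M P \<sigma> x w" "w \<in> tangent_space M x" unfolding jet_prolongation_def by blast
    have "\<xi> + \<eta> = tangent_map M P \<sigma> x (v + w)" using lin[OF v(2) w(2), of 1 1] v(1) w(1) by simp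
    then show "\<xi> + \<eta> \<in> jet_prolongation P M \<sigma> x"
      unfolding jet_prolongation_def using subspace_add[OF sub v(2) w(2)] by blast
  qed
  show "jet_prolongation P M \<sigma> x \<inter> vertical_space P M \<alpha> (\<sigma> x) = {0}"
  proof (intro equalityI subsetI)
    fix \<xi> assume \<xi>: "\<xi> \<in> jet_prolongation P M \<sigma> x \<inter> vertical_space P M \<alpha> (\<sigma> x)"
    then obtain v where v: "\<xi> = tangent_map M P \<sigma> x v" "v \<in> tangent_space M x" unfolding jet_prolongation_def by blast
    have "v = tangent_map P M \<alpha> (\<sigma> x) \<xi>" unfolding v(1) by (rule local_section_tangent[OF fb \<sigma> x v(2), symmetric])
    then have "v = 0" using \<xi> unfolding vertical_space_def by simp
    then show "\<xi> \<in> {0}" using v(1) zero by simp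
  qed (use \<open>subspace (jet_prolongation P M \<sigma> x)\<close> subspace_0 subspace_vertical_space[OF fb y] in auto)
  show "jet_prolongation P M \<sigma> x \<subseteq> tangent_space P (\<sigma> x)"
    unfolding jet_prolongation_def using tangent_map_tangent[OF PM(2,1) \<sigma>s x] by blast
qed

text \<open>Supplies the first clause of \<open>PD_solution\<close> on both sides of the equivalence
  to be proved.\<close>

lemma jet_prolongation_jet_point:
  assumes fb: "fiber_bundle P M F \<alpha>" and \<sigma>: "local_section P M \<alpha> U \<sigma>" and x: "x \<in> U"
  shows "jet_prolongation P M \<sigma> x \<in> jet_points P M \<alpha> (\<sigma> x)"
proof -
  note PM = fiber_bundle_manifolds[OF fb]
  note J = jet_prolongation_Int_vertical[OF fb \<sigma> x]
  have y: "\<sigma> x \<in> carrier P" by (rule smooth_map_maps[OF local_section_smooth[OF \<sigma>] x])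
  have "{h + v | h v. h \<in> jet_prolongation P M \<sigma> x \<and> v \<in> vertical_space P M \<alpha> (\<sigma> x)} = tangent_space P (\<sigma> x)"
  proof (intro equalityI subsetI)
    fix \<xi> assume "\<xi> \<in> {h + v | h v. h \<in> jet_prolongation P M \<sigma> x \<and> v \<in> vertical_space P M \<alpha> (\<sigma> x)}"
    then obtain h v where hv: "\<xi> = h + v" "h \<in> jet_prolongation P M \<sigma> x" "v \<in> vertical_space P M \<alpha> (\<sigma> x)" by blast
    then have "h \<in> tangent_space P (\<sigma> x)" "v \<in> tangent_space P (\<sigma> x)"
      using J(3) unfolding vertical_space_def by blast+
    then show "\<xi> \<in> tangent_space P (\<sigma> x)"
      unfolding hv(1) by (rule subspace_add[OF subspace_tangent_space[OF PM(1) y]])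
  next
    fix \<xi> assume \<xi>: "\<xi> \<in> tangent_space P (\<sigma> x)"
    note sp = local_section_split[OF fb \<sigma> x \<xi>]
    let ?h = "tangent_map M P \<sigma> x (tangent_map P M \<alpha> (\<sigma> x) \<xi>)"
    have "\<xi> = ?h + (\<xi> - ?h)" by simp
    then show "\<xi> \<in> {h + v | h v. h \<in> jet_prolongation P M \<sigma> x \<and> v \<in> vertical_space P M \<alpha> (\<sigma> x)}"
      using sp(1,3) by blast
  qed
  then show ?thesis unfolding jet_points_def using J by blast
qed

lemma horizontal_part_local_section:
  assumes fb: "fiber_bundle P M F \<alpha>" and \<sigma>: "local_section P M \<alpha> U \<sigma>" and x: "x \<in> U"
    and \<xi>: "\<xi> \<in> tangent_space P (\<sigma> x)"
  shows "horizontal_part (jet_prolongation P M \<sigma> x) (vertical_space P M \<alpha> (\<sigma> x)) \<xi> =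
    tangent_map M P \<sigma> x (tangent_map P M \<alpha> (\<sigma> x) \<xi>)"
  unfolding horizontal_part_def
proof (rule the_equality)
  note sp = local_section_split[OF fb \<sigma> x \<xi>] and J = jet_prolongation_Int_vertical[OF fb \<sigma> x]
  have y: "\<sigma> x \<in> carrier P" by (rule smooth_map_maps[OF local_section_smooth[OF \<sigma>] x])
  let ?h = "tangent_map M P \<sigma> x (tangent_map P M \<alpha> (\<sigma> x) \<xi>)"
  show "?h \<in> jet_prolongation P M \<sigma> x \<and> \<xi> - ?h \<in> vertical_space P M \<alpha> (\<sigma> x)" using sp by blast
  fix h assume h: "h \<in> jet_prolongation P M \<sigma> x \<and> \<xi> - h \<in> vertical_space P M \<alpha> (\<sigma> x)"
  have "(\<xi> - ?h) - (\<xi> - h) \<in> vertical_space P M \<alpha> (\<sigma> x)"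
    by (rule subspace_diff[OF subspace_vertical_space[OF fb y] sp(3) conjunct2[OF h]])
  moreover have "(\<xi> - ?h) - (\<xi> - h) = h - ?h" by simp
  ultimately have "h - ?h \<in> vertical_space P M \<alpha> (\<sigma> x)" by (simp only:)
  moreover have "h - ?h \<in> jet_prolongation P M \<sigma> x"
    by (rule subspace_diff[OF J(2) conjunct1[OF h] sp(1)])
  ultimately have "h - ?h \<in> jet_prolongation P M \<sigma> x \<inter> vertical_space P M \<alpha> (\<sigma> x)" by (rule IntI[rotated])
  then have "h - ?h = 0" unfolding J(1) by (rule singletonD)
  then show "h = ?h" by (simp only: right_minus_eq)
qed

section \<open>Reduction along the leaves\<close>

locale leaf_reduction =
  fixes M :: "('m, 'b::real_normed_vector) manifold"
    and P :: "('p, 'e::real_normed_vector) manifold"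
    and F :: "('f, 'g::real_normed_vector) manifold"
    and \<alpha> :: "'p \<Rightarrow> 'm"
    and \<omega> :: "('p, 'e) form"
    and P' :: "('p set, 'h::real_normed_vector) manifold"
    and F' :: "('i, 'j::real_normed_vector) manifold"
    and \<alpha>' :: "'p set \<Rightarrow> 'm"
    and G :: "('l, 'k::real_normed_vector) manifold"
    and \<pp> :: "'p \<Rightarrow> 'p set"
  assumes bundle_P: "fiber_bundle P M F \<alpha>"
    and preham: "PD_prehamiltonian P M \<alpha> \<omega>"
    and rank: "constant_rank P (kernel_dist_class P M \<alpha> \<omega>)"
    and kernels: "ker_form P M \<alpha> \<omega> = ker_form_class P M \<alpha> \<omega>"
    and leaf_iff: "\<And>y L. y \<in> carrier P \<Longrightarrow>
           L \<in> leaves TYPE('k) P (kernel_dist P M \<alpha> \<omega>) \<and> y \<in> L \<longleftrightarrow> L = \<pp> y"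
    and \<alpha>'_\<pp>: "\<And>y. y \<in> carrier P \<Longrightarrow> \<alpha>' (\<pp> y) = \<alpha> y"
    and bundle_P': "fiber_bundle P' M F' \<alpha>'"
    and bundle_\<pp>: "fiber_bundle P P' G \<pp>"
begin

text \<open>This is n + 1, also for n = 0 in spite of the truncated subtraction. For n = 0 the
  horizontal degree n - 1 is truncated to 0, so \<open>Omega\<close> then asks for two vertical
  contractions instead of three.\<close>

abbreviation deg :: nat where "deg \<equiv> 2 + mdim M - 1"

abbreviation T\<pp> :: "'p \<Rightarrow> ('p, 'e) tvec \<Rightarrow> ('p set, 'h) tvec" where "T\<pp> \<equiv> tangent_map P P' \<pp>"

lemmas P = fiber_bundle_manifolds(1)[OF bundle_P] and M = fiber_bundle_manifolds(2)[OF bundle_P]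
  and \<alpha>_smooth = fiber_bundle_manifolds(4)[OF bundle_P]
  and P' = fiber_bundle_manifolds(1)[OF bundle_P'] and \<alpha>'_smooth = fiber_bundle_manifolds(4)[OF bundle_P']
  and G = fiber_bundle_manifolds(3)[OF bundle_\<pp>]
  and \<pp>_smooth = fiber_bundle_manifolds(4)[OF bundle_\<pp>] and \<pp>_image = fiber_bundle_manifolds(5)[OF bundle_\<pp>]

lemma \<pp>_carrier: "y \<in> carrier P \<Longrightarrow> \<pp> y \<in> carrier P'"
  using \<pp>_image by blast

lemma \<omega>_Lambda: "\<omega> \<in> Lambda_forms P M \<alpha> (mdim M - 1) deg"
  and \<omega>_closed: "ext_deriv P \<omega> = 0"
  using preham unfolding PD_prehamiltonian_def Omega_def by auto

lemma \<omega>_forms: "\<omega> \<in> forms P deg"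
  using \<omega>_Lambda unfolding Lambda_forms_def by (simp split: if_splits)

lemma \<omega>_alternating: "y \<in> carrier P \<Longrightarrow> alternating_form (tangent_space P y) deg (\<omega> y)"
  by (rule forms_alternating[OF \<omega>_forms])

section \<open>Tangent spaces of the leaves and the kernel of the form\<close>

lemma leaf_manifold:
  assumes y: "y \<in> carrier P"
  obtains N :: "('p, 'k) manifold"
  where "connected_integral_manifold P (kernel_dist P M \<alpha> \<omega>) N" "carrier N = \<pp> y" "y \<in> \<pp> y"
proof -
  have "\<pp> y \<in> leaves TYPE('k) P (kernel_dist P M \<alpha> \<omega>) \<and> y \<in> \<pp> y" using leaf_iff[OF y] by blast
  then show ?thesis using that unfolding leaves_def by blast
qed

lemma leaf_mem_iff:
  assumes "y \<in> carrier P" "z \<in> carrier P" shows "z \<in> \<pp> y \<longleftrightarrow> \<pp> z = \<pp> y"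
  using leaf_iff[OF assms(1)] leaf_iff[OF assms(2)] by metis

text \<open>The dimension count is carried out by a map: read through the parametrizations of the
  leaf and of the fibre of \<pp>, the inclusion of the kernel into the vertical space is an
  injective linear map \<theta> of \<open>'k\<close> into itself, hence surjective.\<close>

lemma kernel_dist_eq_vertical:
  assumes y: "y \<in> carrier P"
  shows "kernel_dist P M \<alpha> \<omega> y = vertical_space P P' \<pp> y"
proof -
  obtain N :: "('p, 'k) manifold" where N: "connected_integral_manifold P (kernel_dist P M \<alpha> \<omega>) N"
    "carrier N = \<pp> y" "y \<in> \<pp> y"
    using leaf_manifold[OF y] .
  have N': "smooth_manifold N" "carrier N \<subseteq> carrier P" "smooth_map N P (carrier N) id"
    "inj_on (tangent_map N P id y) (tangent_space N y)"
    "tangent_map N P id y ` tangent_space N y = kernel_dist P M \<alpha> \<omega> y"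
    using N unfolding connected_integral_manifold_def by auto
  have yN: "y \<in> carrier N" using N by simp
  obtain S and f :: "'k \<Rightarrow> 'p" and x where f: "param N S f" "x \<in> S" "f x = y" "f ` S \<subseteq> carrier N"
    "tangent_space N y = range (push N f x)" "inj (push N f x)"
    using tangent_param[OF N'(1) smooth_map_openin[OF N'(3)] yN] .
  have "param P S (\<lambda>z. id (f z))" by (rule param_smooth_map[OF N'(1) P f(1) N'(3) f(4)])
  then have fP: "param P S f" by simp
  have j: "tangent_map N P id y (push N f x w) = push P f x w" for w
    using tangent_map_push[OF N'(1) P N'(3) f(1,2), of w] f(3) yN by simp
  have D: "kernel_dist P M \<alpha> \<omega> y = range (push P f x)"
    unfolding N'(5)[symmetric] f(5) image_image j .. 
  have j_inj: "inj (push P f x)"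
  proof (rule injI)
    fix a b assume "push P f x a = push P f x b"
    then have "push N f x a = push N f x b"
      using inj_onD[OF N'(4), of "push N f x a" "push N f x b"] f(5) j by auto
    then show "a = b" by (rule injD[OF f(6)])
  qed
  \<comment> \<open>The leaf lies in a single fibre of \<pp>, so T\<pp> vanishes on its tangent
    vectors.\<close>
  have const: "\<pp> (f z) = \<pp> y" if "z \<in> S" for z
    using leaf_mem_iff[OF y, of "f z"] f(4) N(2) N'(2) that by blast
  have D_vert: "push P f x w \<in> vertical_space P P' \<pp> y" for w
  proof -
    have "T\<pp> (f x) (push P f x w) = push P' (\<lambda>z. \<pp> (f z)) x w"
      using y f(3) by (intro tangent_map_push[OF P P' \<pp>_smooth fP f(2)]) simp
    also have "push P' (\<lambda>z. \<pp> (f z)) x = push P' (\<lambda>z. \<pp> y) x"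
      by (rule push_cong[OF param_open[OF f(1)] f(2) const])
    also have "\<dots> w = 0" by (rule push_const)
    finally have "T\<pp> y (push P f x w) = 0" unfolding f(3) .
    then show ?thesis unfolding vertical_space_def using push_tangent[OF P fP f(2), of w] f(3) by simp
  qed
  obtain c A and B :: "'k set" and \<Phi> \<psi> t where t: "local_triv P P' \<pp> c A B \<Phi> \<psi>" "t \<in> A \<times> B" "\<Phi> t = y"
    using fiber_bundle_local_triv[OF bundle_\<pp> y] by blast
  interpret T: bundle_triv P P' G \<pp> c A B \<Phi> \<psi> using bundle_\<pp> t by unfold_locales
  define r where "r u = push P \<Phi> t (0, u)" for u
  have V: "vertical_space P P' \<pp> y = range r" using T.vertical_space_eq[OF t(2)] t(3) unfolding r_def by simp
  have r_inj: "inj r"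
    unfolding r_def by (rule injI) (drule injD[OF T.push_inj[OF t(2)]], simp)
  have lin0: "linear (\<lambda>u::'k. (0::'h, u))" by (auto intro!: linearI)
  have r_lin: "linear r"
    unfolding r_def using linear_compose[OF lin0 push_linear[OF T.\<Phi> t(2)]] by (simp add: comp_def)
  define \<theta> where "\<theta> w = inv r (push P f x w)" for w
  have r\<theta>: "r (\<theta> w) = push P f x w" for w
    unfolding \<theta>_def using D_vert[of w] V by (simp add: f_inv_into_f)
  note f_lin = push_linear[OF fP f(2)]
  have "linear \<theta>"
    by (intro linearI injD[OF r_inj]) (simp_all add: r\<theta> linear_add[OF r_lin] linear_scale[OF r_lin]
        linear_add[OF f_lin] linear_scale[OF f_lin])
  moreover have "inj \<theta>"
    using j_inj r\<theta> by (metis injD injI)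
  ultimately have "surj \<theta>"
    by (rule finite_dim_linear_injective_surjective[OF smooth_manifold_finite_dim[OF G]])
  then have "range r \<subseteq> range (push P f x)" using r\<theta> by (metis image_subsetI rangeI surjD)
  then show ?thesis unfolding D using V D_vert by blast
qed

lemma kernel_dist_class_eq_vertical:
  "y \<in> carrier P \<Longrightarrow> kernel_dist_class P M \<alpha> \<omega> y = vertical_space P P' \<pp> y"
  using kernel_dist_eq_class[OF bundle_P \<omega>_forms rank kernels] kernel_dist_eq_vertical by simp

lemma \<omega>_vertical:
  assumes "y \<in> carrier P" "\<xi> \<in> vertical_space P P' \<pp> y" shows "\<omega> y (\<xi> # \<xi>s) = 0"
  using assms kernel_dist_eq_vertical[OF assms(1)] unfolding kernel_dist_def by blast

text \<open>The base chart of the trivialization is a chart around \<open>\<pp> y\<close>, so the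
  component of a tangent vector of \<open>P'\<close> in it, paired with 0, is the coordinate vector
  of a lift.\<close>

lemma chart_triv:
  assumes y: "y \<in> carrier P"
  obtains c A and B :: "'k set" and \<Phi> \<psi> t
  where "bundle_triv P P' G \<pp> c A B \<Phi> \<psi>" "t \<in> A \<times> B" "\<Phi> t = y" "c \<in> charts_at P' (\<pp> y)" "snd c (\<pp> y) = fst t"
proof -
  obtain c A and B :: "'k set" and \<Phi> \<psi> t where t: "local_triv P P' \<pp> c A B \<Phi> \<psi>" "t \<in> A \<times> B" "\<Phi> t = y"
    using fiber_bundle_local_triv[OF bundle_\<pp> y] by blast
  interpret T: bundle_triv P P' G \<pp> c A B \<Phi> \<psi> using bundle_\<pp> t by unfold_locales
  have c: "\<pp> y = chart_inv c (fst t)" using T.\<alpha>_\<Phi>[OF t(2)] t(3) by simp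
  have x: "fst t \<in> chart_image c" using t(2) T.A(2) by auto
  show ?thesis
  proof
    show "bundle_triv P P' G \<pp> c A B \<Phi> \<psi>" by unfold_locales
    show "c \<in> charts_at P' (\<pp> y)" unfolding charts_at_def c using T.c chart_inv_in[OF x] by simp
    show "snd c (\<pp> y) = fst t" unfolding c by (rule chart_chart_inv[OF x])
  qed (fact t)+
qed

section \<open>Lifting tangent vectors and constancy along leaves\<close>

lemma T\<pp>_surj:
  assumes y: "y \<in> carrier P" and \<xi>': "\<xi>' \<in> tangent_space P' (\<pp> y)"
  shows "\<exists>\<xi>\<in>tangent_space P y. T\<pp> y \<xi> = \<xi>'"
proof -
  obtain c A and B :: "'k set" and \<Phi> \<psi> t where t: "bundle_triv P P' G \<pp> c A B \<Phi> \<psi>" "t \<in> A \<times> B" "\<Phi> t = y"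
    "c \<in> charts_at P' (\<pp> y)" "snd c (\<pp> y) = fst t"
    using chart_triv[OF y] .
  interpret T: bundle_triv P P' G \<pp> c A B \<Phi> \<psi> by fact
  have "T\<pp> y (push P \<Phi> t (\<xi>' c, 0)) = \<xi>'"
    using T.tangent_map_push_triv[OF t(2), of "(\<xi>' c, 0)"] tangent_eq_push[OF P' \<xi>' t(4)] t(3,5) by simp
  then show ?thesis using push_tangent[OF P T.\<Phi> t(2)] t(3) by blast
qed

text \<open>A pointwise choice, with no claim of linearity or continuity; by
  \<open>\<omega>_cong_lift\<close> the values of \<omega> on lifts do not depend on it.\<close>

definition lift :: "'p \<Rightarrow> ('p set, 'h) tvec \<Rightarrow> ('p, 'e) tvec"
  where "lift y \<xi>' = (SOME \<xi>. \<xi> \<in> tangent_space P y \<and> T\<pp> y \<xi> = \<xi>')"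

lemma lift:
  assumes "y \<in> carrier P" "\<xi>' \<in> tangent_space P' (\<pp> y)"
  shows "lift y \<xi>' \<in> tangent_space P y" "T\<pp> y (lift y \<xi>') = \<xi>'"
  using someI_ex[of "\<lambda>\<xi>. \<xi> \<in> tangent_space P y \<and> T\<pp> y \<xi> = \<xi>'"] T\<pp>_surj[OF assms]
  unfolding lift_def by blast+

lemma lift_list:
  assumes "y \<in> carrier P" "set \<xi>s' \<subseteq> tangent_space P' (\<pp> y)"
  shows "set (map (lift y) \<xi>s') \<subseteq> tangent_space P y" "map (T\<pp> y) (map (lift y) \<xi>s') = \<xi>s'"
  using lift[OF assms(1)] assms(2) by (auto intro!: map_idI)

text \<open>Arguments with equal images under T\<pp> differ by vectors tangent to the leaf, which
  \<omega> annihilates in every slot.\<close>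

lemma \<omega>_cong_lift:
  assumes y: "y \<in> carrier P" and sub: "set \<xi>s \<subseteq> tangent_space P y" "set \<eta>s \<subseteq> tangent_space P y"
    and eq: "map (T\<pp> y) \<xi>s = map (T\<pp> y) \<eta>s"
  shows "\<omega> y \<xi>s = \<omega> y \<eta>s"
proof -
  have len: "length \<xi>s = length \<eta>s" using eq by (rule map_eq_imp_length_eq)
  have "\<xi>s ! i - \<eta>s ! i \<in> vertical_space P P' \<pp> y" if i: "i < length \<xi>s" for i
  proof -
    have T: "\<xi>s ! i \<in> tangent_space P y" "\<eta>s ! i \<in> tangent_space P y" using sub i len by auto
    have "T\<pp> y (\<xi>s ! i) = T\<pp> y (\<eta>s ! i)" using arg_cong[OF eq, of "\<lambda>l. l ! i"] i len by simp
    then have "T\<pp> y (\<xi>s ! i - \<eta>s ! i) = 0" using tangent_map_diff[OF P P' \<pp>_smooth y T] by simp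
    then show ?thesis
      unfolding vertical_space_def using subspace_diff[OF subspace_tangent_space[OF P y] T] by simp
  qed
  then have "list_all2 (\<lambda>\<xi> \<eta>. \<xi> - \<eta> \<in> vertical_space P P' \<pp> y) \<xi>s \<eta>s"
    using len by (simp add: list_all2_conv_all_nth)
  from alternating_form_cong_mod[OF \<omega>_alternating[OF y] subspace_tangent_space[OF P y] \<omega>_vertical[OF y] this, of "[]"]
  show ?thesis using sub by simp
qed

text \<open>Contracting \<open>d\<omega> = 0\<close> with a vector tangent to the leaf, only the derivative of the coefficient in
  that direction survives, so the coefficients of \<open>\<omega>\<close> in a trivialization of \<open>\<pp>\<close> are constant along leaves.\<close>

lemma \<omega>_locally_constant:
  assumes z: "z \<in> carrier P" and \<xi>s': "set \<xi>s' \<subseteq> tangent_space P' (\<pp> z)" "length \<xi>s' = deg"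
  shows "\<exists>W. openin (mtop P) W \<and> z \<in> W \<and>
    (\<forall>z'\<in>W. \<pp> z' = \<pp> z \<longrightarrow> \<omega> z' (map (lift z') \<xi>s') = \<omega> z (map (lift z) \<xi>s'))"
proof -
  obtain c A and B :: "'k set" and \<Phi> \<psi> t where t: "bundle_triv P P' G \<pp> c A B \<Phi> \<psi>" "t \<in> A \<times> B" "\<Phi> t = z"
    "c \<in> charts_at P' (\<pp> z)" "snd c (\<pp> z) = fst t"
    using chart_triv[OF z] .
  interpret T: bundle_triv P P' G \<pp> c A B \<Phi> \<psi> by fact
  obtain a b where ab: "t = (a, b)" by (cases t)
  have a: "a \<in> A" "b \<in> B" "a \<in> chart_image c" using t(2) T.A(2) ab by auto
  define ws where "ws = map (\<lambda>\<xi>'. (\<xi>' c, 0::'k)) \<xi>s'"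
  define Gf where "Gf = param_pullback P \<Phi> \<omega>"
  note form = form_on_param[OF P \<omega>_forms T.\<Phi>, folded Gf_def]
  have len: "length ws = deg" using \<xi>s' by (simp add: ws_def)
  have coord: "\<omega> (\<Phi> (a, b')) (map (lift (\<Phi> (a, b'))) \<xi>s') = Gf (a, b') ws" if b': "b' \<in> B" for b'
  proof -
    let ?t = "(a, b')" and ?z = "\<Phi> (a, b')"
    have tAB: "?t \<in> A \<times> B" using a b' by blast
    have zP: "?z \<in> carrier P" by (rule param_carrier[OF T.\<Phi> tAB])
    have "\<pp> ?z = \<pp> z" using T.\<alpha>_\<Phi>[OF tAB] T.\<alpha>_\<Phi>[OF t(2)] t(3) ab by simp
    then have sub: "set \<xi>s' \<subseteq> tangent_space P' (\<pp> ?z)" using \<xi>s' by simp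
    have "T\<pp> ?z (push P \<Phi> ?t (\<xi>' c, 0)) = \<xi>'" if "\<xi>' \<in> set \<xi>s'" for \<xi>'
      using T.tangent_map_push_triv[OF tAB, of "(\<xi>' c, 0)"] tangent_eq_push[OF P' _ t(4), of \<xi>']
        \<xi>s'(1) that t(5) ab by auto
    then have "map (T\<pp> ?z) (map (push P \<Phi> ?t) ws) = map (T\<pp> ?z) (map (lift ?z) \<xi>s')"
      using lift_list(2)[OF zP sub] by (simp add: ws_def comp_def map_idI)
    moreover have "set (map (push P \<Phi> ?t) ws) \<subseteq> tangent_space P ?z" using push_tangent[OF P T.\<Phi> tAB] by auto
    ultimately show ?thesis
      unfolding Gf_def param_pullback_def
      using \<omega>_cong_lift[OF zP lift_list(1)[OF zP sub]] by simp
  qed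
  have vert: "Gf s ((0, v) # us) = 0" if "s \<in> A \<times> B" for s v us
    unfolding Gf_def param_pullback_def
    using \<omega>_vertical[OF param_carrier[OF T.\<Phi> that]] T.push_vertical_iff[OF that, of "(0, v)"] by simp
  have deriv: "frechet_derivative (\<lambda>s. Gf s ws) (at (a, b')) (0, v) = 0" if b': "b' \<in> B" for b' v
  proof -
    have tAB: "(a, b') \<in> A \<times> B" using a b' by blast
    have AB: "open (A \<times> B)" by (rule open_Times[OF T.A(1) T.B])
    let ?l = "(0, v) # ws"
    have "0 = local_ext_deriv Gf (a, b') ?l"
      unfolding Gf_def using len by (intro param_pullback_closed[OF P \<omega>_forms \<omega>_closed T.\<Phi> tAB, symmetric]) simp
    also have "\<dots> = frechet_derivative (\<lambda>s. Gf s ws) (at (a, b')) (0, v) +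
      (\<Sum>i<length ws. (-1) ^ Suc i * frechet_derivative (\<lambda>s. Gf s ((0, v) # take i ws @ drop (Suc i) ws)) (at (a, b')) (ws ! i))"
      unfolding local_ext_deriv_def by (simp add: sum.lessThan_Suc_shift del: sum.lessThan_Suc)
    also have "(\<Sum>i<length ws. (-1) ^ Suc i *
        frechet_derivative (\<lambda>s. Gf s ((0, v) # take i ws @ drop (Suc i) ws)) (at (a, b')) (ws ! i)) = 0"
    \<comment> \<open>These terms keep (0, v) as first argument, so each differentiates a function
      that is 0 on all of \<open>A \<times> B\<close>.\<close>
    proof (intro sum.neutral ballI)
      fix i
      have "frechet_derivative (\<lambda>s. Gf s ((0, v) # take i ws @ drop (Suc i) ws)) (at (a, b')) =
          frechet_derivative (\<lambda>s. 0) (at (a, b'))"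
        by (rule frechet_derivative_cong_open[OF AB tAB vert])
      then show "(-1) ^ Suc i *
        frechet_derivative (\<lambda>s. Gf s ((0, v) # take i ws @ drop (Suc i) ws)) (at (a, b')) (ws ! i) = 0"
        by (simp add: frechet_derivative_const)
    qed
    finally show ?thesis by simp
  qed
  \<comment> \<open>\<open>B\<close> may be disconnected; on a convex set a vanishing derivative
    does force constancy.\<close>
  obtain e where e: "e > 0" "ball b e \<subseteq> B" using T.B a open_contains_ball by metis
  have "((\<lambda>b'. Gf (a, b') ws) has_derivative (\<lambda>v. 0)) (at b' within ball b e)" if b': "b' \<in> ball b e" for b'
  proof -
    have tAB: "(a, b') \<in> A \<times> B" using a b' e by blast
    have "((\<lambda>b'. (a, b')) has_derivative (\<lambda>v. (0, v))) (at b' within ball b e)"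
      by (auto intro!: derivative_eq_intros)
    from has_derivative_compose[of "\<lambda>b'. (a, b')" _ b' _ "\<lambda>s. Gf s ws", OF this form_on_coeff_has_derivative[OF form tAB len]]
    show ?thesis using deriv e(2) b' by auto
  qed
  from has_derivative_zero_constant[OF convex_ball this]
  obtain C where C: "\<And>b'. b' \<in> ball b e \<Longrightarrow> Gf (a, b') ws = C" by blast
  \<comment> \<open>The base coordinate ranges over \<open>A\<close> to make the set open in
    \<open>P\<close>; for points with the same leaf it is pinned to \<open>a\<close> by injectivity
    of the chart inverse.\<close>
  let ?W = "\<Phi> ` (A \<times> ball b e)"
  have "openin (mtop P) ?W"
    using e(2) by (intro T.image_openin open_Times T.A(1)) auto
  moreover have "z \<in> ?W" using t(3) ab a e by force
  moreover have "\<omega> z' (map (lift z') \<xi>s') = \<omega> z (map (lift z) \<xi>s')" if z': "z' \<in> ?W" "\<pp> z' = \<pp> z" for z'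
  proof -
    obtain a' b' where ab': "a' \<in> A" "b' \<in> ball b e" "z' = \<Phi> (a', b')" using z'(1) by blast
    have "b' \<in> B" using ab'(2) e(2) by blast
    then have eq: "chart_inv c a' = chart_inv c a"
      using T.\<alpha>_\<Phi>[of "(a', b')"] T.\<alpha>_\<Phi>[OF t(2)] ab' z'(2) t(3) ab by simp
    have "a' \<in> chart_image c" using ab'(1) T.A(2) by blast
    then have "a' = a"
      using arg_cong[OF eq, of "snd c"] unfolding chart_chart_inv[OF a(3)] by (simp only: chart_chart_inv)
    then show ?thesis
      using coord[OF \<open>b' \<in> B\<close>] coord[OF a(2)] C[OF ab'(2)] C[of b] e(1) ab'(3) t(3) ab by simp
  qed
  ultimately show ?thesis by blast
qed

text \<open>Connectedness refers to the topology of \<open>N\<close>, which may be finer than that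
  of a subspace of \<open>P\<close>. The neighbourhoods of local constancy are pulled back along the
  continuous inclusion, and the level set through y is open and closed in \<open>N\<close>.\<close>

lemma \<omega>_leaf_constant:
  assumes y: "y \<in> carrier P" and z: "z \<in> carrier P" "\<pp> z = \<pp> y"
    and \<xi>s': "set \<xi>s' \<subseteq> tangent_space P' (\<pp> y)" "length \<xi>s' = deg"
  shows "\<omega> z (map (lift z) \<xi>s') = \<omega> y (map (lift y) \<xi>s')"
proof -
  obtain N :: "('p, 'k) manifold" where N: "connected_integral_manifold P (kernel_dist P M \<alpha> \<omega>) N"
    "carrier N = \<pp> y" "y \<in> \<pp> y"
    using leaf_manifold[OF y] .
  have N': "carrier N \<subseteq> carrier P" "smooth_map N P (carrier N) id" "connected_space (mtop N)"
    using N unfolding connected_integral_manifold_def by auto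
  have cont: "continuous_map (mtop N) (mtop P) id"
    using N'(2) unfolding smooth_map_def carrier_def by simp
  define h where "h z = \<omega> z (map (lift z) \<xi>s')" for z
  have leaf: "\<pp> x = \<pp> y" "x \<in> carrier P" if "x \<in> carrier N" for x
    using leaf_mem_iff[OF y] N(2) N'(1) that by blast+
  have loc: "\<exists>W. openin (mtop N) W \<and> x \<in> W \<and> (\<forall>x'\<in>W. h x' = h x)" if x: "x \<in> carrier N" for x
  proof -
    obtain W where W: "openin (mtop P) W" "x \<in> W" "\<forall>x'\<in>W. \<pp> x' = \<pp> x \<longrightarrow> h x' = h x"
      using \<omega>_locally_constant[of x \<xi>s'] leaf[OF x] \<xi>s' unfolding h_def by auto
    let ?W = "{x' \<in> topspace (mtop N). id x' \<in> W}"
    have "openin (mtop N) ?W" using cont W(1) unfolding continuous_map_def by blast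
    moreover have "\<forall>x'\<in>?W. h x' = h x"
      using W(3) leaf(1) leaf(1)[OF x] by (auto simp: carrier_def)
    moreover have "x \<in> ?W" using W(2) x by (simp add: carrier_def)
    ultimately show ?thesis by blast
  qed
  let ?S = "{x \<in> carrier N. h x = h y}"
  have sub: "W \<subseteq> carrier N" if "openin (mtop N) W" for W using openin_subset[OF that] unfolding carrier_def .
  have "openin (mtop N) ?S"
  proof (subst openin_subopen, intro ballI)
    fix x assume x: "x \<in> ?S"
    then obtain W where W: "openin (mtop N) W" "x \<in> W" "\<forall>x'\<in>W. h x' = h x" using loc by blast
    have "W \<subseteq> ?S"
    proof
      fix x' assume x': "x' \<in> W"
      have "x' \<in> carrier N" by (rule subsetD[OF sub[OF W(1)] x'])
      moreover have "h x' = h y" using W(3) x' x by simp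
      ultimately show "x' \<in> ?S" by blast
    qed
    then show "\<exists>W. openin (mtop N) W \<and> x \<in> W \<and> W \<subseteq> ?S" using W by blast
  qed
  moreover have "openin (mtop N) (topspace (mtop N) - ?S)"
  proof (subst openin_subopen, intro ballI)
    fix x assume x: "x \<in> topspace (mtop N) - ?S"
    then obtain W where W: "openin (mtop N) W" "x \<in> W" "\<forall>x'\<in>W. h x' = h x" using loc unfolding carrier_def by blast
    have "W \<subseteq> topspace (mtop N) - ?S"
    proof
      fix x' assume x': "x' \<in> W"
      have "x' \<in> topspace (mtop N)" by (rule subsetD[OF openin_subset[OF W(1)] x'])
      moreover have "h x' \<noteq> h y" using W(3) x' x unfolding carrier_def by simp
      ultimately show "x' \<in> topspace (mtop N) - ?S" by blast
    qed
    then show "\<exists>W. openin (mtop N) W \<and> x \<in> W \<and> W \<subseteq> topspace (mtop N) - ?S" using W by blast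
  qed
  then have "closedin (mtop N) ?S" unfolding closedin_def carrier_def by auto
  ultimately have "?S = {} \<or> ?S = topspace (mtop N)" using N'(3) unfolding connected_space_clopen_in by blast
  moreover have "y \<in> ?S" using N by simp
  moreover have "z \<in> topspace (mtop N)" using leaf_mem_iff[OF y z(1)] z(2) N(2) unfolding carrier_def by simp
  ultimately have "h z = h y" by blast
  then show ?thesis unfolding h_def .
qed

text \<open>The point of the leaf and the lifts are arbitrary; independence is shown in
  \<open>reduced_form_T\<pp>\<close>. The value 0 elsewhere is the convention for forms, which makes
  uniqueness an equality of functions.\<close>

definition reduced_form :: "('p set, 'h) form"
  where "reduced_form L \<xi>s' = (if L \<in> carrier P' \<and> set \<xi>s' \<subseteq> tangent_space P' L
    then let y = SOME y. y \<in> carrier P \<and> \<pp> y = L in \<omega> y (map (lift y) \<xi>s') else 0)"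

text \<open>Both choices disappear: that of the point by constancy along the leaf, that of the lifts
  by \<open>\<omega>_cong_lift\<close>. All later facts about proper arguments rest on this
  rule.\<close>

lemma reduced_form_T\<pp>:
  assumes y: "y \<in> carrier P" and \<xi>s: "set \<xi>s \<subseteq> tangent_space P y"
  shows "reduced_form (\<pp> y) (map (T\<pp> y) \<xi>s) = \<omega> y \<xi>s"
proof -
  define z where "z = (SOME z. z \<in> carrier P \<and> \<pp> z = \<pp> y)"
  have z: "z \<in> carrier P" "\<pp> z = \<pp> y"
    using someI_ex[of "\<lambda>z. z \<in> carrier P \<and> \<pp> z = \<pp> y"] y unfolding z_def by blast+
  let ?\<xi>s' = "map (T\<pp> y) \<xi>s"
  have sub: "set ?\<xi>s' \<subseteq> tangent_space P' (\<pp> y)"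
    using tangent_map_tangent[OF P P' \<pp>_smooth y] \<xi>s by auto
  have "reduced_form (\<pp> y) ?\<xi>s' = \<omega> z (map (lift z) ?\<xi>s')"
    unfolding reduced_form_def z_def[symmetric] Let_def using sub \<pp>_carrier[OF y] by simp
  also have "\<dots> = \<omega> y (map (lift y) ?\<xi>s')"
  proof (cases "length ?\<xi>s' = deg")
    case True
    then show ?thesis by (intro \<omega>_leaf_constant[OF y z sub])
  next
    \<comment> \<open>Constancy along leaves concerns lists of length \<open>deg\<close>; for other
      lengths both sides are 0.\<close>
    case False
    then show ?thesis using forms_improper[OF \<omega>_forms] by simp
  qed
  also have "\<dots> = \<omega> y \<xi>s"
    by (rule \<omega>_cong_lift[OF y lift_list(1)[OF y sub] \<xi>s lift_list(2)[OF y sub]])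
  finally show ?thesis .
qed

lemma reduced_form_improper:
  "\<not> (L \<in> carrier P' \<and> set \<xi>s' \<subseteq> tangent_space P' L) \<Longrightarrow> reduced_form L \<xi>s' = 0"
  unfolding reduced_form_def by (rule if_not_P)

lemma pullback_reduced_form: "\<omega> = pullback P P' \<pp> reduced_form"
proof (intro ext)
  fix y \<xi>s
  show "\<omega> y \<xi>s = pullback P P' \<pp> reduced_form y \<xi>s"
  proof (cases "y \<in> carrier P \<and> set \<xi>s \<subseteq> tangent_space P y")
    case True
    then show ?thesis unfolding pullback_def using reduced_form_T\<pp> by simp
  next
    case False
    then have "\<omega> y \<xi>s = 0"
      using forms_off_carrier[OF \<omega>_forms, of y] forms_improper[OF \<omega>_forms, of \<xi>s y]
      by (cases "y \<in> carrier P") auto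
    then show ?thesis unfolding pullback_def if_not_P[OF False] .
  qed
qed

text \<open>Smoothness must be checked in every chart of \<open>P'\<close>, while a trivialization
  comes with its own. The section is the change of charts followed by \<Phi> with the fibre
  coordinate frozen.\<close>

lemma local_section_of_chart:
  assumes c': "c' \<in> atlas P'" and x0: "x0 \<in> chart_image c'"
  obtains S f where "open S" "x0 \<in> S" "S \<subseteq> chart_image c'" "param P S f"
    "\<And>x. x \<in> S \<Longrightarrow> \<pp> (f x) = chart_inv c' x"
proof -
  have L: "chart_inv c' x0 \<in> carrier P'" using chart_inv_in[OF x0] chart_subset_carrier[OF P' c'] by blast
  then have "chart_inv c' x0 \<in> \<pp> ` carrier P" unfolding \<pp>_image .
  then obtain y where y: "y \<in> carrier P" "\<pp> y = chart_inv c' x0" by (metis imageE)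
  obtain c A and B :: "'k set" and \<Phi> \<psi> t where t: "bundle_triv P P' G \<pp> c A B \<Phi> \<psi>" "t \<in> A \<times> B" "\<Phi> t = y"
    "c \<in> charts_at P' (\<pp> y)" "snd c (\<pp> y) = fst t"
    using chart_triv[OF y(1)] .
  interpret T: bundle_triv P P' G \<pp> c A B \<Phi> \<psi> by fact
  note inv = param_chart_inv[OF P' c'] and cA = charts_atD[OF t(4)]
  let ?\<phi> = "\<lambda>x. snd c (chart_inv c' x)"
  let ?T = "chart_image c' \<inter> chart_inv c' -` fst c"
  have T: "open ?T" "smooth_on ?T ?\<phi>"
    by (rule param_chart_vimage_open[OF P' inv cA(1)], rule param_smooth[OF inv cA(1)])
  let ?S = "?T \<inter> ?\<phi> -` A"
  have S: "open ?S" by (rule continuous_open_preimage[OF smooth_on_continuous[OF T(2)] T(1) T.A(1)])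
  let ?\<chi> = "\<lambda>x. (?\<phi> x, snd t)"
  have "smooth_on ?S ?\<chi>"
    by (rule smooth_on_Pair[OF S smooth_on_subset[OF T(2)] smooth_on_const]) blast
  moreover have img: "?\<chi> ` ?S \<subseteq> A \<times> B" using t(2) by auto
  ultimately have "param P ?S (\<lambda>x. \<Phi> (?\<chi> x))" by (rule param_compose[OF P T.total_finite_dim T.\<Phi> S])
  moreover have "\<pp> (\<Phi> (?\<chi> x)) = chart_inv c' x" if "x \<in> ?S" for x
  proof -
    have "?\<chi> x \<in> A \<times> B" using img that by blast
    from T.\<alpha>_\<Phi>[OF this] show ?thesis using that chart_inv_chart[OF P' cA(1)] by simp
  qed
  moreover have "x0 \<in> ?S" using x0 y(2) cA t(2,5) by auto
  ultimately show ?thesis using that S by blast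
qed

text \<open>Over \<open>S\<close> the section supplies the points and its push the lifts, both
  depending smoothly on x, in place of the pointwise choices.\<close>

lemma reduced_form_local_section:
  assumes c': "c' \<in> atlas P'" and S: "open S" "S \<subseteq> chart_image c'" and f: "param P S f"
    and \<pp>f: "\<And>x. x \<in> S \<Longrightarrow> \<pp> (f x) = chart_inv c' x" and x: "x \<in> S"
  shows "T\<pp> (f x) (push P f x w) = push P' (chart_inv c') x w"
    and "reduced_form (chart_inv c' x) (map (coord_tvec P' c' (chart_inv c' x)) ws) = param_pullback P f \<omega> x ws"
proof -
  have fx: "f x \<in> carrier P" by (rule param_carrier[OF f x])
  have T: "T\<pp> (f x) (push P f x w) = push P' (chart_inv c') x w" for w
  proof -
    have "T\<pp> (f x) (push P f x w) = push P' (\<lambda>z. \<pp> (f z)) x w"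
      by (rule tangent_map_push[OF P P' \<pp>_smooth f x fx])
    also have "push P' (\<lambda>z. \<pp> (f z)) x = push P' (chart_inv c') x" by (rule push_cong[OF S(1) x \<pp>f])
    finally show ?thesis .
  qed
  show "T\<pp> (f x) (push P f x w) = push P' (chart_inv c') x w" by (rule T)
  have "x \<in> chart_image c'" using S(2) x by blast
  then have eq: "map (coord_tvec P' c' (chart_inv c' x)) ws = map (T\<pp> (f x)) (map (push P f x) ws)"
    by (simp add: coord_tvec_eq_push T)
  have sub: "set (map (push P f x) ws) \<subseteq> tangent_space P (f x)" using push_tangent[OF P f x] by auto
  show "reduced_form (chart_inv c' x) (map (coord_tvec P' c' (chart_inv c' x)) ws) = param_pullback P f \<omega> x ws"
    unfolding eq unfolding \<pp>f[OF x, symmetric] param_pullback_def by (rule reduced_form_T\<pp>[OF fx sub])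
qed

end

context leaf_reduction begin

section \<open>The reduced form is a closed differential form\<close>

lemma reduced_form_lift:
  assumes "y \<in> carrier P" "set \<xi>s' \<subseteq> tangent_space P' (\<pp> y)"
  shows "reduced_form (\<pp> y) \<xi>s' = \<omega> y (map (lift y) \<xi>s')"
  using reduced_form_T\<pp>[OF assms(1) lift_list(1)[OF assms]] unfolding lift_list(2)[OF assms] .

lemma carrier_P'_cases:
  assumes "L \<in> carrier P'" obtains y where "y \<in> carrier P" "L = \<pp> y"
  using assms unfolding \<pp>_image[symmetric] by blast

text \<open>\<open>lift\<close> is not known to be linear, so multilinearity is read off other
  lifts: \<open>R\<close> pushes the component in the chart along a local section and is
  linear.\<close>

lemma reduced_form_alternating:
  assumes L: "L \<in> carrier P'"
  shows "alternating_form (tangent_space P' L) deg (reduced_form L)"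
proof -
  obtain c' where c': "c' \<in> charts_at P' L" using charts_at_obtain[OF P' L] .
  note cA = charts_atD[OF c']
  let ?x = "snd c' L"
  have x: "?x \<in> chart_image c'" using cA(2) by (rule chart_in_image)
  have inv: "chart_inv c' ?x = L" by (rule chart_inv_chart[OF P' cA])
  obtain S f where f: "open S" "?x \<in> S" "S \<subseteq> chart_image c'" "param P S f"
    "\<And>x. x \<in> S \<Longrightarrow> \<pp> (f x) = chart_inv c' x"
    using local_section_of_chart[OF cA(1) x] by blast
  let ?R = "\<lambda>\<xi>'. push P f ?x (\<xi>' c')"
  have y: "f ?x \<in> carrier P" "\<pp> (f ?x) = L" using param_carrier[OF f(4,2)] f(5)[OF f(2)] inv by simp_all
  have RT: "?R \<xi>' \<in> tangent_space P (f ?x)" for \<xi>' by (rule push_tangent[OF P f(4,2)])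
  have TR: "T\<pp> (f ?x) (?R \<xi>') = \<xi>'" if "\<xi>' \<in> tangent_space P' L" for \<xi>'
    using reduced_form_local_section(1)[OF cA(1) f(1,3,4,5,2), of "\<xi>' c'"] tangent_eq_push[OF P' that c'] by simp
  note lin = push_linear[OF f(4,2)]
  show ?thesis
  proof (rule alternating_form_map[OF \<omega>_alternating[OF y(1)], where R = ?R])
    show "reduced_form L vs = \<omega> (f ?x) (map ?R vs)" if vs: "set vs \<subseteq> tangent_space P' L" for vs
    proof -
      have "map (T\<pp> (f ?x)) (map ?R vs) = vs" using vs TR by (auto intro!: map_idI)
      moreover have "set (map ?R vs) \<subseteq> tangent_space P (f ?x)" using RT by auto
      ultimately show ?thesis using reduced_form_T\<pp>[OF y(1), of "map ?R vs"] y(2) by simp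
    qed
    show "reduced_form L vs = 0" if "\<not> set vs \<subseteq> tangent_space P' L" for vs
      using that by (intro reduced_form_improper) blast
    show "?R (a *\<^sub>R u + b *\<^sub>R v) = a *\<^sub>R ?R u + b *\<^sub>R ?R v" for u v a b
      by (simp add: scaleR_fun_def linear_add[OF lin] linear_scale[OF lin, unfolded scaleR_fun_def])
  qed (rule RT, rule subspace_tangent_space[OF P' L])
qed

lemma reduced_form_forms: "reduced_form \<in> forms P' deg"
  unfolding forms_def
proof (intro CollectI conjI allI ballI impI)
  show "reduced_form L = 0" if "L \<notin> carrier P'" for L
    using that by (intro ext) (simp add: reduced_form_improper)
  show "alternating_form (tangent_space P' L) deg (reduced_form L)" if "L \<in> carrier P'" for L
    by (rule reduced_form_alternating[OF that])
  fix c' and ws :: "'h list" assume c': "c' \<in> atlas P'" and ws: "length ws = deg"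
  show "smooth_on (chart_image c') (\<lambda>x. reduced_form (chart_inv c' x) (map (coord_tvec P' c' (chart_inv c' x)) ws))"
  proof (rule smooth_on_local)
    fix x0 assume x0: "x0 \<in> chart_image c'"
    obtain S f where f: "open S" "x0 \<in> S" "S \<subseteq> chart_image c'" "param P S f"
      "\<And>x. x \<in> S \<Longrightarrow> \<pp> (f x) = chart_inv c' x"
      using local_section_of_chart[OF c' x0] by blast
    have "smooth_on S (\<lambda>x. param_pullback P f \<omega> x ws)"
      using form_on_param[OF P \<omega>_forms f(4)] ws unfolding form_on_def by blast
    then have "smooth_on S (\<lambda>x. reduced_form (chart_inv c' x) (map (coord_tvec P' c' (chart_inv c' x)) ws))"
      by (rule smooth_on_cong[OF f(1), rotated]) (rule reduced_form_local_section(2)[OF c' f(1,3,4,5), symmetric])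
    then show "\<exists>S. open S \<and> x0 \<in> S \<and>
        smooth_on S (\<lambda>x. reduced_form (chart_inv c' x) (map (coord_tvec P' c' (chart_inv c' x)) ws))"
      using f(1,2) by blast
  qed
qed

lemma reduced_form_closed: "ext_deriv P' reduced_form = 0"
proof (intro ext)
  fix L \<xi>s'
  show "ext_deriv P' reduced_form L \<xi>s' = 0 L \<xi>s'"
  proof (cases "L \<in> carrier P' \<and> set \<xi>s' \<subseteq> tangent_space P' L")
    case True
    define c' where "c' = some_chart P' L"
    have c': "c' \<in> charts_at P' L" unfolding c'_def using some_chart_in[OF P'] True by blast
    note cA = charts_atD[OF c']
    let ?x = "snd c' L"
    have x: "?x \<in> chart_image c'" using cA(2) by (rule chart_in_image)
    obtain S f where f: "open S" "?x \<in> S" "S \<subseteq> chart_image c'" "param P S f"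
      "\<And>x. x \<in> S \<Longrightarrow> \<pp> (f x) = chart_inv c' x"
      using local_section_of_chart[OF cA(1) x] by blast
    let ?H = "\<lambda>x us. reduced_form (chart_inv c' x) (map (coord_tvec P' c' (chart_inv c' x)) us)"
    let ?ws = "map (\<lambda>\<xi>. \<xi> c') \<xi>s'"
    have "ext_deriv P' reduced_form L \<xi>s' = local_ext_deriv ?H ?x ?ws"
      unfolding ext_deriv_def local_ext_deriv_def if_P[OF True] c'_def[symmetric] Let_def ..
    also have "\<dots> = local_ext_deriv (param_pullback P f \<omega>) ?x ?ws"
      by (rule local_ext_deriv_cong[OF f(1,2)]) (intro ext reduced_form_local_section(2)[OF cA(1) f(1,3,4,5)])
    also have "\<dots> = 0"
    proof (cases "length ?ws = Suc deg")
      case True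
      then show ?thesis by (rule param_pullback_closed[OF P \<omega>_forms \<omega>_closed f(4,2)])
    next
      \<comment> \<open>\<open>ext_deriv\<close> accepts lists of any length; here omitting an entry
        never leaves \<open>deg\<close> of them, so all coefficients are identically 0.\<close>
      case False
      have "frechet_derivative (\<lambda>x. param_pullback P f \<omega> x (take i ?ws @ drop (Suc i) ?ws)) (at ?x) v = 0"
        if i: "i < length ?ws" for i v
      proof -
        have "length (take i ?ws @ drop (Suc i) ?ws) = length ?ws - 1" using i by simp
        then have "length (take i ?ws @ drop (Suc i) ?ws) \<noteq> deg" using False i by simp
        then have "param_pullback P f \<omega> x (take i ?ws @ drop (Suc i) ?ws) = 0" for x
          unfolding param_pullback_def by (intro forms_improper[OF \<omega>_forms]) simp
        then show ?thesis by (simp only: frechet_derivative_const)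
      qed
      then show ?thesis unfolding local_ext_deriv_def by (intro sum.neutral) simp
    qed
    finally show ?thesis by simp
  next
    case False
    then show ?thesis unfolding ext_deriv_def if_not_P[OF False] by simp
  qed
qed

section \<open>Vertical vectors, nondegeneracy and uniqueness\<close>

lemma T\<alpha>'_T\<pp>:
  assumes y: "y \<in> carrier P" and \<xi>: "\<xi> \<in> tangent_space P y"
  shows "tangent_map P' M \<alpha>' (\<pp> y) (T\<pp> y \<xi>) = tangent_map P M \<alpha> y \<xi>"
  using tangent_map_compose[OF P P' M \<pp>_smooth \<alpha>'_smooth \<alpha>_smooth _ y \<xi>] \<alpha>'_\<pp> \<pp>_carrier by blast

text \<open>Both sides say that T\<alpha> kills \<xi>, as T\<alpha>' after T\<pp> is
  T\<alpha>.\<close>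

lemma T\<pp>_vertical_iff:
  assumes y: "y \<in> carrier P" and \<xi>: "\<xi> \<in> tangent_space P y"
  shows "T\<pp> y \<xi> \<in> vertical_space P' M \<alpha>' (\<pp> y) \<longleftrightarrow> \<xi> \<in> vertical_space P M \<alpha> y"
  using T\<alpha>'_T\<pp>[OF y \<xi>] tangent_map_tangent[OF P P' \<pp>_smooth y \<xi>] \<xi> unfolding vertical_space_def by simp

lemma lift_vertical:
  assumes y: "y \<in> carrier P" and \<xi>': "\<xi>' \<in> vertical_space P' M \<alpha>' (\<pp> y)"
  shows "lift y \<xi>' \<in> vertical_space P M \<alpha> y"
proof -
  have "\<xi>' \<in> tangent_space P' (\<pp> y)" using \<xi>' unfolding vertical_space_def by blast
  from lift[OF y this] show ?thesis using T\<pp>_vertical_iff[OF y] \<xi>' by metis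
qed

text \<open>The fields are evaluated at a leaf and lifted to vertical vectors at one of its points,
  where the degree condition on \<omega> holds for vectors by
  \<open>Lambda_forms_vertical\<close>.\<close>

lemma reduced_form_Lambda: "reduced_form \<in> Lambda_forms P' M \<alpha>' (mdim M - 1) deg"
proof -
  have "foldr interior Ys reduced_form = 0"
    if Ys: "set Ys \<subseteq> vertical_fields P' M \<alpha>'" "length Ys = deg - (mdim M - 1) + 1" for Ys
  proof (intro ext)
    fix L \<xi>s'
    let ?vs = "map (\<lambda>Y. Y L) (rev Ys)"
    have "reduced_form L (?vs @ \<xi>s') = 0"
    proof (cases "L \<in> carrier P' \<and> set \<xi>s' \<subseteq> tangent_space P' L")
      case True
      then obtain y where y: "y \<in> carrier P" "L = \<pp> y" by (auto elim: carrier_P'_cases)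
      have V: "set ?vs \<subseteq> vertical_space P' M \<alpha>' L"
        using Ys(1) True unfolding vertical_fields_def by auto
      then have sub: "set (?vs @ \<xi>s') \<subseteq> tangent_space P' (\<pp> y)"
        using True y(2) unfolding vertical_space_def by auto
      have "reduced_form L (?vs @ \<xi>s') = \<omega> y (map (lift y) ?vs @ map (lift y) \<xi>s')"
        using reduced_form_lift[OF y(1) sub] y(2) by simp
      also have "\<dots> = 0"
      proof (rule Lambda_forms_vertical[OF bundle_P \<omega>_Lambda _ y(1)])
        show "set (map (lift y) ?vs) \<subseteq> vertical_space P M \<alpha> y"
          using lift_vertical[OF y(1)] V y(2) by auto
        show "length (map (lift y) ?vs) = deg - (mdim M - 1) + 1" using Ys(2) by simp
      qed simp
      finally show ?thesis .
    next
      case False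
      then show ?thesis by (intro reduced_form_improper) auto
    qed
    then show "foldr interior Ys reduced_form L \<xi>s' = 0 L \<xi>s'" unfolding foldr_interior by simp
  qed
  then show ?thesis unfolding Lambda_forms_def using reduced_form_forms by simp
qed

lemma reduced_form_prehamiltonian: "PD_prehamiltonian P' M \<alpha>' reduced_form"
  unfolding PD_prehamiltonian_def Omega_def using reduced_form_Lambda reduced_form_closed by simp

lemma zero_vertical_field: "0 \<in> vertical_fields P' M \<alpha>'"
  unfolding vertical_fields_def using subspace_0[OF subspace_vertical_space[OF bundle_P']] by simp

lemma interior_zero: "interior 0 reduced_form = 0"
  using forms_zero_arg[OF P' reduced_form_forms, of _ "[]"] by (intro ext) (simp add: interior_def)

text \<open>A lift of a value of Y pairs to 0 with all vertical vectors, so it lies in the kernel of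
  the class at y. That kernel is tangent to the leaf, whence T\<pp> sends the lift to 0; but it also
  returns the value of Y.\<close>

lemma reduced_form_kernel_class: "ker_form_class P' M \<alpha>' reduced_form = {0}"
proof (intro equalityI subsetI)
  fix Y assume Y: "Y \<in> ker_form_class P' M \<alpha>' reduced_form"
  have YV: "Y \<in> vertical_fields P' M \<alpha>'" using Y unfolding ker_form_class_def by blast
  have "Y L = 0" for L
  proof (cases "L \<in> carrier P'")
    case False
    then show ?thesis using YV unfolding vertical_fields_def by blast
  next
    case True
    then obtain y where y: "y \<in> carrier P" "L = \<pp> y" by (rule carrier_P'_cases)
    have YL: "Y L \<in> vertical_space P' M \<alpha>' (\<pp> y)" using YV True y(2) unfolding vertical_fields_def by blast
    then have YT: "Y L \<in> tangent_space P' (\<pp> y)" unfolding vertical_space_def by blast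
    let ?\<xi> = "lift y (Y L)"
    note l = lift[OF y(1) YT]
    have "\<omega> y (?\<xi> # \<eta> # \<xi>s) = 0" if \<eta>: "\<eta> \<in> vertical_space P M \<alpha> y" for \<eta> \<xi>s
    proof (cases "set \<xi>s \<subseteq> tangent_space P y")
      case True
      have \<eta>T: "\<eta> \<in> tangent_space P y" using \<eta> unfolding vertical_space_def by blast
      have "T\<pp> y \<eta> \<in> vertical_space P' M \<alpha>' (\<pp> y)" using T\<pp>_vertical_iff[OF y(1) \<eta>T] \<eta> by blast
      \<comment> \<open>The hypothesis on Y can only be tested with global fields on
        \<open>P'\<close>, so the image of \<eta> is extended to one.\<close>
      then obtain W where W: "W \<in> vertical_fields P' M \<alpha>'" "W (\<pp> y) = T\<pp> y \<eta>"
        using vertical_extension[OF bundle_P' \<pp>_carrier[OF y(1)]] by blast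
      have "interior W (interior Y reduced_form) = 0" using Y W(1) unfolding ker_form_class_def by blast
      then have "interior W (interior Y reduced_form) (\<pp> y) (map (T\<pp> y) \<xi>s) = 0" by simp
      then have "reduced_form (\<pp> y) (map (T\<pp> y) (?\<xi> # \<eta> # \<xi>s)) = 0"
        using W(2) y(2) l(2) by (simp add: interior_def)
      then show ?thesis using reduced_form_T\<pp>[OF y(1), of "?\<xi> # \<eta> # \<xi>s"] l(1) \<eta>T True by simp
    next
      case False
      then show ?thesis by (intro forms_improper[OF \<omega>_forms]) auto
    qed
    then have "?\<xi> \<in> kernel_dist_class P M \<alpha> \<omega> y"
      unfolding kernel_dist_class_def using lift_vertical[OF y(1) YL] by blast
    then have "T\<pp> y ?\<xi> = 0"
      unfolding kernel_dist_class_eq_vertical[OF y(1)] vertical_space_def by blast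
    then show ?thesis using l(2) by simp
  qed
  then have "Y = 0" by (intro ext) simp
  then show "Y \<in> {0}" by simp
next
  fix Y :: "'p set \<Rightarrow> ('p set, 'h) tvec" assume "Y \<in> {0}"
  moreover have "interior W 0 = 0" for W :: "'p set \<Rightarrow> ('p set, 'h) tvec"
    by (intro ext) (simp add: interior_def)
  ultimately show "Y \<in> ker_form_class P' M \<alpha>' reduced_form"
    unfolding ker_form_class_def using zero_vertical_field interior_zero by simp
qed

lemma reduced_form_kernel: "ker_form P' M \<alpha>' reduced_form = {0}"
proof (intro equalityI subsetI)
  fix Y assume Y: "Y \<in> ker_form P' M \<alpha>' reduced_form"
  have "interior W 0 = 0" for W :: "'p set \<Rightarrow> ('p set, 'h) tvec"
    by (intro ext) (simp add: interior_def)
  then have "Y \<in> ker_form_class P' M \<alpha>' reduced_form"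
    using Y unfolding ker_form_class_def ker_form_def by simp
  then show "Y \<in> {0}" unfolding reduced_form_kernel_class .
next
  fix Y :: "'p set \<Rightarrow> ('p set, 'h) tvec" assume "Y \<in> {0}"
  then show "Y \<in> ker_form P' M \<alpha>' reduced_form"
    unfolding ker_form_def using zero_vertical_field interior_zero by simp
qed

lemma reduced_form_hamiltonian: "PD_hamiltonian P' M \<alpha>' reduced_form"
  unfolding PD_hamiltonian_def using reduced_form_prehamiltonian reduced_form_kernel_class by blast

text \<open>Pullback along \<pp> is injective on forms, because \<pp> and its tangent maps are
  surjective.\<close>

lemma reduced_form_unique:
  assumes "PD_hamiltonian P' M \<alpha>' \<omega>'" "\<omega> = pullback P P' \<pp> \<omega>'"
  shows "\<omega>' = reduced_form"
proof (intro ext)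
  fix L \<xi>s'
  have \<omega>': "\<omega>' \<in> forms P' deg"
    using assms(1) unfolding PD_hamiltonian_def PD_prehamiltonian_def Omega_def Lambda_forms_def
    by (simp split: if_splits)
  show "\<omega>' L \<xi>s' = reduced_form L \<xi>s'"
  proof (cases "L \<in> carrier P' \<and> set \<xi>s' \<subseteq> tangent_space P' L")
    case True
    then obtain y where y: "y \<in> carrier P" "L = \<pp> y" by (auto elim: carrier_P'_cases)
    then have sub: "set \<xi>s' \<subseteq> tangent_space P' (\<pp> y)" using True by simp
    note l = lift_list[OF y(1) sub]
    have "\<omega> y (map (lift y) \<xi>s') = pullback P P' \<pp> \<omega>' y (map (lift y) \<xi>s')" using assms(2) by simp
    also have "\<dots> = \<omega>' (\<pp> y) \<xi>s'" unfolding pullback_def if_P[OF conjI[OF y(1) l(1)]] l(2) ..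
    finally show ?thesis using reduced_form_lift[OF y(1) sub] y(2) by simp
  next
    case False
    then have "\<omega>' L \<xi>s' = 0"
      using forms_off_carrier[OF \<omega>', of L] forms_improper[OF \<omega>', of \<xi>s' L] by (cases "L \<in> carrier P'") auto
    then show ?thesis using reduced_form_improper[OF False] by simp
  qed
qed

section \<open>Correspondence of solutions\<close>

lemma local_section_\<pp>:
  assumes \<sigma>: "local_section P M \<alpha> U \<sigma>"
  shows "local_section P' M \<alpha>' U (\<pp> \<circ> \<sigma>)"
  unfolding local_section_def
proof (intro conjI ballI)
  note \<sigma>s = local_section_smooth[OF \<sigma>]
  show "smooth_map M P' U (\<pp> \<circ> \<sigma>)"
    using smooth_map_maps[OF \<sigma>s] by (intro smooth_map_compose[OF M P P' \<sigma>s \<pp>_smooth]) blast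
  show "\<alpha>' ((\<pp> \<circ> \<sigma>) x) = x" if "x \<in> U" for x
    using \<alpha>'_\<pp>[OF smooth_map_maps[OF \<sigma>s that]] \<sigma> that unfolding local_section_def by simp
qed

text \<open>T\<pp> intertwines the horizontal projections belonging to \<sigma> and to
  \<open>\<pp> \<circ> \<sigma>\<close>. It therefore maps the argument list of each summand to the
  corresponding list on \<open>P'\<close>, and \<open>reduced_form_T\<pp>\<close> equates the
  values.\<close>

lemma jet_contraction_\<pp>:
  assumes \<sigma>: "local_section P M \<alpha> U \<sigma>" and x: "x \<in> U" and \<xi>s: "set \<xi>s \<subseteq> tangent_space P (\<sigma> x)"
  shows "jet_contraction P' M \<alpha>' (\<pp> (\<sigma> x)) (jet_prolongation P' M (\<pp> \<circ> \<sigma>) x) reduced_form (map (T\<pp> (\<sigma> x)) \<xi>s) =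
    jet_contraction P M \<alpha> (\<sigma> x) (jet_prolongation P M \<sigma> x) \<omega> \<xi>s"
proof -
  note \<sigma>s = local_section_smooth[OF \<sigma>] and \<tau> = local_section_\<pp>[OF \<sigma>]
  let ?y = "\<sigma> x" and ?T = "T\<pp> (\<sigma> x)"
  let ?h = "horizontal_part (jet_prolongation P M \<sigma> x) (vertical_space P M \<alpha> ?y)"
  let ?h' = "horizontal_part (jet_prolongation P' M (\<pp> \<circ> \<sigma>) x) (vertical_space P' M \<alpha>' (\<pp> ?y))"
  have y: "?y \<in> carrier P" by (rule smooth_map_maps[OF \<sigma>s x])
  have h_T: "?h \<xi> \<in> tangent_space P ?y" if "\<xi> \<in> tangent_space P ?y" for \<xi>
    unfolding horizontal_part_local_section[OF bundle_P \<sigma> x that]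
    by (rule local_section_split(2)[OF bundle_P \<sigma> x that])
  have h': "?h' (?T \<xi>) = ?T (?h \<xi>)" if \<xi>: "\<xi> \<in> tangent_space P ?y" for \<xi>
  proof -
    have T\<xi>: "?T \<xi> \<in> tangent_space P' ((\<pp> \<circ> \<sigma>) x)" using tangent_map_tangent[OF P P' \<pp>_smooth y \<xi>] by simp
    have v: "tangent_map P M \<alpha> ?y \<xi> \<in> tangent_space M x"
      using tangent_map_tangent[OF P M \<alpha>_smooth y \<xi>] \<sigma> x unfolding local_section_def by simp
    have "?h' (?T \<xi>) = tangent_map M P' (\<pp> \<circ> \<sigma>) x (tangent_map P' M \<alpha>' (\<pp> ?y) (?T \<xi>))"
      using horizontal_part_local_section[OF bundle_P' \<tau> x T\<xi>] unfolding o_apply .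
    also have "\<dots> = tangent_map M P' (\<pp> \<circ> \<sigma>) x (tangent_map P M \<alpha> ?y \<xi>)"
      by (simp only: T\<alpha>'_T\<pp>[OF y \<xi>])
    also have "\<dots> = ?T (tangent_map M P \<sigma> x (tangent_map P M \<alpha> ?y \<xi>))"
      by (rule tangent_map_compose[OF M P P' \<sigma>s \<pp>_smooth local_section_smooth[OF \<tau>] _ x v, symmetric])
        (use smooth_map_maps[OF \<sigma>s] in simp)
    finally show ?thesis unfolding horizontal_part_local_section[OF bundle_P \<sigma> x \<xi>] .
  qed
  have nth_T: "\<xi>s ! i \<in> tangent_space P ?y" if "i < length \<xi>s" for i using \<xi>s that nth_mem by blast
  have "horizontal_component (jet_prolongation P' M (\<pp> \<circ> \<sigma>) x) (vertical_space P' M \<alpha>' (\<pp> ?y)) (mdim M)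
      (reduced_form (\<pp> ?y)) (map ?T \<xi>s) =
    horizontal_component (jet_prolongation P M \<sigma> x) (vertical_space P M \<alpha> ?y) (mdim M) (\<omega> ?y) \<xi>s"
    unfolding horizontal_component_def length_map
  proof (rule sum.cong[OF refl])
    fix S
    let ?l = "map (\<lambda>i. if i \<in> S then ?h (\<xi>s ! i) else \<xi>s ! i - ?h (\<xi>s ! i)) [0..<length \<xi>s]"
    let ?l' = "map (\<lambda>i. if i \<in> S then ?h' (map ?T \<xi>s ! i) else map ?T \<xi>s ! i - ?h' (map ?T \<xi>s ! i)) [0..<length \<xi>s]"
    have "?l' = map ?T ?l"
      unfolding map_map
    proof (rule map_cong[OF refl])
      fix i assume "i \<in> set [0..<length \<xi>s]"
      then have i: "i < length \<xi>s" by simp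
      show "(if i \<in> S then ?h' (map ?T \<xi>s ! i) else map ?T \<xi>s ! i - ?h' (map ?T \<xi>s ! i)) =
        (?T \<circ> (\<lambda>i. if i \<in> S then ?h (\<xi>s ! i) else \<xi>s ! i - ?h (\<xi>s ! i))) i"
        unfolding o_apply nth_map[OF i] h'[OF nth_T[OF i]]
        by (simp only: tangent_map_diff[OF P P' \<pp>_smooth y nth_T[OF i] h_T[OF nth_T[OF i]]] if_distrib[of ?T])
    qed
    moreover have "set ?l \<subseteq> tangent_space P ?y"
      using nth_T h_T subspace_diff[OF subspace_tangent_space[OF P y]] by auto
    ultimately show "reduced_form (\<pp> ?y) ?l' = \<omega> ?y ?l"
      using reduced_form_T\<pp>[OF y, of ?l] by (simp only:)
  qed
  moreover have "set (map ?T \<xi>s) \<subseteq> tangent_space P' (\<pp> ?y)"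
    using \<xi>s tangent_map_tangent[OF P P' \<pp>_smooth y] by auto
  ultimately show ?thesis unfolding jet_contraction_def using \<xi>s by (simp only: if_True)
qed

text \<open>The contractions agree on corresponding lists, and every list of tangent vectors of
  \<open>P'\<close> is the image of its lifts, so one contraction vanishes exactly when the other
  does.\<close>

lemma PD_solution_iff:
  assumes \<sigma>: "local_section P M \<alpha> U \<sigma>"
  shows "PD_solution P M \<alpha> \<omega> U \<sigma> \<longleftrightarrow> PD_solution P' M \<alpha>' reduced_form U (\<pp> \<circ> \<sigma>)"
proof -
  note \<tau> = local_section_\<pp>[OF \<sigma>]
  have "jet_contraction P M \<alpha> (\<sigma> x) (jet_prolongation P M \<sigma> x) \<omega> = 0 \<longleftrightarrow>
    jet_contraction P' M \<alpha>' ((\<pp> \<circ> \<sigma>) x) (jet_prolongation P' M (\<pp> \<circ> \<sigma>) x) reduced_form = 0" (is "?f = 0 \<longleftrightarrow> ?f' = 0")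
    if x: "x \<in> U" for x
  proof
    have y: "\<sigma> x \<in> carrier P" by (rule smooth_map_maps[OF local_section_smooth[OF \<sigma>] x])
    note eq = jet_contraction_\<pp>[OF \<sigma> x]
    {
      assume f: "?f = 0"
      show "?f' = 0"
      proof (rule ext)
        fix \<xi>s'
        show "?f' \<xi>s' = 0 \<xi>s'"
        proof (cases "set \<xi>s' \<subseteq> tangent_space P' (\<pp> (\<sigma> x))")
          case True
          show ?thesis using eq[OF lift_list(1)[OF y True]] f unfolding lift_list(2)[OF y True] by simp
        qed (simp add: jet_contraction_def)
      qed
    }
    assume f': "?f' = 0"
    show "?f = 0"
    proof (rule ext)
      fix \<xi>s
      show "?f \<xi>s = 0 \<xi>s"
      proof (cases "set \<xi>s \<subseteq> tangent_space P (\<sigma> x)")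
        case True
        show ?thesis using eq[OF True] f' by simp
      qed (simp add: jet_contraction_def)
    qed
  qed
  then show ?thesis
    unfolding PD_solution_def
    using \<sigma> \<tau> jet_prolongation_jet_point[OF bundle_P \<sigma>] jet_prolongation_jet_point[OF bundle_P' \<tau>] by simp
qed

end

theorem theorem6p6:
  fixes M :: "('m, 'b::real_normed_vector) manifold"
    and P :: "('p, 'e::real_normed_vector) manifold"
    and F :: "('f, 'g::real_normed_vector) manifold"
    and \<alpha> :: "'p \<Rightarrow> 'm"
    and \<omega> :: "('p, 'e) form"
    and P' :: "('p set, 'h::real_normed_vector) manifold"
    and F' :: "('i, 'j::real_normed_vector) manifold"
    and \<alpha>' :: "'p set \<Rightarrow> 'm"
    and G :: "('l, 'k::real_normed_vector) manifold"
    and \<pp> :: "'p \<Rightarrow> 'p set"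
  assumes "fiber_bundle P M F \<alpha>" and "carrier F \<noteq> {}" and "connected_space (mtop F)"
    and "PD_prehamiltonian P M \<alpha> \<omega>"
    and "constant_rank P (kernel_dist_class P M \<alpha> \<omega>)"
    and "ker_form P M \<alpha> \<omega> = ker_form_class P M \<alpha> \<omega>"
    and "carrier P' = leaves TYPE('k) P (kernel_dist P M \<alpha> \<omega>)"
    and "\<And>y L. y \<in> carrier P \<Longrightarrow>
           L \<in> leaves TYPE('k) P (kernel_dist P M \<alpha> \<omega>) \<and> y \<in> L \<longleftrightarrow> L = \<pp> y"
    and "\<And>y. y \<in> carrier P \<Longrightarrow> \<alpha>' (\<pp> y) = \<alpha> y"
    and "fiber_bundle P' M F' \<alpha>'"
    and "fiber_bundle P P' G \<pp>"
  shows "\<exists>!\<omega>'. PD_hamiltonian P' M \<alpha>' \<omega>' \<and>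
           \<omega> = pullback P P' \<pp> \<omega>' \<and>
           (ker_form P' M \<alpha>' \<omega>' = {0} \<and> ker_form_class P' M \<alpha>' \<omega>' = {0}) \<and>
           (\<forall>U \<sigma>. local_section P M \<alpha> U \<sigma> \<longrightarrow>
              local_section P' M \<alpha>' U (\<pp> \<circ> \<sigma>) \<and>
              (PD_solution P M \<alpha> \<omega> U \<sigma> \<longleftrightarrow> PD_solution P' M \<alpha>' \<omega>' U (\<pp> \<circ> \<sigma>)))"
proof -
  interpret leaf_reduction M P F \<alpha> \<omega> P' F' \<alpha>' G \<pp>
    using assms(1,4-6,8-11) by unfold_locales
  show ?thesis
  proof (rule ex1I[of _ reduced_form], intro conjI allI impI)
    show "PD_hamiltonian P' M \<alpha>' reduced_form" by (rule reduced_form_hamiltonian)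
    show "\<omega> = pullback P P' \<pp> reduced_form" by (rule pullback_reduced_form)
    show "ker_form P' M \<alpha>' reduced_form = {0}" by (rule reduced_form_kernel)
    show "ker_form_class P' M \<alpha>' reduced_form = {0}" by (rule reduced_form_kernel_class)
    fix U \<sigma> assume \<sigma>: "local_section P M \<alpha> U \<sigma>"
    show "local_section P' M \<alpha>' U (\<pp> \<circ> \<sigma>)" by (rule local_section_\<pp>[OF \<sigma>])
    show "PD_solution P M \<alpha> \<omega> U \<sigma> \<longleftrightarrow> PD_solution P' M \<alpha>' reduced_form U (\<pp> \<circ> \<sigma>)"
      by (rule PD_solution_iff[OF \<sigma>])
  qed (rule reduced_form_unique, (elim conjE, assumption)+)
qed

end
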